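(* Let $\alpha,\beta\in\mathbb{R}\setminus\mathbb{Q}$. The Sturmian systems $(X_\alpha,\sigma_\alpha)$ and $(X_\beta,\sigma_\beta)$ are eventually flow equivalent if and only if they are topologically conjugate.
   Context: A system $(X,S)$ is a non-empty compact metric space $X$ with a homeomorphism $S$. Topological conjugacy of $(X,S)$ and $(Y,T)$ means existence of a homeomorphism $h:X\to Y$ with $hS=Th$. Sturmian systems. For irrational $\alpha\in\mathbb{R}/\mathbb{Z}$ (represented in $(0,1)$), define $x\in\{0,1\}^{\mathbb{Z}}$ by $x_n=0$ if $n\alpha\bmod1\in[0,1-\alpha)$ and $x_n=1$ if $n\alpha\bmod 1\in[1-\alpha,1)$. $X_\alpha$ is the closure of the shift orbit of $x$ and $\sigma_\alpha$ is the restriction of the shift. Flow equivalence. The suspension of $(X,S)$ is $\Sigma_SX=(X\times\mathbb{R})/\mathbb{Z}$, where $n\cdot(x,s)=(S^n(x),s-n)$, with flow $(x,s)\mapsto(x,s+s')$. Two systems are flow equivalent if there is a homeomorphism between their suspensions mapping flow orbits onto flow orbits and preserving their orientation. $(X,S)$ and $(Y,T)$ are eventually flow equivalent if $(X,S^n)$ and $(Y,T^n)$ are flow equivalent for all but finitely many $n\in\mathbb{N}$. *)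

theory Defs
  imports "HOL-Analysis.Analysis"
begin

(* Systems are given by an abstract topology X and a map S of the ambient type;
   only the values of S on topspace X matter in all notions below. *)

definition dynamical_system :: "'a topology \<Rightarrow> ('a \<Rightarrow> 'a) \<Rightarrow> bool" where
  "dynamical_system X S \<longleftrightarrow>
     topspace X \<noteq> {} \<and> compact_space X \<and> metrizable_space X \<and> homeomorphic_map X X S"

definition topologically_conjugate ::
    "'a topology \<Rightarrow> ('a \<Rightarrow> 'a) \<Rightarrow> 'b topology \<Rightarrow> ('b \<Rightarrow> 'b) \<Rightarrow> bool" where
  "topologically_conjugate X S Y T \<longleftrightarrow>
     (\<exists>h. homeomorphic_map X Y h \<and> (\<forall>x\<in>topspace X. h (S x) = T (h x)))"


definition int_iterate :: "'a topology \<Rightarrow> ('a \<Rightarrow> 'a) \<Rightarrow> int \<Rightarrow> 'a \<Rightarrow> 'a" where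
  "int_iterate X S n =
     (if n \<ge> 0 then S ^^ nat n else inv_into (topspace X) S ^^ nat (- n))"

text \<open>Points of the suspension are the orbits of the integer action
  \<open>n \<cdot> (x, s) = (S\<^sup>n x, s - n)\<close> on \<open>X \<times> \<real>\<close>, as sets of pairs.\<close>

definition suspension_class ::
    "'a topology \<Rightarrow> ('a \<Rightarrow> 'a) \<Rightarrow> 'a \<times> real \<Rightarrow> ('a \<times> real) set" where
  "suspension_class X S p =
     range (\<lambda>n::int. (int_iterate X S n (fst p), snd p - of_int n))"

definition suspension :: "'a topology \<Rightarrow> ('a \<Rightarrow> 'a) \<Rightarrow> ('a \<times> real) set topology" where
  "suspension X S = topology (\<lambda>U.
     U \<subseteq> suspension_class X S ` topspace (prod_topology X euclideanreal) \<and>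
     openin (prod_topology X euclideanreal)
       {p \<in> topspace (prod_topology X euclideanreal). suspension_class X S p \<in> U})"

lemma istopology_quotient:
  "istopology (\<lambda>U. U \<subseteq> f ` topspace Z \<and> openin Z {p \<in> topspace Z. f p \<in> U})"
proof -
  have "openin Z {p \<in> topspace Z. f p \<in> A \<inter> B}"
    if "openin Z {p \<in> topspace Z. f p \<in> A}" "openin Z {p \<in> topspace Z. f p \<in> B}" for A B
  proof -
    have "{p \<in> topspace Z. f p \<in> A \<inter> B} = {p \<in> topspace Z. f p \<in> A} \<inter> {p \<in> topspace Z. f p \<in> B}"
      by auto
    then show ?thesis using openin_Int[OF that] by simp
  qed
  moreover have "openin Z {p \<in> topspace Z. f p \<in> \<Union>K}"
    if "\<forall>A\<in>K. openin Z {p \<in> topspace Z. f p \<in> A}" for K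
  proof -
    have "{p \<in> topspace Z. f p \<in> \<Union>K} = (\<Union>A\<in>K. {p \<in> topspace Z. f p \<in> A})"
      by auto
    moreover have "openin Z (\<Union>A\<in>K. {p \<in> topspace Z. f p \<in> A})"
      using that by (intro openin_Union) auto
    ultimately show ?thesis by simp
  qed
  ultimately show ?thesis
    unfolding istopology_def by (simp add: le_infI1 Sup_least)
qed

lemma openin_suspension:
  "openin (suspension X S) U \<longleftrightarrow>
     U \<subseteq> suspension_class X S ` topspace (prod_topology X euclideanreal) \<and>
     openin (prod_topology X euclideanreal)
       {p \<in> topspace (prod_topology X euclideanreal). suspension_class X S p \<in> U}"
  unfolding suspension_def by (simp only: topology_inverse'[OF istopology_quotient])

lemma topspace_suspension:
  "topspace (suspension X S) =
     suspension_class X S ` topspace (prod_topology X euclideanreal)"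
proof
  show "topspace (suspension X S) \<subseteq>
      suspension_class X S ` topspace (prod_topology X euclideanreal)"
    using openin_suspension[of X S "topspace (suspension X S)"] by simp
  have "{p \<in> topspace (prod_topology X euclideanreal).
      suspension_class X S p \<in> suspension_class X S ` topspace (prod_topology X euclideanreal)}
      = topspace (prod_topology X euclideanreal)"
    by blast
  then have "openin (suspension X S)
      (suspension_class X S ` topspace (prod_topology X euclideanreal))"
    unfolding openin_suspension by (metis openin_topspace subset_refl)
  then show "suspension_class X S ` topspace (prod_topology X euclideanreal)
      \<subseteq> topspace (suspension X S)"
    by (rule openin_subset)
qed

lemma quotient_map_suspension:
  "quotient_map (prod_topology X euclideanreal) (suspension X S) (suspension_class X S)"
  unfolding quotient_map_def
proof (intro conjI allI impI)
  show "suspension_class X S ` topspace (prod_topology X euclideanreal)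
      = topspace (suspension X S)"
    by (rule topspace_suspension[symmetric])
next
  fix U assume "U \<subseteq> topspace (suspension X S)"
  then show "openin (prod_topology X euclideanreal)
      {p \<in> topspace (prod_topology X euclideanreal). suspension_class X S p \<in> U}
      \<longleftrightarrow> openin (suspension X S) U"
    unfolding openin_suspension topspace_suspension by (rule iffI[OF conjI conjunct2])
qed


text \<open>The translation \<open>(x, s) \<mapsto> (x, s + t)\<close> commutes with the integer action, so the flow
  on the suspension is obtained by translating a whole class.\<close>

definition suspension_flow :: "real \<Rightarrow> ('a \<times> real) set \<Rightarrow> ('a \<times> real) set" where
  "suspension_flow t c = (\<lambda>(x, s). (x, s + t)) ` c"

lemma suspension_flow_class:
  "suspension_flow t (suspension_class X S (x, s)) = suspension_class X S (x, s + t)"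
  by (simp add: suspension_flow_def suspension_class_def image_image diff_add_eq)

definition flow_orbit :: "('a \<times> real) set \<Rightarrow> ('a \<times> real) set set" where
  "flow_orbit c = range (\<lambda>t. suspension_flow t c)"

text \<open>Orientation of orbits is preserved: along each orbit the map is given, in the time
  parameters of the two flows, by an increasing homeomorphism \<open>\<theta>\<close> of the real line.\<close>

definition flow_equivalent ::
    "'a topology \<Rightarrow> ('a \<Rightarrow> 'a) \<Rightarrow> 'b topology \<Rightarrow> ('b \<Rightarrow> 'b) \<Rightarrow> bool" where
  "flow_equivalent X S Y T \<longleftrightarrow>
     (\<exists>h. homeomorphic_map (suspension X S) (suspension Y T) h \<and>
       (\<forall>c\<in>topspace (suspension X S).
          h ` flow_orbit c = flow_orbit (h c) \<and>
          (\<exists>\<theta>::real \<Rightarrow> real. homeomorphic_map euclideanreal euclideanreal \<theta> \<and> strict_mono \<theta> \<and>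
             (\<forall>t. h (suspension_flow t c) = suspension_flow (\<theta> t) (h c)))))"

definition eventually_flow_equivalent ::
    "'a topology \<Rightarrow> ('a \<Rightarrow> 'a) \<Rightarrow> 'b topology \<Rightarrow> ('b \<Rightarrow> 'b) \<Rightarrow> bool" where
  "eventually_flow_equivalent X S Y T \<longleftrightarrow>
     finite {n::nat. n \<ge> 1 \<and> \<not> flow_equivalent X (S ^^ n) Y (T ^^ n)}"


definition full_shift :: "(int \<Rightarrow> nat) topology" where
  "full_shift = product_topology (\<lambda>_. discrete_topology {0, 1}) UNIV"

definition shift :: "(int \<Rightarrow> nat) \<Rightarrow> int \<Rightarrow> nat" where
  "shift y = (\<lambda>n. y (n + 1))"

text \<open>\<open>frac \<alpha>\<close> is the representative of \<open>\<alpha>\<close> modulo 1; it lies in \<open>(0, 1)\<close> for irrational \<open>\<alpha>\<close>.\<close>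

definition sturmian_point :: "real \<Rightarrow> int \<Rightarrow> nat" where
  "sturmian_point \<alpha> n = (if frac (of_int n * \<alpha>) \<in> {0..<1 - frac \<alpha>} then 0 else 1)"

definition sturmian_orbit :: "real \<Rightarrow> (int \<Rightarrow> nat) set" where
  "sturmian_orbit \<alpha> = range (\<lambda>k::int. int_iterate full_shift shift k (sturmian_point \<alpha>))"

definition sturmian_space :: "real \<Rightarrow> (int \<Rightarrow> nat) topology" where
  "sturmian_space \<alpha> = subtopology full_shift (full_shift closure_of sturmian_orbit \<alpha>)"

definition sturmian_map :: "real \<Rightarrow> (int \<Rightarrow> nat) \<Rightarrow> int \<Rightarrow> nat" where
  "sturmian_map \<alpha> = restrict shift (topspace (sturmian_space \<alpha>))"


lemma topspace_full_shift: "topspace full_shift = {y. \<forall>n. y n \<in> {0, 1}}"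
  by (simp only: full_shift_def topspace_product_topology topspace_discrete_topology
      PiE_UNIV_domain Pi_def UNIV_I simp_thms)

lemma continuous_map_full_shift_reindex:
  "continuous_map full_shift full_shift (\<lambda>y n. y (f n))"
proof -
  have "continuous_map full_shift (discrete_topology {0, 1}) (\<lambda>y. y (f n))" for n
    unfolding full_shift_def
    by (rule continuous_map_product_projection[where X = "\<lambda>_. discrete_topology {0, 1}"]) (rule UNIV_I)
  then show ?thesis
    by (subst (2) full_shift_def) (simp only: continuous_map_componentwise_UNIV simp_thms)
qed

lemma homeomorphic_map_shift: "homeomorphic_map full_shift full_shift shift"
proof -
  have "homeomorphic_maps full_shift full_shift shift (\<lambda>y n. y (n - 1))"
    using continuous_map_full_shift_reindex[of "\<lambda>n. n + 1"]
      continuous_map_full_shift_reindex[of "\<lambda>n. n - 1"]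
    by (auto simp: homeomorphic_maps_def shift_def [abs_def])
  then show ?thesis by (rule homeomorphic_maps_imp_map)
qed

lemma inv_into_shift:
  assumes "y \<in> topspace full_shift"
  shows "inv_into (topspace full_shift) shift y = (\<lambda>n. y (n - 1))"
proof (rule inv_into_f_eq)
  show "inj_on shift (topspace full_shift)"
    by (rule homeomorphic_imp_injective_map[OF homeomorphic_map_shift])
  show "(\<lambda>n. y (n - 1)) \<in> topspace full_shift"
    using assms unfolding topspace_full_shift by blast
qed (simp add: shift_def)

lemma int_iterate_shift:
  assumes "y \<in> topspace full_shift"
  shows "int_iterate full_shift shift k y = (\<lambda>n. y (n + k))"
proof (cases "k \<ge> 0")
  case True
  have "(shift ^^ m) y = (\<lambda>n. y (n + int m))" for m
    by (induction m) (auto simp: shift_def algebra_simps)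
  then show ?thesis using True by (simp add: int_iterate_def)
next
  case False
  have "(inv_into (topspace full_shift) shift ^^ m) y = (\<lambda>n. y (n - int m))" for m
  proof (induction m)
    case (Suc m)
    have "(\<lambda>n. y (n - int m)) \<in> topspace full_shift"
      using assms unfolding topspace_full_shift by blast
    then show ?case using Suc by (simp add: inv_into_shift algebra_simps)
  qed simp
  then show ?thesis using False by (simp add: int_iterate_def)
qed

lemma sturmian_orbit_eq: "sturmian_orbit \<alpha> = range (\<lambda>k n. sturmian_point \<alpha> (n + k))"
proof -
  have "sturmian_point \<alpha> \<in> topspace full_shift"
    by (simp add: topspace_full_shift sturmian_point_def)
  then show ?thesis by (simp only: sturmian_orbit_def int_iterate_shift)
qed

lemma dynamical_system_sturmian: "dynamical_system (sturmian_space \<alpha>) (sturmian_map \<alpha>)"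
proof -
  let ?O = "sturmian_orbit \<alpha>"
  let ?C = "full_shift closure_of ?O"
  have sub: "?O \<subseteq> topspace full_shift"
    by (simp add: sturmian_orbit_eq topspace_full_shift sturmian_point_def image_subset_iff)
  have top: "topspace (sturmian_space \<alpha>) = ?C"
    unfolding sturmian_space_def
    by (rule topspace_subtopology_subset[OF closure_of_subset_topspace])
  have "?O \<noteq> {}" by (simp add: sturmian_orbit_def)
  then have ne: "?C \<noteq> {}" using closure_of_subset[OF sub] by blast
  have "compact_space full_shift"
    unfolding full_shift_def by (simp add: compact_space_product_topology compact_space_discrete_topology)
  then have comp: "compact_space (sturmian_space \<alpha>)"
    unfolding sturmian_space_def
    by (intro compact_space_subtopology closedin_compact_space) auto
  have "metrizable_space full_shift"
    unfolding full_shift_def by (simp add: metrizable_space_product_topology)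
  then have metr: "metrizable_space (sturmian_space \<alpha>)"
    unfolding sturmian_space_def by (rule metrizable_space_subtopology)
  have "shift ` ?O = ?O"
  proof -
    have "shift (\<lambda>n. sturmian_point \<alpha> (n + k)) = (\<lambda>n. sturmian_point \<alpha> (n + (k + 1)))" for k
      by (simp add: shift_def algebra_simps)
    then have "shift ` ?O = (\<lambda>k n. sturmian_point \<alpha> (n + k)) ` range (\<lambda>k::int. k + 1)"
      by (simp only: sturmian_orbit_eq image_image)
    also have "range (\<lambda>k::int. k + 1) = UNIV" by (rule surjI[where f = "\<lambda>k. k - 1"]) simp
    finally show ?thesis by (simp add: sturmian_orbit_eq)
  qed
  then have inv: "shift ` ?C = ?C"
    using homeomorphic_map_closure_of[OF homeomorphic_map_shift sub] by simp
  have "homeomorphic_map (sturmian_space \<alpha>) (sturmian_space \<alpha>) shift"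
    unfolding sturmian_space_def
    using homeomorphic_map_subtopologies[OF homeomorphic_map_shift, of ?C ?C] inv
    by (simp add: Int_absorb1 closure_of_subset_topspace)
  then have "homeomorphic_map (sturmian_space \<alpha>) (sturmian_space \<alpha>) (sturmian_map \<alpha>)"
    by (rule homeomorphic_map_eq) (simp add: sturmian_map_def)
  then show ?thesis
    using ne comp metr top by (simp add: dynamical_system_def)
qed

end

theory Submission
  imports Defs
begin

text \<open>
  A flow equivalence \<open>h\<close> between the suspensions of \<open>\<sigma>\<^sub>\<alpha>\<^sup>n\<close> and \<open>\<sigma>\<^sub>\<beta>\<^sup>n\<close> lifts, over the zero-dimensional
  bases, to a continuous map \<open>\<phi>\<close> between the bases that sends orbits to orbits with a continuous integer
  time change \<open>N\<close>; likewise \<open>h\<inverse>\<close> gives \<open>\<psi>\<close> and \<open>M\<close>. Every continuous integer-valued function on a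
  Sturmian system is an integral combination of \<open>1\<close> and the coordinates, so by equidistribution its
  mean lies in \<open>\<int> + \<int>\<alpha>\<close>, and pulling back along \<open>\<phi>\<close> multiplies means by the mean of \<open>N\<close>. Hence the mean
  \<open>\<lambda>\<close> of \<open>M\<close> satisfies \<open>\<lambda>(\<int> + \<int>\<alpha>) = \<int> + \<int>\<beta>\<close>. Moreover \<open>M\<close> sums to the same value along the two points
  of an asymptotic pair, as the rotation factor shows, and this forces \<open>\<lambda> \<in> \<int> + n\<int>\<beta>\<close>.
  So for all large \<open>n\<close> there is an integral matrix of determinant \<open>\<plusminus>1\<close>, with upper right entry divisible
  by \<open>n\<close>, taking \<open>\<beta>\<close> to \<open>\<alpha>\<close>. If that entry never vanishes, two such matrices show that \<open>\<beta>\<close>, hence \<open>\<alpha>\<close>, is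
  quadratic. Taking for \<open>n\<close> a multiple of both leading coefficients then makes \<open>\<lambda>\<close> a unit, and multiplying
  out gives \<open>\<alpha> = \<plusminus>\<beta>\<close> modulo \<open>1\<close>, in which case the identity or the exchange of \<open>0\<close> and \<open>1\<close> is a conjugacy.
\<close>

section \<open>Integral relations between irrational numbers\<close>

text \<open>For \<open>n = 1\<close> the divisibility condition is void and only equivalence of
  \<alpha> and \<beta> under integral fractional linear maps remains; it is the growth of
  \<open>n\<close> that separates the systems. The obstacle on the topological side is that a flow
  equivalence need not carry base to base, and that the time of an image point is known only modulo
  1. Replacing it by \<phi> and \<open>N\<close> leaves statements about integer-valued functions
  with finite windows. The price is that \<psi> after \<phi> is the identity only up to a move along
  the orbit. That move is bounded, hence invisible to means, which is why the means of
  \<open>N\<close> and \<open>M\<close> are inverse to each other and both integral matrices are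
  invertible. Nothing prevents \<open>N\<close> from vanishing or being negative at some points, so
  all sums are taken with sign and all means are uniform in the point and in positive and negative
  times.\<close>

lemma irrational_linear_eq_0:
  fixes x :: real and p q :: int
  assumes "x \<notin> \<rat>" "of_int p + of_int q * x = 0"
  shows "p = 0" "q = 0"
proof -
  show "q = 0"
  proof (rule ccontr)
    assume "q \<noteq> 0"
    then have "x = - of_int p / of_int q"
      using assms(2) by (simp add: field_simps add_eq_0_iff)
    then have "x \<in> \<rat>" by simp
    with assms(1) show False by simp
  qed
  then show "p = 0" using assms(2) by simp
qed

lemma irrational_linear_eq_iff:
  fixes x :: real and p q p' q' :: int
  assumes "x \<notin> \<rat>" "of_int p + of_int q * x = of_int p' + of_int q' * x"
  shows "p = p'" "q = q'"
  using irrational_linear_eq_0[OF assms(1), of "p - p'" "q - q'"] assms(2)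
  by (simp_all add: algebra_simps)

text \<open>The fractional linear action of an integral matrix of determinant \<plusminus>1, in
  Hecke congruence form of level \<open>n\<close>, sending \<open>y\<close> to \<open>x\<close>. It
  is written without a denominator so that the relation can be compared coefficientwise.\<close>

definition modular_relation :: "nat \<Rightarrow> real \<Rightarrow> real \<Rightarrow> int \<Rightarrow> int \<Rightarrow> int \<Rightarrow> int \<Rightarrow> bool" where
  "modular_relation n x y a b c d \<longleftrightarrow>
     \<bar>a * d - b * c\<bar> = 1 \<and> int n dvd b \<and>
     x * (of_int a + of_int b * y) = of_int c + of_int d * y"

text \<open>The adjugate matrix is the inverse up to sign, and its upper right entry is
  \<open>- b\<close>, so the congruence survives.\<close>

lemma modular_relation_swap:
  assumes "modular_relation n x y a b c d"
  shows "modular_relation n y x d (- b) (- c) a"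
  using assms unfolding modular_relation_def
  by (auto simp: algebra_simps abs_if)

lemma modular_relation_b_0:
  assumes "modular_relation n x y a 0 c d"
  shows "\<exists>k::int. x = y + of_int k \<or> x = - y + of_int k"
proof -
  have *: "\<bar>a\<bar> * \<bar>d\<bar> = 1" "x * of_int a = of_int c + of_int d * y"
    using assms by (auto simp: modular_relation_def abs_mult)
  have "a = 1 \<or> a = -1" "d = 1 \<or> d = -1"
    using *(1) by (auto simp: zmult_eq_1_iff abs_if split: if_splits)
  then consider "x = of_int c + y" | "x = of_int c - y" | "x = of_int (- c) - y" | "x = of_int (- c) + y"
    using *(2) by fastforce
  then show ?thesis
    by cases (metis add.commute, metis add.commute uminus_add_conv_diff,
        metis add.commute uminus_add_conv_diff, metis add.commute)
qed

text \<open>Eliminating \<open>x\<close> between two relations leaves a quadratic equation for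
  \<open>y\<close>. It degenerates only for proportional matrices, which entries \<open>b\<close> of
  different size exclude.\<close>

lemma modular_relations_quadratic:
  fixes x y :: real
  assumes y: "y \<notin> \<rat>"
    and R: "\<And>n. n \<ge> n0 \<Longrightarrow> \<exists>a b c d. b \<noteq> 0 \<and> modular_relation n x y a b c d"
  shows "\<exists>A B C::int. A \<noteq> 0 \<and> of_int A * y\<^sup>2 + of_int B * y + of_int C = 0"
proof -
  obtain a1 b1 c1 d1 where 1: "b1 \<noteq> 0" "modular_relation n0 x y a1 b1 c1 d1"
    using R by blast
  \<comment> \<open>A level above \<open>\<bar>b1\<bar>\<close>: as a nonzero multiple of it,
    \<open>b2\<close> exceeds \<open>b1\<close> in absolute value.\<close>
  define n where "n = n0 + nat \<bar>b1\<bar> + 1"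
  obtain a2 b2 c2 d2 where 2: "b2 \<noteq> 0" "modular_relation n x y a2 b2 c2 d2"
    using R[of n] by (auto simp: n_def)
  have "int n \<le> \<bar>b2\<bar>"
    using 2 dvd_imp_le_int[of b2 "int n"] by (simp add: modular_relation_def)
  then have lt: "\<bar>b1\<bar> < \<bar>b2\<bar>" by (simp add: n_def)
  have det: "\<bar>a1 * d1 - b1 * c1\<bar> = 1" "\<bar>a2 * d2 - b2 * c2\<bar> = 1"
    and rel: "x * (of_int a1 + of_int b1 * y) = of_int c1 + of_int d1 * y"
      "x * (of_int a2 + of_int b2 * y) = of_int c2 + of_int d2 * y"
    using 1 2 by (auto simp: modular_relation_def)
  define A B C where "A = d1 * b2 - d2 * b1" and "B = c1 * b2 + d1 * a2 - c2 * b1 - d2 * a1"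
    and "C = c1 * a2 - c2 * a1"
  have "(of_int c1 + of_int d1 * y) * (of_int a2 + of_int b2 * y) =
      (of_int c2 + of_int d2 * y) * (of_int a1 + of_int b1 * y)"
    unfolding rel[symmetric] by (simp add: mult_ac)
  then have eq: "of_int A * y\<^sup>2 + of_int B * y + of_int C = 0"
    by (simp add: A_def B_def C_def algebra_simps power2_eq_square)
  have "A \<noteq> 0"
  proof
    assume A0: "A = 0"
    with eq have "B = 0" using irrational_linear_eq_0[OF y, of C B] by (simp add: add.commute)
    \<comment> \<open>With \<open>A = B = 0\<close> this identity and its mirror image below make
      \<open>b1\<close> and \<open>b2\<close> divide each other, against
      \<open>\<bar>b1\<bar> < \<bar>b2\<bar>\<close>.\<close>
    have "b2 * (a1 * d1 - b1 * c1) = a1 * A - b1 * B + b1 * (d1 * a2 - c2 * b1)"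
      by (simp add: A_def B_def algebra_simps)
    then have "b2 * (a1 * d1 - b1 * c1) = b1 * (d1 * a2 - c2 * b1)"
      using A0 \<open>B = 0\<close> by simp
    then have b2: "b1 dvd b2"
      using det(1) by (metis abs_dvd_iff abs_mult dvd_abs_iff dvd_triv_left mult.right_neutral)
    have "b1 * (a2 * d2 - b2 * c2) = - a2 * A + b2 * B + b2 * (d2 * a1 - c1 * b2)"
      by (simp add: A_def B_def algebra_simps)
    then have "b1 * (a2 * d2 - b2 * c2) = b2 * (d2 * a1 - c1 * b2)"
      using A0 \<open>B = 0\<close> by simp
    then have "b2 dvd b1"
      using det(2) by (metis abs_dvd_iff abs_mult dvd_abs_iff dvd_triv_left mult.right_neutral)
    then have "\<bar>b2\<bar> \<le> \<bar>b1\<bar>" using 1(1) by (simp add: dvd_imp_le_int)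
    with lt show False by simp
  qed
  with eq show ?thesis by blast
qed

text \<open>The divisibility makes both \<open>a + b y\<close> and its inverse \<open>\<plusminus>(d - b x)\<close> algebraic
  integers, so that \<open>a + b y\<close> has norm \<open>\<plusminus>1\<close>.\<close>

lemma quadratic_modular_relation:
  fixes x y :: real
  assumes y: "y \<notin> \<rat>" and x: "x \<notin> \<rat>"
    and Y: "A \<noteq> 0" "of_int A * y\<^sup>2 + of_int B * y + of_int C = 0"
    and X: "A' \<noteq> 0" "of_int A' * x\<^sup>2 + of_int B' * x + of_int C' = 0"
    and R: "modular_relation n x y a b c d" and b: "b \<noteq> 0"
    and n: "A dvd int n" "A' dvd int n"
  shows "\<exists>k::int. x = y + of_int k \<or> x = - y + of_int k"
proof -
  obtain m where m: "b = A * m" using n(1) R by (meson dvdE dvd_trans modular_relation_def)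
  obtain m' where m': "b = A' * m'" using n(2) R by (meson dvdE dvd_trans modular_relation_def)
  define \<delta> where "\<delta> = a * d - b * c"
  have \<delta>: "\<delta> = 1 \<or> \<delta> = -1" using R by (auto simp: modular_relation_def \<delta>_def abs_if split: if_splits)
  have rel: "x * (of_int a + of_int b * y) = of_int c + of_int d * y"
    using R by (simp add: modular_relation_def)
  define l where "l = of_int a + of_int b * y"
  define v where "v = of_int \<delta> * (of_int d - of_int b * x)"
  have lv: "l * v = 1"
  proof -
    have "l * (of_int d - of_int b * x) = l * of_int d - of_int b * (x * l)"
      by (simp add: algebra_simps)
    also have "x * l = of_int c + of_int d * y" using rel by (simp add: l_def)
    also have "l * of_int d - of_int b * (of_int c + of_int d * y) = of_int \<delta>"
      by (simp add: l_def \<delta>_def algebra_simps)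
    finally have "l * (of_int d - of_int b * x) = of_int \<delta>" .
    then have "l * v = of_int (\<delta> * \<delta>)" by (simp add: v_def)
    then show ?thesis using \<delta> by auto
  qed
  have v_lin: "v = of_int (\<delta> * d) + of_int (- \<delta> * b) * x" by (simp add: v_def algebra_simps)
  \<comment> \<open>Norm and trace of \<open>l\<close>, computed with the second root of the
    equation for \<open>y\<close>. They are integers because \<open>b = A * m\<close> clears the
    denominators of sum and product of the roots.\<close>
  define N T where "N = a\<^sup>2 - a * m * B + b * m * C" and "T = 2 * a - m * B"
  have l2: "l\<^sup>2 - of_int T * l + of_int N = 0"
  proof -
    have "l\<^sup>2 - of_int T * l + of_int N =
        of_int (b * m) * (of_int A * y\<^sup>2 + of_int B * y + of_int C)"
      unfolding l_def N_def T_def by (simp add: m algebra_simps power2_eq_square)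
    with Y show ?thesis by simp
  qed
  \<comment> \<open>Trace and norm of \<open>v = 1 / l\<close>, integral because \<open>A'\<close>
    divides \<open>b\<close> as well.\<close>
  define e f where "e = \<delta> * (2 * d + m' * B')" and "f = d\<^sup>2 + d * m' * B' + b * m' * C'"
  have v2: "v\<^sup>2 - of_int e * v + of_int f = 0"
  proof -
    have d2: "real_of_int \<delta> * of_int \<delta> = 1" using \<delta> by auto
    have "v\<^sup>2 - of_int e * v + of_int f =
        (of_int \<delta> * of_int \<delta>) * ((of_int d - of_int b * x)\<^sup>2 - of_int (2 * d + m' * B') * (of_int d - of_int b * x)) + of_int f"
      unfolding v_def e_def by (simp add: algebra_simps power2_eq_square)
    also have "\<dots> = of_int (b * m') * (of_int A' * x\<^sup>2 + of_int B' * x + of_int C')"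
      unfolding d2 f_def by (simp add: m' algebra_simps power2_eq_square)
    finally show ?thesis using X by simp
  qed
  \<comment> \<open>The reciprocal of the equation for \<open>l\<close> has leading coefficient
    \<open>N\<close>. Subtracting \<open>N\<close> times the monic equation for \<open>v\<close>
    leaves a linear relation in \<open>v\<close>, hence in \<open>x\<close>, and its vanishing
    forces \<open>N * f = 1\<close>.\<close>
  have "of_int N * v\<^sup>2 - of_int T * v + 1 = v\<^sup>2 * (l\<^sup>2 - of_int T * l + of_int N)"
  proof -
    have "v\<^sup>2 * (l\<^sup>2 - of_int T * l + of_int N) = (l * v)\<^sup>2 - of_int T * v * (l * v) + of_int N * v\<^sup>2"
      by (simp add: algebra_simps power2_eq_square)
    then show ?thesis unfolding lv by simp
  qed
  then have "of_int N * v\<^sup>2 - of_int T * v + 1 = 0" using l2 by simp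
  moreover have "of_int (N * e - T) * v + of_int (1 - N * f) =
      (of_int N * v\<^sup>2 - of_int T * v + 1) - of_int N * (v\<^sup>2 - of_int e * v + of_int f)"
    by (simp add: algebra_simps)
  ultimately have "of_int (N * e - T) * v + of_int (1 - N * f) = 0"
    using v2 by simp
  then have "of_int ((N * e - T) * (\<delta> * d) + (1 - N * f)) + of_int ((N * e - T) * (- \<delta> * b)) * x = 0"
    unfolding v_lin by (simp add: algebra_simps)
  from irrational_linear_eq_0[OF x this] have "N * f = 1"
    using \<delta> b by auto
  then have N: "N = 1 \<or> N = -1" by (auto simp: zmult_eq_1_iff)
  \<comment> \<open>\<open>T - l\<close> is the conjugate of \<open>l\<close>, so multiplying
    \<open>x * l = c + d * y\<close> by it gives \<open>N * x\<close>. The quadratic terms vanish by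
    the equation for \<open>y\<close>, and the coefficient of \<open>y\<close> that remains is the
    determinant.\<close>
  define k where "k = a * c - m * c * B + m * d * C"
  have "real_of_int N = l * of_int T - l\<^sup>2" using l2 by (simp add: algebra_simps)
  then have "of_int N * x = (l * of_int T - l\<^sup>2) * x" by simp
  also have "\<dots> = (of_int T - l) * (x * l)" by (simp add: algebra_simps power2_eq_square)
  also have "x * l = of_int c + of_int d * y" using rel by (simp add: l_def)
  also have "(of_int T - l) * (of_int c + of_int d * y) = of_int \<delta> * y + of_int k
      - of_int (m * d) * (of_int A * y\<^sup>2 + of_int B * y + of_int C)"
    unfolding l_def T_def k_def \<delta>_def by (simp add: m algebra_simps power2_eq_square)
  finally have "of_int N * x = of_int \<delta> * y + of_int k" using Y by simp
  then have "x = y + of_int k \<or> x = - y + of_int k \<or> x = y + of_int (- k) \<or> x = - y + of_int (- k)"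
    using N \<delta> by auto
  then show ?thesis by blast
qed

text \<open>If the conclusion fails, no relation at these levels is triangular in either direction,
  so both numbers are quadratic; a level divisible by both leading coefficients then yields the
  conclusion after all.\<close>

lemma eventually_modular_relation_imp:
  fixes x y :: real
  assumes x: "x \<notin> \<rat>" and y: "y \<notin> \<rat>"
    and R: "\<And>n. n \<ge> n0 \<Longrightarrow> \<exists>a b c d. modular_relation n x y a b c d"
  shows "\<exists>k::int. x = y + of_int k \<or> x = - y + of_int k"
proof (rule ccontr)
  assume neg: "\<not> ?thesis"
  then have R1: "\<exists>a b c d. b \<noteq> 0 \<and> modular_relation n x y a b c d" if "n \<ge> n0" for n
    using R[OF that] modular_relation_b_0 by metis
  then have R2: "\<exists>a b c d. b \<noteq> 0 \<and> modular_relation n y x a b c d" if "n \<ge> n0" for n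
    using modular_relation_swap that by (metis add.inverse_inverse minus_zero)
  obtain A B C where Y: "A \<noteq> 0" "of_int A * y\<^sup>2 + of_int B * y + of_int C = 0"
    using modular_relations_quadratic[OF y R1] by blast
  obtain A' B' C' where X: "A' \<noteq> 0" "of_int A' * x\<^sup>2 + of_int B' * x + of_int C' = 0"
    using modular_relations_quadratic[OF x R2] by blast
  \<comment> \<open>The factor \<open>n0\<close> keeps the level admissible; the other factor serves
    both leading coefficients.\<close>
  define n where "n = nat \<bar>A * A'\<bar> * n0"
  have "1 \<le> nat \<bar>A * A'\<bar>" using Y(1) X(1) by (simp add: Suc_le_eq)
  then have "n0 \<le> n" by (simp add: n_def)
  from R1[OF this] obtain a b c d where "b \<noteq> 0" "modular_relation n x y a b c d" by blast
  moreover have "A dvd int n" "A' dvd int n" by (auto simp: n_def)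
  ultimately show False using quadratic_modular_relation[OF y x Y X] neg by blast
qed

section \<open>Lifting maps through suspensions\<close>

lemma homeomorphic_map_bij_betw:
  "homeomorphic_map X Y f \<Longrightarrow> bij_betw f (topspace X) (topspace Y)"
  by (simp add: bij_betw_def homeomorphic_imp_injective_map homeomorphic_imp_surjective_map)

lemma int_iterate_0 [simp]: "int_iterate X S 0 x = x"
  by (simp add: int_iterate_def)

lemma int_iterate_1 [simp]: "int_iterate X S 1 = S"
  by (simp add: int_iterate_def)

lemma int_iterate_mem:
  assumes "bij_betw S (topspace X) (topspace X)" "x \<in> topspace X"
  shows "int_iterate X S k x \<in> topspace X"
proof -
  have "(S ^^ m) x \<in> topspace X" "(inv_into (topspace X) S ^^ m) x \<in> topspace X" for m
    using assms bij_betw_inv_into[OF assms(1)]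
    by (induction m) (auto dest: bij_betwE)
  then show ?thesis by (simp add: int_iterate_def)
qed

lemma int_iterate_succ:
  assumes S: "bij_betw S (topspace X) (topspace X)" and x: "x \<in> topspace X"
  shows "int_iterate X S (k + 1) x = S (int_iterate X S k x)"
proof (cases "k \<ge> 0")
  case True
  then show ?thesis by (simp add: int_iterate_def nat_add_distrib)
next
  case False
  then have k: "nat (- k) = Suc (nat (- (k + 1)))" by simp
  have "int_iterate X S (k + 1) x = (inv_into (topspace X) S ^^ nat (- (k + 1))) x"
    using False by (auto simp: int_iterate_def)
  moreover have "int_iterate X S k x = inv_into (topspace X) S (int_iterate X S (k + 1) x)"
    unfolding calculation using False by (simp only: int_iterate_def k) simp
  ultimately show ?thesis
    using int_iterate_mem[OF S x, of "k + 1"] S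
    by (metis bij_betw_imp_surj_on f_inv_into_f)
qed

text \<open>Reduces a formula for all integer iterates to a single forward step; injectivity of
  \<open>S\<close> takes care of negative indices.\<close>

lemma int_iterate_unique:
  assumes S: "bij_betw S (topspace X) (topspace X)" and g0: "g 0 \<in> topspace X"
    and step: "\<And>k::int. g (k + 1) = S (g k)" and mem: "\<And>k. g k \<in> topspace X"
  shows "int_iterate X S k (g 0) = g k"
proof (induction k rule: int_induct[where k = 0])
  case (step2 i)
  have "S (int_iterate X S (i - 1) (g 0)) = S (g (i - 1))"
    using int_iterate_succ[OF S g0, of "i - 1"] step[of "i - 1"] step2 by simp
  then show ?case
    using S int_iterate_mem[OF S g0] mem by (metis bij_betw_def inj_on_def)
qed (use int_iterate_succ[OF S g0] step in auto)

lemma int_iterate_add: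
  assumes S: "bij_betw S (topspace X) (topspace X)" and x: "x \<in> topspace X"
  shows "int_iterate X S (j + k) x = int_iterate X S j (int_iterate X S k x)"
  using int_iterate_unique[OF S, where g = "\<lambda>j. int_iterate X S (j + k) x"]
    int_iterate_succ[OF S x, of "_ + k"] int_iterate_mem[OF S x]
  by (simp add: add_ac)

lemma continuous_map_int_iterate:
  assumes S: "homeomorphic_map X X S"
  shows "continuous_map X X (int_iterate X S k)"
proof -
  have pow: "continuous_map X X (f ^^ m)" if "continuous_map X X f" for f :: "'a \<Rightarrow> 'a" and m
    using that by (induction m) (auto intro: continuous_map_compose)
  obtain g where g: "homeomorphic_maps X X S g"
    using S homeomorphic_map_maps by blast
  have "inv_into (topspace X) S x = g x" if "x \<in> topspace X" for x
    using g that homeomorphic_imp_injective_map[OF S]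
    by (intro inv_into_f_eq) (auto simp: homeomorphic_maps_def continuous_map_def Pi_iff)
  then have "continuous_map X X (inv_into (topspace X) S)"
    using g by (auto intro: continuous_map_eq simp: homeomorphic_maps_def)
  then show ?thesis
    using pow homeomorphic_imp_continuous_map[OF S] by (simp add: int_iterate_def)
qed

section \<open>Identifications in the suspension and local sections of the quotient map\<close>

lemma suspension_class_self: "p \<in> suspension_class X S p"
  unfolding suspension_class_def by (rule range_eqI[of _ _ 0]) simp

lemma suspension_class_eq_iff:
  assumes S: "bij_betw S (topspace X) (topspace X)" and x: "x \<in> topspace X" and y: "y \<in> topspace X"
  shows "suspension_class X S (x, s) = suspension_class X S (y, t) \<longleftrightarrow>
     (\<exists>k. y = int_iterate X S k x \<and> t = s - of_int k)" (is "?L = ?R")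
proof
  assume ?L
  then have "(y, t) \<in> suspension_class X S (x, s)" using suspension_class_self by metis
  then show ?R by (auto simp: suspension_class_def)
next
  assume ?R
  then obtain k where k: "y = int_iterate X S k x" "t = s - of_int k" by blast
  have "suspension_class X S (y, t) =
      range (\<lambda>n. (int_iterate X S (n + k) x, s - of_int (n + k)))"
    by (simp add: suspension_class_def k int_iterate_add[OF S x] algebra_simps)
  also have "\<dots> = (\<lambda>n. (int_iterate X S n x, s - of_int n)) ` range (\<lambda>n. n + k)"
    by (simp only: image_image)
  also have "range (\<lambda>n::int. n + k) = UNIV" by (rule surjI[where f = "\<lambda>n. n - k"]) simp
  finally show ?L by (simp add: suspension_class_def)
qed

lemma suspension_class_step:
  assumes S: "bij_betw S (topspace X) (topspace X)" and x: "x \<in> topspace X"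
  shows "suspension_class X S (S x, t) = suspension_class X S (x, t + 1)"
proof -
  have "S x \<in> topspace X" using S x by (auto dest: bij_betwE)
  then have "suspension_class X S (x, t + 1) = suspension_class X S (S x, t)"
    using suspension_class_eq_iff[OF S x] by (force intro: exI[of _ 1])
  then show ?thesis by simp
qed

text \<open>The quotient is by a group of homeomorphisms, so the saturation of an open set is a
  union of open translates, here its preimages under the action maps \<open>a k\<close>.\<close>

lemma open_map_suspension_class:
  assumes S: "homeomorphic_map X X S"
  shows "open_map (prod_topology X euclideanreal) (suspension X S) (suspension_class X S)"
  unfolding open_map_def
proof (intro allI impI)
  let ?P = "prod_topology X euclideanreal"
  fix W assume W: "openin ?P W"
  define a where "a k = (\<lambda>p. (int_iterate X S k (fst p), snd p - of_int k :: real))" for k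
  note bij = homeomorphic_map_bij_betw[OF S]
  have sub: "W \<subseteq> topspace ?P" using W by (rule openin_subset)
  have "continuous_map ?P ?P (a k)" for k
    unfolding a_def
    by (intro continuous_map_pairedI continuous_map_compose[OF continuous_map_fst, unfolded o_def]
        continuous_map_int_iterate S continuous_map_diff continuous_map_snd) auto
  then have "openin ?P (\<Union>k. {p \<in> topspace ?P. a k p \<in> W})"
    by (intro openin_Union) (use W openin_continuous_map_preimage in blast)
  moreover have "(\<Union>k. {p \<in> topspace ?P. a k p \<in> W}) =
      {p \<in> topspace ?P. suspension_class X S p \<in> suspension_class X S ` W}" (is "?A = ?B")
  proof -
    have "(\<exists>k. a k p \<in> W) \<longleftrightarrow> suspension_class X S p \<in> suspension_class X S ` W"
      if p: "p \<in> topspace ?P" for p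
    proof -
      have "suspension_class X S p = suspension_class X S q \<longleftrightarrow> (\<exists>k. q = a k p)" if "q \<in> W" for q
        using suspension_class_eq_iff[OF bij, of "fst p" "fst q" "snd p" "snd q"] p that sub
        by (auto simp: a_def prod_eq_iff)
      then show ?thesis by blast
    qed
    then show ?thesis by auto
  qed
  ultimately show "openin (suspension X S) (suspension_class X S ` W)"
    using sub by (auto simp: openin_suspension)
qed

text \<open>An open slab of height one embeds in the suspension: two representatives of a class
  differ in time by an integer, which is 0 inside an open interval of length one. The lift is
  \<open>k\<close> followed by the local inverse of the class map.\<close>

lemma suspension_local_lift:
  assumes T: "homeomorphic_map Y Y T" and k: "continuous_map X (suspension Y T) k"
    and x0: "x0 \<in> topspace X"
  shows "\<exists>U g. openin X U \<and> x0 \<in> U \<and>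
    continuous_map (subtopology X U) (prod_topology Y euclideanreal) g \<and>
    (\<forall>x\<in>U. suspension_class Y T (g x) = k x)"
proof -
  let ?P = "prod_topology Y euclideanreal"
  let ?q = "suspension_class Y T"
  have "k x0 \<in> topspace (suspension Y T)" using k x0 by (auto simp: continuous_map_def)
  then obtain y0 a where y0: "y0 \<in> topspace Y" and k0: "k x0 = ?q (y0, a)"
    by (auto simp: topspace_suspension)
  define W where "W = topspace Y \<times> {a - 1/2 <..< a + 1/2}"
  have W: "openin ?P W" by (simp add: W_def openin_prod_Times_iff)
  define V where "V = ?q ` W"
  have V: "openin (suspension Y T) V"
    using open_map_suspension_class[OF T] W by (auto simp: open_map_def V_def)
  have "inj_on ?q W"
  proof (rule inj_onI)
    fix p p' assume p: "p \<in> W" "p' \<in> W" "?q p = ?q p'"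
    then obtain j where "fst p' = int_iterate Y T j (fst p)" "snd p' = snd p - of_int j"
      using suspension_class_eq_iff[OF homeomorphic_map_bij_betw[OF T], of "fst p" "fst p'" "snd p" "snd p'"]
      by (auto simp: W_def)
    moreover from this have "\<bar>real_of_int j\<bar> < 1" using p by (auto simp: W_def)
    then have "j = 0" by linarith
    ultimately show "p = p'" by (simp add: prod_eq_iff)
  qed
  moreover have "open_map (subtopology ?P W) (suspension Y T) ?q"
    by (rule open_map_from_subtopology[OF open_map_suspension_class[OF T] W])
  moreover have "continuous_map (subtopology ?P W) (suspension Y T) ?q"
    by (intro continuous_map_from_subtopology quotient_imp_continuous_map quotient_map_suspension)
  moreover have "topspace (subtopology ?P W) = W"
    using openin_subset[OF W] by auto
  ultimately have "embedding_map (subtopology ?P W) (suspension Y T) ?q"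
    by (intro injective_open_imp_embedding_map) auto
  then have "homeomorphic_map (subtopology ?P W) (subtopology (suspension Y T) V) ?q"
    using \<open>topspace _ = W\<close> by (simp add: embedding_map_def V_def)
  then obtain r where r: "homeomorphic_maps (subtopology ?P W) (subtopology (suspension Y T) V) ?q r"
    using homeomorphic_map_maps by blast
  define U where "U = {x \<in> topspace X. k x \<in> V}"
  have "openin X U" unfolding U_def by (rule openin_continuous_map_preimage[OF k V])
  moreover have "x0 \<in> U" using x0 y0 by (auto simp: U_def k0 V_def W_def)
  moreover have "continuous_map (subtopology X U) (subtopology (suspension Y T) V) k"
    using k by (intro continuous_map_into_subtopology continuous_map_from_subtopology)
      (auto simp only: U_def topspace_subtopology)
  then have "continuous_map (subtopology X U) (subtopology ?P W) (r \<circ> k)"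
    by (rule continuous_map_compose) (use r in \<open>simp add: homeomorphic_maps_def\<close>)
  then have "continuous_map (subtopology X U) ?P (r \<circ> k)"
    by (simp add: continuous_map_in_subtopology)
  moreover have "\<forall>x\<in>U. ?q ((r \<circ> k) x) = k x"
    using r openin_subset[OF V] by (auto simp: homeomorphic_maps_def U_def)
  ultimately show ?thesis by blast
qed

section \<open>Global lifts over compact zero-dimensional spaces\<close>

definition zero_dimensional :: "'a topology \<Rightarrow> bool" where
  "zero_dimensional X \<longleftrightarrow> (\<forall>U x. openin X U \<longrightarrow> x \<in> U \<longrightarrow>
     (\<exists>V. openin X V \<and> closedin X V \<and> x \<in> V \<and> V \<subseteq> U))"

text \<open>The passage from local to uniform facts: lifts, time bounds and windows all arise from a
  property \<open>Q\<close> that is stable under unions.\<close>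

lemma compact_space_cover_induct:
  assumes X: "compact_space X"
    and loc: "\<And>x. x \<in> topspace X \<Longrightarrow> \<exists>U. openin X U \<and> x \<in> U \<and> Q U"
    and empty: "Q {}" and un: "\<And>U V. Q U \<Longrightarrow> Q V \<Longrightarrow> Q (U \<union> V)"
  shows "Q (topspace X)"
proof -
  define \<U> where "\<U> = {U. openin X U \<and> Q U}"
  have "\<forall>U\<in>\<U>. openin X U" "topspace X \<subseteq> \<Union>\<U>" using loc by (auto simp: \<U>_def)
  then obtain \<F> where \<F>: "finite \<F>" "\<F> \<subseteq> \<U>" "topspace X \<subseteq> \<Union>\<F>"
    using X[unfolded compact_space_alt, rule_format, of \<U>] by blast
  have "Q (\<Union>\<F>)" using \<F>(1,2) by induction (simp_all add: empty un \<U>_def)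
  moreover have "U \<subseteq> topspace X" if "U \<in> \<F>" for U
    using \<F>(2) that openin_subset[of X U] by (auto simp: \<U>_def)
  then have "\<Union>\<F> = topspace X" using \<F>(3) by (intro equalityI Union_least) auto
  ultimately show ?thesis by simp
qed

text \<open>Local lifts are not unique and need not match on overlaps. On clopen pieces the second
  lift may be used only off the first, so no matching is required; this is where zero-dimensionality
  enters.\<close>

lemma suspension_lift:
  assumes X: "compact_space X" "zero_dimensional X"
    and T: "homeomorphic_map Y Y T" and k: "continuous_map X (suspension Y T) k"
  shows "\<exists>g. continuous_map X (prod_topology Y euclideanreal) g \<and>
    (\<forall>x\<in>topspace X. suspension_class Y T (g x) = k x)"
proof -
  let ?P = "prod_topology Y euclideanreal"
  define Q where "Q U \<longleftrightarrow> openin X U \<and> closedin X U \<and>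
    (\<exists>g. continuous_map (subtopology X U) ?P g \<and> (\<forall>x\<in>U. suspension_class Y T (g x) = k x))" for U
  have "Q (topspace X)"
  proof (rule compact_space_cover_induct[OF X(1)])
    fix x assume x: "x \<in> topspace X"
    obtain U g where U: "openin X U" "x \<in> U" "continuous_map (subtopology X U) ?P g"
      "\<forall>x\<in>U. suspension_class Y T (g x) = k x"
      using suspension_local_lift[OF T k x] by blast
    obtain V where V: "openin X V" "closedin X V" "x \<in> V" "V \<subseteq> U"
      using X(2) U(1,2) unfolding zero_dimensional_def by blast
    have "continuous_map (subtopology X V) ?P g"
      using continuous_map_from_subtopology_mono[OF U(3) V(4)] .
    with U V show "\<exists>U. openin X U \<and> x \<in> U \<and> Q U" unfolding Q_def by blast
  next
    show "Q {}" unfolding Q_def by (auto simp: continuous_map_def)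
  next
    fix U V assume "Q U" "Q V"
    then obtain g f where U: "openin X U" "closedin X U" "continuous_map (subtopology X U) ?P g"
      "\<forall>x\<in>U. suspension_class Y T (g x) = k x"
      and V: "openin X V" "closedin X V" "continuous_map (subtopology X V) ?P f"
      "\<forall>x\<in>V. suspension_class Y T (f x) = k x"
      unfolding Q_def by auto
    let ?Z = "subtopology X (U \<union> V)"
    define h where "h x = (if x \<in> U then g x else f x)" for x
    define A where "A b = (if b then U else V - U)" for b
    have oUV: "openin X (U \<union> V)" "openin X (V - U)" using U V by auto
    have "continuous_map ?Z ?P h"
    proof (rule pasting_lemma[where I = UNIV and T = A and f = "\<lambda>b. if b then g else f"])
      show "openin ?Z (A b)" for b
        using oUV U(1) by (cases b) (auto simp: A_def openin_open_subtopology)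
      have "subtopology ?Z U = subtopology X U" "subtopology ?Z (V - U) = subtopology X (V - U)"
        by (simp_all add: subtopology_subtopology Int_absorb1 le_supI2 Diff_subset)
      moreover have "continuous_map (subtopology X (V - U)) ?P f"
        by (rule continuous_map_from_subtopology_mono[OF V(3) Diff_subset])
      ultimately show "continuous_map (subtopology ?Z (A b)) ?P (if b then g else f)" for b
        using U(3) by (cases b) (auto simp: A_def)
    qed (auto simp: A_def h_def split: if_splits)
    moreover have "\<forall>x\<in>U \<union> V. suspension_class Y T (h x) = k x" using U V by (auto simp: h_def)
    moreover have "closedin X (U \<union> V)" using U V by blast
    ultimately show "Q (U \<union> V)" using oUV unfolding Q_def by blast
  qed
  then show ?thesis unfolding Q_def by (auto simp: subtopology_topspace)
qed

text \<open>The time coordinate of a class is defined modulo 1, so its exponential is a function on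
  the suspension; every representative that \<open>SOME\<close> may pick gives the same
  value.\<close>

definition suspension_angle :: "('a \<times> real) set \<Rightarrow> complex" where
  "suspension_angle c = cis (2 * pi * snd (SOME p. p \<in> c))"

lemma suspension_angle_class: "suspension_angle (suspension_class X S (x, s)) = cis (2 * pi * s)"
proof -
  have "(SOME p. p \<in> suspension_class X S (x, s)) \<in> suspension_class X S (x, s)"
    using suspension_class_self by (rule someI)
  then obtain n where "snd (SOME p. p \<in> suspension_class X S (x, s)) = s - of_int n"
    by (auto simp: suspension_class_def)
  moreover have "cis (2 * pi * s - 2 * pi * of_int n) = cis (2 * pi * s)"
  proof -
    have "cis (2 * pi * of_int n) = 1" by (rule cis_multiple_2pi) simp
    then show ?thesis by (simp only: cis_divide[symmetric] div_by_1)
  qed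
  ultimately show ?thesis by (simp add: suspension_angle_def right_diff_distrib)
qed

lemma continuous_map_suspension_angle:
  "continuous_map (suspension X S) euclidean suspension_angle"
proof (rule continuous_compose_quotient_map[OF quotient_map_suspension])
  have "continuous_map euclideanreal euclidean (\<lambda>s. cis (2 * pi * s))"
    by (simp add: continuous_on_cis continuous_on_mult_left)
  then have "continuous_map (prod_topology X euclideanreal) euclidean (\<lambda>p. cis (2 * pi * snd p))"
    by (rule continuous_map_compose[OF continuous_map_snd, unfolded o_def])
  moreover have "suspension_angle \<circ> suspension_class X S = (\<lambda>p. cis (2 * pi * snd p))"
    using suspension_angle_class[of X S] by (simp add: fun_eq_iff)
  ultimately show "continuous_map (prod_topology X euclideanreal) euclidean
      (suspension_angle \<circ> suspension_class X S)" by simp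
qed

text \<open>Used backwards: where a sum of two angles does not vanish, the two times cannot differ
  by exactly 1/2.\<close>

lemma cis_add_eq_0_if_half:
  assumes "\<bar>r - s\<bar> = 1/2"
  shows "cis (2 * pi * r) + cis (2 * pi * s) = 0"
proof -
  have "r = s + 1/2 \<or> r = s - 1/2" using assms by linarith
  then have "2 * pi * r = 2 * pi * s + pi \<or> 2 * pi * r = 2 * pi * s - pi"
    by (elim disjE) (simp_all add: distrib_left right_diff_distrib)
  moreover have "cis (a + pi) = - cis a" "cis (a - pi) = - cis a" for a
    by (simp_all add: complex_eq_iff cos_diff sin_diff)
  ultimately have "cis (2 * pi * r) = - cis (2 * pi * s)" by metis
  then show ?thesis by simp
qed

text \<open>One direction of a flow equivalence, in a form satisfied by the homeomorphism and by its
  inverse.\<close>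

definition flow_map ::
    "'a topology \<Rightarrow> ('a \<Rightarrow> 'a) \<Rightarrow> 'b topology \<Rightarrow> ('b \<Rightarrow> 'b) \<Rightarrow>
     (('a \<times> real) set \<Rightarrow> ('b \<times> real) set) \<Rightarrow> bool" where
  "flow_map X S Y T h \<longleftrightarrow> continuous_map (suspension X S) (suspension Y T) h \<and>
     (\<forall>c\<in>topspace (suspension X S). \<exists>\<theta>. continuous_on UNIV \<theta> \<and>
        (\<forall>t. h (suspension_flow t c) = suspension_flow (\<theta> t) (h c)))"

text \<open>The base point \<open>\<phi> x\<close> is kept along the whole flow line of
  \<open>x\<close>, and \<open>\<tau> x\<close> is the unwrapped time of the image. Continuity is
  asked only in \<open>t\<close> for each \<open>x\<close>, and in \<open>x\<close> at time 0;
  control in both variables together is recovered from the angle.\<close>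

definition flow_lift ::
    "'a topology \<Rightarrow> ('a \<Rightarrow> 'a) \<Rightarrow> 'b topology \<Rightarrow> ('b \<Rightarrow> 'b) \<Rightarrow>
     (('a \<times> real) set \<Rightarrow> ('b \<times> real) set) \<Rightarrow> ('a \<Rightarrow> 'b) \<Rightarrow> ('a \<Rightarrow> real \<Rightarrow> real) \<Rightarrow> bool" where
  "flow_lift X S Y T h \<phi> \<tau> \<longleftrightarrow> continuous_map X Y \<phi> \<and> continuous_map X euclideanreal (\<lambda>x. \<tau> x 0) \<and>
     (\<forall>x\<in>topspace X. continuous_on UNIV (\<tau> x) \<and>
        (\<forall>t. h (suspension_class X S (x, t)) = suspension_class Y T (\<phi> x, \<tau> x t)))"

lemma suspension_class_mem:
  "x \<in> topspace X \<Longrightarrow> suspension_class X S (x, t) \<in> topspace (suspension X S)"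
  by (auto simp: topspace_suspension)

lemma flow_lift_exists:
  assumes X: "compact_space X" "zero_dimensional X"
    and T: "homeomorphic_map Y Y T" and h: "flow_map X S Y T h"
  shows "\<exists>\<phi> \<tau>. flow_lift X S Y T h \<phi> \<tau>"
proof -
  have "continuous_map X (prod_topology X euclideanreal) (\<lambda>x. (x, 0))"
    by (intro continuous_map_pairedI) auto
  from continuous_map_compose[OF this quotient_imp_continuous_map[OF quotient_map_suspension]]
  have "continuous_map X (suspension X S) (\<lambda>x. suspension_class X S (x, 0))"
    by (simp add: o_def)
  from continuous_map_compose[OF this h[unfolded flow_map_def, THEN conjunct1]]
  have "continuous_map X (suspension Y T) (\<lambda>x. h (suspension_class X S (x, 0)))"
    by (simp add: o_def)
  from suspension_lift[OF X T this] obtain g where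
    g: "continuous_map X (prod_topology Y euclideanreal) g"
      "\<And>x. x \<in> topspace X \<Longrightarrow> suspension_class Y T (g x) = h (suspension_class X S (x, 0))"
    by blast
  define \<phi> s where "\<phi> = fst \<circ> g" and "s = snd \<circ> g"
  have "\<forall>x\<in>topspace X. \<exists>\<theta>. continuous_on UNIV \<theta> \<and>
      (\<forall>t. h (suspension_flow t (suspension_class X S (x, 0))) =
        suspension_flow (\<theta> t) (h (suspension_class X S (x, 0))))"
    using h[unfolded flow_map_def, THEN conjunct2] suspension_class_mem[of _ X] by (meson bspec)
  then obtain \<theta> where \<theta>: "\<And>x. x \<in> topspace X \<Longrightarrow> continuous_on UNIV (\<theta> x)"
    "\<And>x t. x \<in> topspace X \<Longrightarrow> h (suspension_flow t (suspension_class X S (x, 0))) =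
        suspension_flow (\<theta> x t) (h (suspension_class X S (x, 0)))"
    by metis
  \<comment> \<open>\<open>\<theta> x 0\<close> may be a nonzero period of the orbit. Subtracting it
    gives \<open>\<tau> x 0 = s x\<close>, which is continuous in \<open>x\<close>.\<close>
  define \<tau> where "\<tau> x t = s x + (\<theta> x t - \<theta> x 0)" for x t
  have eq: "h (suspension_class X S (x, t)) = suspension_class Y T (\<phi> x, \<tau> x t)"
    if x: "x \<in> topspace X" for x t
  proof -
    have hx: "h (suspension_class X S (x, 0)) = suspension_class Y T (\<phi> x, s x)"
      using g(2)[OF x] by (simp add: \<phi>_def s_def)
    have flow: "h (suspension_class X S (x, t)) = suspension_class Y T (\<phi> x, s x + \<theta> x t)" for t
      using \<theta>(2)[OF x, of t] unfolding hx suspension_flow_class by simp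
    have "suspension_class Y T (\<phi> x, s x + \<theta> x t) =
        suspension_flow (\<theta> x t - \<theta> x 0) (suspension_class Y T (\<phi> x, s x + \<theta> x 0))"
      by (simp add: suspension_flow_class)
    also have "\<dots> = suspension_class Y T (\<phi> x, \<tau> x t)"
      by (simp only: flow[of 0, symmetric] hx suspension_flow_class \<tau>_def)
    finally show ?thesis using flow by simp
  qed
  have "continuous_map X Y \<phi>" "continuous_map X euclideanreal s"
    using g(1) by (simp_all add: \<phi>_def s_def continuous_map_pairwise)
  then have "flow_lift X S Y T h \<phi> \<tau>"
    unfolding flow_lift_def using eq \<theta>(1)
    by (simp add: \<tau>_def continuous_on_add continuous_on_diff)
  then show ?thesis by blast
qed

text \<open>By the tube lemma the angles over \<open>x\<close> and \<open>x0\<close> are nowhere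
  antipodal for \<open>\<bar>t\<bar> \<le> K\<close> once \<open>x\<close> is near
  \<open>x0\<close>. The time difference starts below 1/2 at \<open>t = 0\<close> and is continuous
  in \<open>t\<close>, so to reach 1/2 it would have to equal 1/2 somewhere, where the angles are
  antipodal.\<close>

lemma flow_lift_locally_close:
  assumes h: "continuous_map (suspension X S) (suspension Y T) h"
    and lift: "flow_lift X S Y T h \<phi> \<tau>" and x0: "x0 \<in> topspace X"
  shows "\<exists>U. openin X U \<and> x0 \<in> U \<and> (\<forall>x\<in>U. \<forall>t. \<bar>t\<bar> \<le> K \<longrightarrow> \<bar>\<tau> x t - \<tau> x0 t\<bar> < 1/2)"
proof (cases "K \<ge> 0")
  case False
  then show ?thesis using x0 by (intro exI[of _ "topspace X"]) auto
next
  case True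
  let ?P = "prod_topology X euclideanreal"
  define F where "F p = suspension_angle (h (suspension_class X S p))" for p
  have F: "F (x, t) = cis (2 * pi * \<tau> x t)" if "x \<in> topspace X" for x t
    using lift that by (simp add: F_def flow_lift_def suspension_angle_class)
  have cF: "continuous_map ?P euclidean F"
    using continuous_map_compose[OF continuous_map_compose[OF
          quotient_imp_continuous_map[OF quotient_map_suspension[of X S]] h]
        continuous_map_suspension_angle]
    by (simp add: o_def F_def[abs_def])
  have "continuous_map ?P ?P (\<lambda>p. (x0, snd p))"
    using x0 by (intro continuous_map_pairedI continuous_map_snd) auto
  from continuous_map_compose[OF this cF]
  have "continuous_map ?P euclidean (\<lambda>p. F p + F (x0, snd p))"
    by (intro continuous_map_add cF) (simp add: o_def)
  then have W: "openin ?P {p \<in> topspace ?P. F p + F (x0, snd p) \<in> - {0}}"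
    by (rule openin_continuous_map_preimage) auto
  have sub: "{x0} \<times> {-K..K} \<subseteq> {p \<in> topspace ?P. F p + F (x0, snd p) \<in> - {0}}"
    using x0 by (auto simp: F)
  have "compactin euclideanreal {-K..K}" by simp
  from tube_lemma_right[OF W this x0 sub] obtain U V where UV: "openin X U" "x0 \<in> U" "{-K..K} \<subseteq> V"
    "U \<times> V \<subseteq> {p \<in> topspace ?P. F p + F (x0, snd p) \<in> - {0}}"
    by blast
  define U' where "U' = U \<inter> {x \<in> topspace X. \<tau> x 0 \<in> {\<tau> x0 0 - 1/2 <..< \<tau> x0 0 + 1/2}}"
  have "openin X U'"
    unfolding U'_def using lift UV(1)
    by (intro openin_Int openin_continuous_map_preimage[of X euclideanreal]) (auto simp: flow_lift_def)
  moreover have "x0 \<in> U'" using UV x0 by (auto simp: U'_def)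
  moreover have "\<bar>\<tau> x t - \<tau> x0 t\<bar> < 1/2" if x: "x \<in> U'" and t: "\<bar>t\<bar> \<le> K" for x t
  proof (rule ccontr)
    assume "\<not> ?thesis"
    moreover have xX: "x \<in> topspace X" using x by (auto simp: U'_def)
    define f where "f r = \<bar>\<tau> x r - \<tau> x0 r\<bar>" for r
    have "\<tau> x0 0 - 1/2 < \<tau> x 0" "\<tau> x 0 < \<tau> x0 0 + 1/2" using x by (auto simp: U'_def)
    then have "f 0 < 1/2" unfolding f_def by linarith
    moreover have "continuous_on {min 0 t..max 0 t} f"
      unfolding f_def using lift xX x0
      by (auto intro!: continuous_intros simp: flow_lift_def intro: continuous_on_subset)
    ultimately have "\<exists>r\<in>{min 0 t..max 0 t}. f r = 1/2"
      using IVT'[of f "min 0 t" "1/2" "max 0 t"] IVT2'[of f "max 0 t" "1/2" "min 0 t"]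
      by (cases "t \<ge> 0") (auto simp: f_def min_def max_def)
    then obtain r where r: "r \<in> {min 0 t..max 0 t}" "\<bar>\<tau> x r - \<tau> x0 r\<bar> = 1/2"
      by (auto simp: f_def)
    have "r \<in> {-K..K}" using r(1) t by (auto simp: min_def max_def split: if_splits)
    then have "(x, r) \<in> U \<times> V" using UV(3) x by (auto simp: U'_def simp del: atLeastAtMost_iff)
    then have "F (x, r) + F (x0, r) \<noteq> 0" using UV(4) by fastforce
    then show False using cis_add_eq_0_if_half[OF r(2)] F xX x0 by simp
  qed
  ultimately show ?thesis by blast
qed

lemma flow_lift_bounded:
  assumes h: "continuous_map (suspension X S) (suspension Y T) h"
    and lift: "flow_lift X S Y T h \<phi> \<tau>" and X: "compact_space X"
  shows "\<exists>B. \<forall>x\<in>topspace X. \<forall>t. \<bar>t\<bar> \<le> K \<longrightarrow> \<bar>\<tau> x t\<bar> \<le> B"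
proof -
  define Q where "Q U \<longleftrightarrow> (\<exists>B. \<forall>x\<in>U. \<forall>t. \<bar>t\<bar> \<le> K \<longrightarrow> \<bar>\<tau> x t\<bar> \<le> B)" for U
  have "Q (topspace X)"
  proof (rule compact_space_cover_induct[OF X])
    fix x0 assume x0: "x0 \<in> topspace X"
    obtain U where U: "openin X U" "x0 \<in> U" "\<And>x t. x \<in> U \<Longrightarrow> \<bar>t\<bar> \<le> K \<Longrightarrow> \<bar>\<tau> x t - \<tau> x0 t\<bar> < 1/2"
      using flow_lift_locally_close[OF h lift x0] by metis
    have "bounded (\<tau> x0 ` {-K..K})"
      using lift x0 by (intro compact_imp_bounded compact_continuous_image)
        (auto simp: flow_lift_def intro: continuous_on_subset)
    then obtain B where B: "\<And>t. t \<in> {-K..K} \<Longrightarrow> \<bar>\<tau> x0 t\<bar> \<le> B"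
      unfolding bounded_iff by (auto simp del: atLeastAtMost_iff)
    have "\<bar>\<tau> x t\<bar> \<le> B + 1/2" if "x \<in> U" "\<bar>t\<bar> \<le> K" for x t
      using U(3)[OF that] B[of t] that by (simp add: abs_if split: if_splits)
    then have "Q U" unfolding Q_def by blast
    with U show "\<exists>U. openin X U \<and> x0 \<in> U \<and> Q U" by blast
  next
    fix U V assume "Q U" "Q V"
    then obtain B C where "\<And>x t. x \<in> U \<Longrightarrow> \<bar>t\<bar> \<le> K \<Longrightarrow> \<bar>\<tau> x t\<bar> \<le> B"
      "\<And>x t. x \<in> V \<Longrightarrow> \<bar>t\<bar> \<le> K \<Longrightarrow> \<bar>\<tau> x t\<bar> \<le> C" unfolding Q_def by metis
    then have "\<forall>x\<in>U \<union> V. \<forall>t. \<bar>t\<bar> \<le> K \<longrightarrow> \<bar>\<tau> x t\<bar> \<le> max B C"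
      by (metis Un_iff max.coboundedI1 max.coboundedI2)
    then show "Q (U \<union> V)" unfolding Q_def by blast
  qed (simp add: Q_def)
  then show ?thesis unfolding Q_def .
qed

definition orbit_cocycle ::
    "'a topology \<Rightarrow> ('a \<Rightarrow> 'a) \<Rightarrow> 'b topology \<Rightarrow> ('b \<Rightarrow> 'b) \<Rightarrow> ('a \<Rightarrow> 'b) \<Rightarrow> ('a \<Rightarrow> int) \<Rightarrow> bool" where
  "orbit_cocycle X S Y T \<phi> N \<longleftrightarrow> continuous_map X Y \<phi> \<and>
     continuous_map X (discrete_topology UNIV) N \<and>
     (\<forall>x\<in>topspace X. \<phi> (S x) = int_iterate Y T (N x) (\<phi> x))"

lemma continuous_map_discrete_UNIV:
  assumes "\<And>x. x \<in> topspace X \<Longrightarrow> \<exists>U. openin X U \<and> x \<in> U \<and> (\<forall>y\<in>U. f y = f x)"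
  shows "continuous_map X (discrete_topology UNIV) f"
  unfolding continuous_map_def
proof (intro conjI allI impI)
  fix V
  have "\<exists>U. openin X U \<and> x \<in> U \<and> U \<subseteq> {x \<in> topspace X. f x \<in> V}"
    if "x \<in> {x \<in> topspace X. f x \<in> V}" for x
    using assms[of x] that openin_subset by (smt (verit) mem_Collect_eq subset_eq)
  then show "openin X {x \<in> topspace X. f x \<in> V}" using openin_subopen by blast
qed auto

text \<open>The points \<open>(x, 1)\<close> and \<open>(S x, 0)\<close> represent the same class,
  so their lifts differ by an integer \<open>N x = \<tau> x 1 - \<tau> (S x) 0\<close>. Nearby
  points change each term by less than 1/2, so \<open>N\<close> is locally constant.\<close>

lemma flow_lift_cocycle:
  assumes S: "homeomorphic_map X X S" and T: "homeomorphic_map Y Y T"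
    and h: "continuous_map (suspension X S) (suspension Y T) h"
    and lift: "flow_lift X S Y T h \<phi> \<tau>"
  shows "\<exists>N. orbit_cocycle X S Y T \<phi> N"
proof -
  note bS = homeomorphic_map_bij_betw[OF S] and bT = homeomorphic_map_bij_betw[OF T]
  have SX: "S x \<in> topspace X" if "x \<in> topspace X" for x
    using bS that by (auto dest: bij_betwE)
  have \<phi>: "\<phi> x \<in> topspace Y" if "x \<in> topspace X" for x
    using lift that by (auto simp: flow_lift_def continuous_map_def)
  have "\<forall>x\<in>topspace X. \<exists>k. \<phi> (S x) = int_iterate Y T k (\<phi> x) \<and> \<tau> (S x) 0 = \<tau> x 1 - of_int k"
  proof
    fix x assume x: "x \<in> topspace X"
    have "suspension_class Y T (\<phi> x, \<tau> x 1) = suspension_class Y T (\<phi> (S x), \<tau> (S x) 0)"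
      using lift x SX[OF x] suspension_class_step[OF bS x, of 0] by (simp add: flow_lift_def) metis
    then show "\<exists>k. \<phi> (S x) = int_iterate Y T k (\<phi> x) \<and> \<tau> (S x) 0 = \<tau> x 1 - of_int k"
      using suspension_class_eq_iff[OF bT] \<phi> SX x by blast
  qed
  then obtain N where N: "\<And>x. x \<in> topspace X \<Longrightarrow> \<phi> (S x) = int_iterate Y T (N x) (\<phi> x)"
    "\<And>x. x \<in> topspace X \<Longrightarrow> \<tau> (S x) 0 = \<tau> x 1 - of_int (N x)"
    by metis
  have "continuous_map X (discrete_topology UNIV) N"
  proof (rule continuous_map_discrete_UNIV)
    fix x0 assume x0: "x0 \<in> topspace X"
    obtain U where U: "openin X U" "x0 \<in> U" "\<And>x t. x \<in> U \<Longrightarrow> \<bar>t\<bar> \<le> 1 \<Longrightarrow> \<bar>\<tau> x t - \<tau> x0 t\<bar> < 1/2"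
      using flow_lift_locally_close[OF h lift x0, of 1] by metis
    obtain V where V: "openin X V" "S x0 \<in> V" "\<And>x t. x \<in> V \<Longrightarrow> \<bar>t\<bar> \<le> 1 \<Longrightarrow> \<bar>\<tau> x t - \<tau> (S x0) t\<bar> < 1/2"
      using flow_lift_locally_close[OF h lift SX[OF x0], of 1] by metis
    define W where "W = U \<inter> {x \<in> topspace X. S x \<in> V}"
    have "openin X W"
      unfolding W_def using U V openin_continuous_map_preimage[OF homeomorphic_imp_continuous_map[OF S]]
      by blast
    moreover have "x0 \<in> W" using U V x0 by (simp add: W_def)
    moreover have "N x = N x0" if "x \<in> W" for x
    proof -
      have "\<bar>\<tau> x 1 - \<tau> x0 1\<bar> < 1/2" "\<bar>\<tau> (S x) 0 - \<tau> (S x0) 0\<bar> < 1/2" "x \<in> topspace X"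
        using that U(3)[of x 1] V(3)[of "S x" 0] by (auto simp: W_def)
      then have "\<bar>real_of_int (N x) - of_int (N x0)\<bar> < 1"
        using N(2)[of x] N(2)[OF x0] by linarith
      then show ?thesis by linarith
    qed
    ultimately show "\<exists>U. openin X U \<and> x0 \<in> U \<and> (\<forall>x\<in>U. N x = N x0)" by blast
  qed
  with N(1) lift show ?thesis unfolding orbit_cocycle_def flow_lift_def by blast
qed

lemma flow_equivalent_imp_flow_maps:
  assumes "flow_equivalent X S Y T"
  shows "\<exists>h g. flow_map X S Y T h \<and> flow_map Y T X S g \<and> (\<forall>c\<in>topspace (suspension X S). g (h c) = c)"
proof -
  let ?X = "suspension X S" and ?Y = "suspension Y T"
  from assms obtain h where hm: "homeomorphic_map ?X ?Y h"
    and \<theta>: "\<And>c. c \<in> topspace ?X \<Longrightarrow> \<exists>\<theta>::real \<Rightarrow> real. homeomorphic_map euclideanreal euclideanreal \<theta> \<and>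
       (\<forall>t. h (suspension_flow t c) = suspension_flow (\<theta> t) (h c))"
    unfolding flow_equivalent_def by metis
  obtain g where g: "homeomorphic_maps ?X ?Y h g" using hm homeomorphic_map_maps by blast
  then have gh: "\<And>c. c \<in> topspace ?X \<Longrightarrow> g (h c) = c" "\<And>c. c \<in> topspace ?Y \<Longrightarrow> h (g c) = c"
    and cont: "continuous_map ?X ?Y h" "continuous_map ?Y ?X g"
    by (auto simp: homeomorphic_maps_def)
  have flow: "suspension_flow t c \<in> topspace ?X" if "c \<in> topspace ?X" for t c
    using that suspension_class_mem by (force simp: topspace_suspension suspension_flow_class)
  have "flow_map X S Y T h"
    unfolding flow_map_def using cont(1) \<theta> by (fastforce dest: homeomorphic_imp_continuous_map)
  moreover have "\<exists>\<eta>. continuous_on UNIV \<eta> \<and> (\<forall>t. g (suspension_flow t c) = suspension_flow (\<eta> t) (g c))"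
    if c: "c \<in> topspace ?Y" for c
  proof -
    have gc: "g c \<in> topspace ?X" using cont(2) c by (auto simp: continuous_map_def)
    obtain \<theta>' where t: "homeomorphic_map euclideanreal euclideanreal \<theta>'"
      "\<And>t. h (suspension_flow t (g c)) = suspension_flow (\<theta>' t) (h (g c))"
      using \<theta>[OF gc] by blast
    then obtain \<eta> where \<eta>: "homeomorphic_maps euclideanreal euclideanreal \<theta>' \<eta>"
      using homeomorphic_map_maps by blast
    then have "continuous_on UNIV \<eta>" "\<And>t. \<theta>' (\<eta> t) = t" by (auto simp: homeomorphic_maps_def)
    moreover have "g (suspension_flow t c) = suspension_flow (\<eta> t) (g c)" for t
      using t(2)[of "\<eta> t"] gh(1)[OF flow[OF gc]] gh(2)[OF c] \<open>\<theta>' (\<eta> t) = t\<close> by metis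
    ultimately show ?thesis by blast
  qed
  then have "flow_map Y T X S g" unfolding flow_map_def using cont(2) by blast
  ultimately show ?thesis using gh by blast
qed

text \<open>Lifting \<open>h\<close> and then its inverse returns from \<open>x\<close> to the same
  class, so \<open>\<psi> (\<phi> x)\<close> lies on the orbit of \<open>x\<close>. The number of
  steps is the time \<open>\<rho> (\<phi> x) (\<tau> x 0)\<close>, bounded because \<tau> is bounded
  at time 0 by \<open>B\<close> and \<rho> is bounded on times up to \<open>B\<close>.\<close>

lemma flow_equivalent_imp_orbit_cocycles:
  assumes X: "compact_space X" "zero_dimensional X" "homeomorphic_map X X S"
    and Y: "compact_space Y" "zero_dimensional Y" "homeomorphic_map Y Y T"
    and eq: "flow_equivalent X S Y T"
  shows "\<exists>\<phi> N \<psi> M. orbit_cocycle X S Y T \<phi> N \<and> orbit_cocycle Y T X S \<psi> M \<and>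
    (\<exists>B j. \<forall>x\<in>topspace X. x = int_iterate X S (j x) (\<psi> (\<phi> x)) \<and> \<bar>j x\<bar> \<le> (B::int))"
proof -
  obtain h g where h: "flow_map X S Y T h" and g: "flow_map Y T X S g"
    and gh: "\<And>c. c \<in> topspace (suspension X S) \<Longrightarrow> g (h c) = c"
    using flow_equivalent_imp_flow_maps[OF eq] by blast
  note ch = h[unfolded flow_map_def, THEN conjunct1] and cg = g[unfolded flow_map_def, THEN conjunct1]
  obtain \<phi> \<tau> where \<tau>: "flow_lift X S Y T h \<phi> \<tau>" using flow_lift_exists[OF X(1,2) Y(3) h] by blast
  obtain \<psi> \<rho> where \<rho>: "flow_lift Y T X S g \<psi> \<rho>" using flow_lift_exists[OF Y(1,2) X(3) g] by blast
  obtain N where N: "orbit_cocycle X S Y T \<phi> N" using flow_lift_cocycle[OF X(3) Y(3) ch \<tau>] by blast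
  obtain M where M: "orbit_cocycle Y T X S \<psi> M" using flow_lift_cocycle[OF Y(3) X(3) cg \<rho>] by blast
  obtain B where B: "\<And>x t. x \<in> topspace X \<Longrightarrow> \<bar>t\<bar> \<le> 0 \<Longrightarrow> \<bar>\<tau> x t\<bar> \<le> B"
    using flow_lift_bounded[OF ch \<tau> X(1)] by metis
  obtain C where C: "\<And>y t. y \<in> topspace Y \<Longrightarrow> \<bar>t\<bar> \<le> B \<Longrightarrow> \<bar>\<rho> y t\<bar> \<le> C"
    using flow_lift_bounded[OF cg \<rho> Y(1)] by metis
  have "\<exists>j. x = int_iterate X S j (\<psi> (\<phi> x)) \<and> \<bar>j\<bar> \<le> \<lceil>C\<rceil>" if x: "x \<in> topspace X" for x
  proof -
    have \<phi>x: "\<phi> x \<in> topspace Y" using \<tau> x by (auto simp: flow_lift_def continuous_map_def)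
    then have \<psi>x: "\<psi> (\<phi> x) \<in> topspace X" using \<rho> by (auto simp: flow_lift_def continuous_map_def)
    have "suspension_class X S (\<psi> (\<phi> x), \<rho> (\<phi> x) (\<tau> x 0)) = suspension_class X S (x, 0)"
      using \<rho> \<phi>x \<tau> x gh[OF suspension_class_mem[OF x]] unfolding flow_lift_def by metis
    then obtain j where "x = int_iterate X S j (\<psi> (\<phi> x))" "0 = \<rho> (\<phi> x) (\<tau> x 0) - of_int j"
      using suspension_class_eq_iff[OF homeomorphic_map_bij_betw[OF X(3)] \<psi>x x] by blast
    moreover from this have "\<bar>real_of_int j\<bar> \<le> C" using C[OF \<phi>x, of "\<tau> x 0"] B[OF x, of 0] by simp
    then have "\<bar>j\<bar> \<le> \<lceil>C\<rceil>" by linarith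
    ultimately show ?thesis by blast
  qed
  then have "\<exists>j. \<forall>x\<in>topspace X. x = int_iterate X S (j x) (\<psi> (\<phi> x)) \<and> \<bar>j x\<bar> \<le> \<lceil>C\<rceil>" by metis
  with N M show ?thesis by blast
qed

section \<open>Equidistribution of Sturmian sequences\<close>

text \<open>Signed like an oriented integral, so that recursion and additivity hold for negative
  \<open>m\<close> too.\<close>

definition ssum :: "(int \<Rightarrow> 'a::ab_group_add) \<Rightarrow> int \<Rightarrow> 'a" where
  "ssum g m = (if m \<ge> 0 then sum g {0..<m} else - sum g {m..<0})"

lemma ssum_0 [simp]: "ssum g 0 = 0"
  by (simp add: ssum_def)

lemma ssum_succ: "ssum g (m + 1) = ssum g m + g m"
proof (cases "m \<ge> 0")
  case True
  then have "{0..<m + 1} = insert m {0..<m}" by auto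
  with True show ?thesis by (simp add: ssum_def)
next
  case False
  then have "{m..<0} = insert m {m + 1..<0}" by auto
  with False show ?thesis by (cases "m = -1") (simp_all add: ssum_def)
qed

lemma ssum_unique:
  assumes "G 0 = 0" "\<And>m. G (m + 1) = G m + g m"
  shows "ssum g m = G m"
proof (induction m rule: int_induct[where k = 0])
  case (step2 i)
  then show ?case using ssum_succ[of g "i - 1"] assms(2)[of "i - 1"] by simp
qed (simp_all add: assms ssum_succ)

lemma ssum_add_shift: "ssum g (m + k) = ssum g m + ssum (\<lambda>i. g (i + m)) k"
proof -
  have "ssum (\<lambda>i. g (i + m)) k = ssum g (m + k) - ssum g m"
    by (rule ssum_unique) (use ssum_succ[of g "m + _"] in \<open>simp_all add: add_ac\<close>)
  then show ?thesis by simp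
qed

lemma ssum_add: "ssum (\<lambda>i. f i + g i) m = ssum f m + ssum g m"
  by (rule ssum_unique) (simp_all add: ssum_succ)

lemma ssum_minus: "ssum (\<lambda>i. - f i) m = - ssum f m"
  by (rule ssum_unique) (simp_all add: ssum_succ)

lemma ssum_const: "ssum (\<lambda>i. c) m = of_int m * (c::'a::ring_1)"
  by (rule ssum_unique) (simp_all add: algebra_simps)

lemma ssum_telescope: "ssum (\<lambda>i. F (i + 1) - F i) m = F m - F 0"
  by (rule ssum_unique) simp_all

lemma ssum_cong: "(\<And>i. \<bar>i\<bar> \<le> \<bar>m\<bar> \<Longrightarrow> f i = g i) \<Longrightarrow> ssum f m = ssum g m"
  by (auto simp: ssum_def intro!: sum.cong)

lemma sum_symmetric_interval_ssum:
  assumes "K \<ge> 0"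
  shows "sum g {-K..<K} = ssum g K - ssum g (-K)"
proof -
  have "{-K..<K} = {-K..<0} \<union> {0..<K}" using assms by auto
  then have "sum g {-K..<K} = sum g {-K..<0} + sum g {0..<K}"
    by (simp add: sum.union_disjoint[symmetric])
  then show ?thesis using assms by (simp add: ssum_def)
qed

text \<open>The integral of the floor function from 0 to \<open>v\<close>.\<close>

definition floor_primitive :: "real \<Rightarrow> real" where
  "floor_primitive v = of_int \<lfloor>v\<rfloor> * v - of_int \<lfloor>v\<rfloor> * (of_int \<lfloor>v\<rfloor> + 1) / 2"

text \<open>The deviation from the parabola is \<open>f * (1 - f) / 2\<close> with \<open>f\<close>
  the fractional part of \<open>v\<close>, which is at most 1/8.\<close>

lemma floor_primitive_bounds:
  "v\<^sup>2 / 2 - v / 2 \<le> floor_primitive v" "floor_primitive v \<le> v\<^sup>2 / 2 - v / 2 + 1/8"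
proof -
  define f where "f = v - of_int \<lfloor>v\<rfloor>"
  have f: "0 \<le> f" "f \<le> 1" unfolding f_def by linarith+
  have eq: "floor_primitive v = v\<^sup>2 / 2 - v / 2 + f * (1 - f) / 2"
    unfolding floor_primitive_def f_def by (simp add: field_simps power2_eq_square)
  show "v\<^sup>2 / 2 - v / 2 \<le> floor_primitive v" using f by (simp add: eq)
  have "0 \<le> (f - 1/2)\<^sup>2" by simp
  then have "f * (1 - f) \<le> 1/4" by (simp add: power2_eq_square algebra_simps)
  then show "floor_primitive v \<le> v\<^sup>2 / 2 - v / 2 + 1/8" by (simp add: eq)
qed

text \<open>Convexity: \<open>\<lfloor>v\<rfloor>\<close> is a slope of a supporting line at
  \<open>v\<close>.\<close>

lemma floor_primitive_tangent:
  "floor_primitive v + of_int \<lfloor>v\<rfloor> * (w - v) \<le> floor_primitive w"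
proof -
  define a b where "a = \<lfloor>v\<rfloor>" and "b = \<lfloor>w\<rfloor>"
  have b: "of_int b \<le> w" "w \<le> of_int b + 1" unfolding b_def by linarith+
  have "floor_primitive w - (floor_primitive v + of_int a * (w - v)) =
      of_int (b - a) * (w - of_int b - 1/2) + of_int (b - a) * of_int (b - a) / 2"
    by (simp add: floor_primitive_def a_def[symmetric] b_def[symmetric] field_simps)
  also have "\<dots> \<ge> 0"
  proof (cases "b - a \<ge> 1")
    case True
    have "of_int (b - a) * (w - of_int b - 1/2) \<ge> of_int (b - a) * (-1/2 :: real)"
      using True b by (intro mult_left_mono) auto
    moreover have "real_of_int (b - a) * of_int (b - a) \<ge> of_int (b - a) * 1"
      using True by (intro mult_left_mono) auto
    ultimately show ?thesis by linarith
  next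
    case False
    then have le: "b - a \<le> 0" by simp
    have "of_int (b - a) * (w - of_int b - 1/2) \<ge> of_int (b - a) * (1/2 :: real)"
      using le b by (intro mult_left_mono_neg) auto
    moreover have "real_of_int (b - a) * of_int (b - a) \<ge> of_int (b - a) * - 1"
    proof (cases "b = a")
      case False
      then show ?thesis using le by (intro mult_left_mono_neg) auto
    qed simp
    ultimately show ?thesis by linarith
  qed
  finally show ?thesis by (simp add: a_def)
qed

text \<open>The floor function being monotone, the error of its Riemann sums telescopes.\<close>

lemma sum_floor_bounds:
  assumes "\<delta> > 0"
  shows "\<delta> * (\<Sum>l<L. of_int \<lfloor>u + of_nat l * \<delta>\<rfloor>) \<le> floor_primitive (u + of_nat L * \<delta>) - floor_primitive u"
    and "floor_primitive (u + of_nat L * \<delta>) - floor_primitive u - \<delta> * of_int (\<lfloor>u + of_nat L * \<delta>\<rfloor> - \<lfloor>u\<rfloor>)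
      \<le> \<delta> * (\<Sum>l<L. of_int \<lfloor>u + of_nat l * \<delta>\<rfloor>)"
proof (induction L)
  case (Suc L)
  {
    case 1
    show ?case
      using Suc(1) floor_primitive_tangent[of "u + of_nat L * \<delta>" "u + of_nat (Suc L) * \<delta>"]
      by (simp add: algebra_simps)
  next
    case 2
    show ?case
      using Suc(2) floor_primitive_tangent[of "u + of_nat (Suc L) * \<delta>" "u + of_nat L * \<delta>"]
      by (simp add: algebra_simps)
  }
qed simp_all

text \<open>Deviation from its mean \<open>c\<close> of a function of period 1. For
  \<open>c = frac \<alpha>\<close> and \<open>v\<close> a multiple of \<open>frac \<alpha>\<close>,
  the floor difference is a digit of the Sturmian point.\<close>

definition floor_defect :: "real \<Rightarrow> real \<Rightarrow> real" where
  "floor_defect c v = of_int (\<lfloor>v + c\<rfloor> - \<lfloor>v\<rfloor>) - c"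

lemma floor_defect_bound: "\<bar>floor_defect c v\<bar> \<le> 1"
  unfolding floor_defect_def by linarith

lemma floor_defect_add_int [simp]: "floor_defect c (v + of_int k) = floor_defect c v"
proof -
  have "\<lfloor>v + of_int k + c\<rfloor> = \<lfloor>v + c\<rfloor> + k" by (metis add.assoc add.commute floor_add_int)
  then show ?thesis by (simp add: floor_defect_def)
qed

text \<open>For a rotation with small step the sums times \<delta> are Riemann sums of the floor
  function. The parabolic parts of the four primitives combine to exactly \<open>c * d\<close>,
  which cancels the subtracted mean; the rest is bounded error.\<close>

lemma sum_floor_defect_slow:
  assumes "\<delta> > 0"
  shows "\<bar>\<Sum>l<L. floor_defect c (u + of_nat l * \<delta>)\<bar> \<le> of_nat L * \<delta> + 1 + 1 / \<delta>"
proof -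
  define S S' where "S = (\<Sum>l<L. real_of_int \<lfloor>u + of_nat l * \<delta>\<rfloor>)"
    and "S' = (\<Sum>l<L. real_of_int \<lfloor>u + c + of_nat l * \<delta>\<rfloor>)"
  define d where "d = of_nat L * \<delta>"
  have sum: "(\<Sum>l<L. floor_defect c (u + of_nat l * \<delta>)) = S' - S - of_nat L * c"
    by (simp add: floor_defect_def S_def S'_def sum_subtractf sum.distrib algebra_simps)
  have fl: "of_int (\<lfloor>v + d\<rfloor> - \<lfloor>v\<rfloor>) \<le> d + 1" for v by linarith
  have mul: "\<delta> * of_int (\<lfloor>v + d\<rfloor> - \<lfloor>v\<rfloor>) \<le> \<delta> * (d + 1)" for v
    using fl assms by (intro mult_left_mono) auto
  have quad: "((u + c + d)\<^sup>2 / 2 - (u + c + d) / 2) - ((u + c)\<^sup>2 / 2 - (u + c) / 2)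
      - (((u + d)\<^sup>2 / 2 - (u + d) / 2) - (u\<^sup>2 / 2 - u / 2)) = c * d"
    by (simp add: field_simps power2_eq_square)
  note b = floor_primitive_bounds[of "u + c + d"] floor_primitive_bounds[of "u + c"]
    floor_primitive_bounds[of "u + d"] floor_primitive_bounds[of u]
  note s = sum_floor_bounds[OF assms, where L = L and u = u, folded S_def d_def]
    sum_floor_bounds[OF assms, where L = L and u = "u + c", folded S'_def d_def]
  have "\<bar>\<delta> * S' - \<delta> * S - c * d\<bar> \<le> \<delta> * (d + 1) + 1/4"
    using b s mul[of u] mul[of "u + c"] quad by linarith
  moreover have "\<delta> * S' - \<delta> * S - c * d = \<delta> * (S' - S - of_nat L * c)"
    by (simp add: d_def algebra_simps)
  ultimately have "\<delta> * \<bar>S' - S - of_nat L * c\<bar> \<le> \<delta> * (d + 1) + 1"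
    using assms by (simp add: abs_mult)
  also have "\<dots> = \<delta> * (d + 1 + 1 / \<delta>)" using assms by (simp add: field_simps)
  finally show ?thesis using assms by (simp add: sum d_def)
qed

lemma irrational_small_multiple:
  fixes \<theta> \<epsilon> :: real
  assumes "\<theta> \<notin> \<rat>" "\<epsilon> > 0"
  shows "\<exists>q p \<delta>. 0 < \<delta> \<and> \<delta> < \<epsilon> \<and> of_nat q * \<theta> = of_int p + \<delta>"
proof -
  obtain h k where "k > 0" "\<bar>of_int k * \<theta> - of_int h - \<epsilon> / 2\<bar> < \<epsilon> / 2"
    using sequence_of_fractional_parts_is_dense[OF assms(1), of "\<epsilon> / 2" "\<epsilon> / 2"] assms(2)
    by (metis half_gt_zero)
  moreover from this have "0 < of_int k * \<theta> - of_int h" "of_int k * \<theta> - of_int h < \<epsilon>"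
    by linarith+
  ultimately show ?thesis
    by (intro exI[of _ "nat k"] exI[of _ h] exI[of _ "of_int k * \<theta> - of_int h"]) simp
qed

text \<open>Each step of the starting point exchanges one boundary term for another, both at most 1
  in absolute value.\<close>

lemma sum_floor_defect_shift:
  "\<bar>(\<Sum>i<k. floor_defect c (t + of_nat i * \<theta>)) -
    (\<Sum>i<k. floor_defect c (t + of_nat j * \<theta> + of_nat i * \<theta>))\<bar> \<le> 2 * of_nat j"
proof (induction j)
  case (Suc j)
  define g where "g i = floor_defect c (t + of_nat j * \<theta> + of_nat i * \<theta>)" for i :: nat
  have "(\<Sum>i<k. floor_defect c (t + of_nat (Suc j) * \<theta> + of_nat i * \<theta>)) = (\<Sum>i<k. g (Suc i))"
    by (simp add: g_def algebra_simps)
  also have "\<dots> = sum g {..<k} + (g k - g 0)"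
    by (induction k) simp_all
  finally show ?case
    using Suc floor_defect_bound[of c "t + of_nat j * \<theta> + of_nat k * \<theta>"]
      floor_defect_bound[of c "t + of_nat j * \<theta> + of_nat 0 * \<theta>"]
    unfolding g_def by simp
qed simp

text \<open>Some multiple \<open>q * \<theta>\<close> is a small \<delta> modulo 1. Averaging the
  sum over \<open>L\<close> starting points \<open>q\<close> steps apart and exchanging the
  summations turns the inner sums into slow rotations, while moving the starting point costs at most
  \<open>2 * q * L\<close>. The resulting constant does not depend on \<open>t\<close>.\<close>

lemma sum_floor_defect_small:
  assumes \<theta>: "\<theta> \<notin> \<rat>" and \<epsilon>: "\<epsilon> > 0"
  shows "\<exists>C. \<forall>t k. \<bar>\<Sum>i<k. floor_defect c (t + of_nat i * \<theta>)\<bar> \<le> \<epsilon> * of_nat k + C"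
proof -
  obtain q p \<delta> where \<delta>: "0 < \<delta>" "\<delta> < \<epsilon> / 2" "of_nat q * \<theta> = of_int p + \<delta>"
    using irrational_small_multiple[OF \<theta>, of "\<epsilon> / 2"] \<epsilon> by auto
  \<comment> \<open>The bound for slow rotations is \<open>L * \<delta> + 1 + 1 / \<delta>\<close>;
    the choice of \<delta> controls its first term by half of \<open>L * \<epsilon>\<close>, this
    choice of \<open>L\<close> the other two.\<close>
  obtain L :: nat where "of_nat L > (1 + 1 / \<delta>) / (\<epsilon> / 2)" using reals_Archimedean2 by blast
  then have L: "1 + 1 / \<delta> < of_nat L * (\<epsilon> / 2)" using \<epsilon> by (simp add: field_simps)
  have "0 < L" using L \<delta> by (cases L) (auto simp: field_simps)
  have inner: "\<bar>\<Sum>l<L. floor_defect c (u + of_nat l * \<delta>)\<bar> \<le> of_nat L * \<epsilon>" for u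
  proof -
    have "of_nat L * \<delta> \<le> of_nat L * (\<epsilon> / 2)" using \<delta> by (intro mult_left_mono) auto
    then show ?thesis using sum_floor_defect_slow[OF \<delta>(1), where L = L and u = u and c = c] L by (simp add: algebra_simps)
  qed
  have "\<bar>\<Sum>i<k. floor_defect c (t + of_nat i * \<theta>)\<bar> \<le> \<epsilon> * of_nat k + 2 * of_nat q * of_nat L" for t k
  proof -
    define s where "s l = (\<Sum>i<k. floor_defect c (t + of_nat (l * q) * \<theta> + of_nat i * \<theta>))" for l
    have s: "s l = (\<Sum>i<k. floor_defect c ((t + of_nat i * \<theta>) + of_nat l * \<delta>))" for l
      unfolding s_def
    proof (rule sum.cong[OF refl])
      fix i
      have "of_nat (l * q) * \<theta> = of_nat l * (of_nat q * \<theta>)" by simp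
      also have "\<dots> = of_nat l * \<delta> + of_int (int l * p)" unfolding \<delta>(3) by (simp add: algebra_simps)
      finally have "t + of_nat (l * q) * \<theta> + of_nat i * \<theta> =
          ((t + of_nat i * \<theta>) + of_nat l * \<delta>) + of_int (int l * p)" by simp
      then show "floor_defect c (t + of_nat (l * q) * \<theta> + of_nat i * \<theta>) =
          floor_defect c ((t + of_nat i * \<theta>) + of_nat l * \<delta>)" by (simp only: floor_defect_add_int)
    qed
    have "\<bar>\<Sum>l<L. s l\<bar> \<le> (\<Sum>i<k. \<bar>\<Sum>l<L. floor_defect c ((t + of_nat i * \<theta>) + of_nat l * \<delta>)\<bar>)"
      unfolding s by (subst sum.swap) (rule sum_abs)
    also have "\<dots> \<le> of_nat k * (of_nat L * \<epsilon>)"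
      using sum_mono[of "{..<k}" _ "\<lambda>_. of_nat L * \<epsilon>"] inner by simp
    finally have 1: "\<bar>\<Sum>l<L. s l\<bar> \<le> of_nat k * (of_nat L * \<epsilon>)" .
    define S where "S = (\<Sum>i<k. floor_defect c (t + of_nat i * \<theta>))"
    have "\<bar>S - s l\<bar> \<le> 2 * of_nat q * of_nat L" if "l < L" for l
    proof -
      have "\<bar>S - s l\<bar> \<le> 2 * of_nat (l * q)"
        unfolding S_def s_def by (rule sum_floor_defect_shift)
      also have "l * q \<le> L * q" using that by simp
      then have "2 * real (l * q) \<le> 2 * of_nat (L * q)" by (simp only: of_nat_le_iff mult_le_cancel_left_pos zero_less_numeral)
      finally show ?thesis by (simp add: mult_ac)
    qed
    then have "\<bar>\<Sum>l<L. S - s l\<bar> \<le> of_nat L * (2 * of_nat q * of_nat L)"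
      using sum_norm_le[of "{..<L}" "\<lambda>l. S - s l" "\<lambda>_. 2 * of_nat q * of_nat L"] by simp
    then have "\<bar>of_nat L * S\<bar> \<le> of_nat k * (of_nat L * \<epsilon>) + of_nat L * (2 * of_nat q * of_nat L)"
      using 1 by (simp add: sum_subtractf)
    then have "of_nat L * \<bar>S\<bar> \<le> of_nat L * (\<epsilon> * of_nat k + 2 * of_nat q * of_nat L)"
      by (simp add: abs_mult algebra_simps)
    then show ?thesis using \<open>0 < L\<close> by (simp add: S_def)
  qed
  then show ?thesis by blast
qed

text \<open>A sum over negative times is minus a forward sum started at
  \<open>t + m * \<theta>\<close>, so uniformity in \<open>t\<close> covers both signs.\<close>

lemma ssum_floor_difference:
  fixes \<theta> \<epsilon> c :: real
  assumes \<theta>: "\<theta> \<notin> \<rat>" and \<epsilon>: "\<epsilon> > 0"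
  shows "\<exists>C. \<forall>t m. \<bar>of_int (ssum (\<lambda>i. \<lfloor>t + of_int i * \<theta> + c\<rfloor> - \<lfloor>t + of_int i * \<theta>\<rfloor>) m) - c * of_int m\<bar>
    \<le> \<epsilon> * of_int \<bar>m\<bar> + C"
proof -
  obtain C where C: "\<And>t k. \<bar>\<Sum>i<k. floor_defect c (t + of_nat i * \<theta>)\<bar> \<le> \<epsilon> * of_nat k + C"
    using sum_floor_defect_small[OF assms] by blast
  have ssum: "of_int (ssum (\<lambda>i. \<lfloor>t + of_int i * \<theta> + c\<rfloor> - \<lfloor>t + of_int i * \<theta>\<rfloor>) m) - c * of_int m =
      ssum (\<lambda>i. floor_defect c (t + of_int i * \<theta>)) m" for t m
    by (rule sym, rule ssum_unique) (simp_all add: ssum_succ floor_defect_def algebra_simps)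
  have pos: "ssum g (int k) = (\<Sum>i<k. g (int i))" for g :: "int \<Rightarrow> real" and k
    by (induction k) (use ssum_succ[of g "int _"] in \<open>simp_all add: add.commute\<close>)
  have "\<bar>ssum (\<lambda>i. floor_defect c (t + of_int i * \<theta>)) m\<bar> \<le> \<epsilon> * of_int \<bar>m\<bar> + C" for t m
  proof (cases "m \<ge> 0")
    case True
    then show ?thesis using C[where k = "nat m" and t = t] pos[of _ "nat m"] by simp
  next
    case False
    define k where "k = nat (- m)"
    have m: "m = - int k" using False by (simp add: k_def)
    have "ssum (\<lambda>i. floor_defect c (t + of_int i * \<theta>)) m =
        - ssum (\<lambda>i. floor_defect c (t + of_int (i + m) * \<theta>)) (int k)"
      using ssum_add_shift[of "\<lambda>i. floor_defect c (t + of_int i * \<theta>)" m "int k"] by (simp add: m)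
    also have "\<dots> = - (\<Sum>i<k. floor_defect c ((t + of_int m * \<theta>) + of_nat i * \<theta>))"
      by (simp add: pos algebra_simps)
    finally show ?thesis using C[where k = k and t = "t + of_int m * \<theta>"] by (simp add: m)
  qed
  then show ?thesis unfolding ssum by blast
qed

section \<open>Windows in Sturmian systems\<close>

definition agree :: "int \<Rightarrow> (int \<Rightarrow> nat) \<Rightarrow> (int \<Rightarrow> nat) \<Rightarrow> bool" where
  "agree m x y \<longleftrightarrow> (\<forall>i. \<bar>i\<bar> \<le> m \<longrightarrow> x i = y i)"

lemma agree_sym: "agree m x y \<Longrightarrow> agree m y x"
  by (simp add: agree_def)

lemma agree_refl [simp]: "agree m x x"
  by (simp add: agree_def)

lemma agree_trans: "agree m x y \<Longrightarrow> agree m y z \<Longrightarrow> agree m x z"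
  by (simp add: agree_def)

lemma agree_mono: "agree m x y \<Longrightarrow> k \<le> m \<Longrightarrow> agree k x y"
  by (simp add: agree_def)

lemma openin_full_shift_agree:
  assumes U: "openin full_shift U" and y: "y \<in> U"
  shows "\<exists>m. \<forall>z\<in>topspace full_shift. agree m y z \<longrightarrow> z \<in> U"
proof -
  obtain V where V: "finite {i. V i \<noteq> {0, 1 :: nat}}" "y \<in> Pi\<^sub>E UNIV V" "Pi\<^sub>E UNIV V \<subseteq> U"
    using U y unfolding full_shift_def openin_product_topology_alt by auto
  define m where "m = Max (insert 0 (abs ` {i. V i \<noteq> {0, 1}}))"
  have m: "\<bar>i\<bar> \<le> m" if "V i \<noteq> {0, 1}" for i
    using V(1) that unfolding m_def by (intro Max_ge) auto
  have "z \<in> U" if z: "z \<in> topspace full_shift" "agree m y z" for z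
  proof -
    have "z i \<in> V i" for i
    proof (cases "V i = {0, 1}")
      case True
      then show ?thesis using z(1) by (auto simp: topspace_full_shift)
    next
      case False
      then show ?thesis using m z(2) V(2) by (metis PiE_mem UNIV_I agree_def)
    qed
    then show ?thesis using V(3) by (auto simp: PiE_UNIV_domain)
  qed
  then show ?thesis by blast
qed

lemma continuous_map_coordinate:
  "continuous_map full_shift (discrete_topology {0, 1}) (\<lambda>y. y i)"
  unfolding full_shift_def
  by (rule continuous_map_product_projection[where X = "\<lambda>_. discrete_topology {0, 1}"]) simp

lemma openin_coordinate: "openin full_shift {z \<in> topspace full_shift. z i \<in> V}"
proof -
  have "openin full_shift {z \<in> topspace full_shift. z i \<in> V \<inter> {0, 1}}"
    by (rule openin_continuous_map_preimage[OF continuous_map_coordinate]) simp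
  moreover have "{z \<in> topspace full_shift. z i \<in> V \<inter> {0, 1}} = {z \<in> topspace full_shift. z i \<in> V}"
    by (auto simp: topspace_full_shift)
  ultimately show ?thesis by simp
qed

lemma openin_agree: "openin full_shift {z \<in> topspace full_shift. agree m y z}"
proof -
  have "{z \<in> topspace full_shift. agree m y z} =
      topspace full_shift \<inter> \<Inter>((\<lambda>i. {z \<in> topspace full_shift. z i \<in> {y i}}) ` {-m..m})"
    by (auto simp: agree_def abs_le_iff)
  moreover have "openin full_shift (topspace full_shift \<inter> \<Inter>((\<lambda>i. {z \<in> topspace full_shift. z i \<in> {y i}}) ` {-m..m}))"
    by (intro openin_Int_Inter openin_topspace) (use openin_coordinate in blast)+
  ultimately show ?thesis by (simp only:)
qed

lemma closedin_agree: "closedin full_shift {z \<in> topspace full_shift. agree m y z}"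
proof -
  have "topspace full_shift - {z \<in> topspace full_shift. agree m y z} =
      (\<Union>i\<in>{-m..m}. {z \<in> topspace full_shift. z i \<in> - {y i}})"
    by (auto simp: agree_def abs_le_iff)
  moreover have "openin full_shift (\<Union>i\<in>{-m..m}. {z \<in> topspace full_shift. z i \<in> - {y i}})"
    by (intro openin_Union) (auto simp del: Compl_iff intro: openin_coordinate)
  ultimately show ?thesis by (simp add: closedin_def)
qed

lemma closure_of_full_shift:
  assumes "B \<subseteq> topspace full_shift"
  shows "full_shift closure_of B = {y \<in> topspace full_shift. \<forall>m. \<exists>b\<in>B. agree m y b}" (is "_ = ?R")
proof (intro equalityI subsetI)
  fix y assume y: "y \<in> full_shift closure_of B"
  then have "y \<in> topspace full_shift" by (simp add: in_closure_of)
  moreover have "\<exists>b\<in>B. agree m y b" for m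
    using y openin_agree[of m y] \<open>y \<in> topspace full_shift\<close> unfolding in_closure_of
    by (metis (no_types, lifting) agree_refl mem_Collect_eq)
  ultimately show "y \<in> ?R" by simp
next
  fix y assume y: "y \<in> ?R"
  have "\<exists>b. b \<in> B \<and> b \<in> U" if U: "y \<in> U" "openin full_shift U" for U
  proof -
    obtain m where m: "\<forall>z\<in>topspace full_shift. agree m y z \<longrightarrow> z \<in> U"
      using openin_full_shift_agree[OF U(2,1)] ..
    obtain b where "b \<in> B" "agree m y b" using y by auto
    then show ?thesis using m assms by (auto dest: bspec)
  qed
  then show "y \<in> full_shift closure_of B" using y by (simp add: in_closure_of)
qed

lemma zero_dimensional_subshift: "zero_dimensional (subtopology full_shift A)"
  unfolding zero_dimensional_def
proof (intro allI impI)
  fix U x assume U: "openin (subtopology full_shift A) U" "x \<in> U"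
  then obtain W where W: "openin full_shift W" "U = W \<inter> A" by (auto simp: openin_subtopology)
  have x: "x \<in> topspace full_shift" "x \<in> A" using U W openin_subset by blast+
  obtain m where m: "\<And>z. z \<in> topspace full_shift \<Longrightarrow> agree m x z \<Longrightarrow> z \<in> W"
    using openin_full_shift_agree[OF W(1)] U W by blast
  define V where "V = {z \<in> topspace full_shift. agree m x z}"
  have "openin (subtopology full_shift A) (V \<inter> A)" "closedin (subtopology full_shift A) (V \<inter> A)"
    using openin_agree[of m x] closedin_agree[of m x] unfolding V_def openin_subtopology closedin_subtopology
    by blast+
  moreover have "x \<in> V \<inter> A" "V \<inter> A \<subseteq> U" using x m W by (auto simp: V_def)
  ultimately show "\<exists>V. openin (subtopology full_shift A) V \<and> closedin (subtopology full_shift A) V \<and> x \<in> V \<and> V \<subseteq> U"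
    by blast
qed

lemma continuous_map_discrete_window:
  assumes A: "A \<subseteq> topspace full_shift" and comp: "compact_space (subtopology full_shift A)"
    and f: "continuous_map (subtopology full_shift A) (discrete_topology UNIV) f"
  shows "\<exists>m. \<forall>x\<in>A. \<forall>y\<in>A. agree m x y \<longrightarrow> f x = f y"
proof -
  let ?X = "subtopology full_shift A"
  have top: "topspace ?X = A" using A by auto
  \<comment> \<open>Only \<open>x\<close> is confined to \<open>U\<close>, while \<open>y\<close>
    ranges over all of \<open>A\<close>; the union step then needs just the larger of two
    windows.\<close>
  define Q where "Q U \<longleftrightarrow> (\<exists>m. \<forall>x\<in>U \<inter> A. \<forall>y\<in>A. agree m x y \<longrightarrow> f x = f y)" for U
  have "Q (topspace ?X)"
  proof (rule compact_space_cover_induct[OF comp])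
    fix x assume x: "x \<in> topspace ?X"
    have "openin ?X {y \<in> topspace ?X. f y \<in> {f x}}"
      using f by (rule openin_continuous_map_preimage) simp
    then obtain W where W: "openin full_shift W" "{y \<in> topspace ?X. f y \<in> {f x}} = W \<inter> A"
      by (auto simp: openin_subtopology)
    have "x \<in> W" using W x by auto
    then obtain m where m: "\<And>z. z \<in> topspace full_shift \<Longrightarrow> agree m x z \<Longrightarrow> z \<in> W"
      using openin_full_shift_agree[OF W(1)] by blast
    define V where "V = {z \<in> topspace full_shift. agree m x z} \<inter> A"
    have fz: "f z = f x" if "z \<in> A" "agree m x z" for z
    proof -
      have "z \<in> W \<inter> A" using m that A by auto
      then show ?thesis unfolding W(2)[symmetric] by simp
    qed
    have "openin ?X V" using openin_agree[of m x] unfolding V_def openin_subtopology by blast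
    moreover have "x \<in> V" using x by (simp add: V_def)
    moreover have "f z = f y" if "z \<in> V \<inter> A" "y \<in> A" "agree m z y" for z y
      using fz[of z] fz[of y] that agree_trans[of m x z y] by (simp add: V_def)
    then have "Q V" unfolding Q_def by blast
    ultimately show "\<exists>U. openin ?X U \<and> x \<in> U \<and> Q U" by blast
  next
    fix U V assume "Q U" "Q V"
    then obtain m k where "\<And>x y. x \<in> U \<inter> A \<Longrightarrow> y \<in> A \<Longrightarrow> agree m x y \<Longrightarrow> f x = f y"
      "\<And>x y. x \<in> V \<inter> A \<Longrightarrow> y \<in> A \<Longrightarrow> agree k x y \<Longrightarrow> f x = f y" unfolding Q_def by metis
    then have "\<forall>x\<in>(U \<union> V) \<inter> A. \<forall>y\<in>A. agree (max m k) x y \<longrightarrow> f x = f y"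
      by (metis Int_iff Un_iff agree_mono max.cobounded1 max.cobounded2)
    then show "Q (U \<union> V)" unfolding Q_def by blast
  qed (simp add: Q_def)
  then show ?thesis unfolding Q_def top by simp
qed

lemma continuous_map_full_shift_window:
  assumes A: "A \<subseteq> topspace full_shift" and comp: "compact_space (subtopology full_shift A)"
    and f: "continuous_map (subtopology full_shift A) (subtopology full_shift B) f"
  shows "\<exists>m. \<forall>x\<in>A. \<forall>y\<in>A. agree m x y \<longrightarrow> agree k (f x) (f y)"
proof -
  have "\<exists>m. \<forall>x\<in>A. \<forall>y\<in>A. agree m x y \<longrightarrow> f x i = f y i" for i
  proof (rule continuous_map_discrete_window[OF A comp])
    have "continuous_map (subtopology full_shift A) (discrete_topology {0, 1}) (\<lambda>x. f x i)"
      using continuous_map_compose[OF continuous_map_into_fulltopology[OF f]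
          continuous_map_coordinate]
      by (simp add: o_def)
    from continuous_map_compose[OF this, of "discrete_topology UNIV" id]
    show "continuous_map (subtopology full_shift A) (discrete_topology UNIV) (\<lambda>x. f x i)"
      by (simp add: o_def)
  qed
  then obtain M where M: "\<And>i x y. x \<in> A \<Longrightarrow> y \<in> A \<Longrightarrow> agree (M i) x y \<Longrightarrow> f x i = f y i" by metis
  define m where "m = Max (insert 0 (M ` {-k..k}))"
  have "M i \<le> m" if "\<bar>i\<bar> \<le> k" for i
    using that unfolding m_def by (intro Max_ge) (auto simp: abs_le_iff)
  then have "\<forall>x\<in>A. \<forall>y\<in>A. agree m x y \<longrightarrow> agree k (f x) (f y)"
    using M agree_mono by (metis agree_def)
  then show ?thesis by blast
qed

section \<open>Sturmian points through shifts and counts of ones\<close>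

definition shift_by :: "int \<Rightarrow> (int \<Rightarrow> nat) \<Rightarrow> int \<Rightarrow> nat" where
  "shift_by j y = (\<lambda>i. y (i + j))"

lemma shift_by_0 [simp]: "shift_by 0 y = y"
  by (simp add: shift_by_def)

lemma shift_by_shift_by [simp]: "shift_by j (shift_by k y) = shift_by (j + k) y"
  by (simp add: shift_by_def add_ac)

lemma agree_shift_by: "agree (m + \<bar>j\<bar>) x y \<Longrightarrow> agree m (shift_by j x) (shift_by j y)"
  by (auto simp: agree_def shift_by_def)

abbreviation sturmian :: "real \<Rightarrow> (int \<Rightarrow> nat) set" where
  "sturmian \<alpha> \<equiv> topspace (sturmian_space \<alpha>)"

lemma sturmian_iff:
  "y \<in> sturmian \<alpha> \<longleftrightarrow> (\<forall>m. \<exists>k. agree m y (shift_by k (sturmian_point \<alpha>)))"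
proof -
  have orbit: "sturmian_orbit \<alpha> = range (\<lambda>k. shift_by k (sturmian_point \<alpha>))"
    by (simp add: sturmian_orbit_eq shift_by_def)
  then have "sturmian_orbit \<alpha> \<subseteq> topspace full_shift"
    unfolding topspace_full_shift by (auto simp: shift_by_def sturmian_point_def split: if_splits)
  then have eq: "sturmian \<alpha> =
      {y \<in> topspace full_shift. \<forall>m. \<exists>k. agree m y (shift_by k (sturmian_point \<alpha>))}"
    unfolding sturmian_space_def
    by (subst topspace_subtopology_subset) (auto simp: closure_of_full_shift orbit)
  have "y i \<in> {0, 1}" if y: "\<forall>m. \<exists>k. agree m y (shift_by k (sturmian_point \<alpha>))" for i
  proof -
    obtain k where "agree \<bar>i\<bar> y (shift_by k (sturmian_point \<alpha>))" using y by blast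
    then have "y i = shift_by k (sturmian_point \<alpha>) i" by (simp add: agree_def)
    then show ?thesis by (auto simp: shift_by_def sturmian_point_def)
  qed
  then show ?thesis unfolding eq by (auto simp: topspace_full_shift)
qed

lemma sturmian_subset: "sturmian \<alpha> \<subseteq> topspace full_shift"
  by (simp add: sturmian_space_def)

lemma sturmian_space_eq: "sturmian_space \<alpha> = subtopology full_shift (sturmian \<alpha>)"
  by (simp only: sturmian_space_def topspace_subtopology_subset[OF closure_of_subset_topspace])

lemma shift_by_sturmian: "y \<in> sturmian \<alpha> \<Longrightarrow> shift_by j y \<in> sturmian \<alpha>"
  unfolding sturmian_iff
proof
  fix m assume "\<forall>m. \<exists>k. agree m y (shift_by k (sturmian_point \<alpha>))"
  then obtain k where "agree (m + \<bar>j\<bar>) y (shift_by k (sturmian_point \<alpha>))" by blast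
  from agree_shift_by[OF this] show "\<exists>k. agree m (shift_by j y) (shift_by k (sturmian_point \<alpha>))"
    by auto
qed

lemma sturmian_point_mem: "sturmian_point \<alpha> \<in> sturmian \<alpha>"
  unfolding sturmian_iff by (metis agree_refl shift_by_0)

lemma sturmian_map_pow:
  assumes "y \<in> sturmian \<alpha>"
  shows "(sturmian_map \<alpha> ^^ n) y = shift_by (int n) y"
proof (induction n)
  case (Suc n)
  have "sturmian_map \<alpha> (shift_by (int n) y) = shift_by 1 (shift_by (int n) y)"
    using shift_by_sturmian[OF assms] by (simp add: sturmian_map_def shift_def[abs_def] shift_by_def)
  then show ?case using Suc by (simp only: funpow.simps o_apply shift_by_shift_by) simp
qed simp

lemma homeomorphic_map_funpow:
  "homeomorphic_map X X f \<Longrightarrow> homeomorphic_map X X (f ^^ n)"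
  by (induction n) (auto intro: homeomorphic_map_compose homeomorphic_map_id[THEN iffD2])

lemma homeomorphic_map_sturmian_map_pow:
  "homeomorphic_map (sturmian_space \<alpha>) (sturmian_space \<alpha>) (sturmian_map \<alpha> ^^ n)"
  using dynamical_system_sturmian by (auto simp: dynamical_system_def intro: homeomorphic_map_funpow)

lemma compact_space_sturmian: "compact_space (sturmian_space \<alpha>)"
  using dynamical_system_sturmian by (auto simp: dynamical_system_def)

lemma int_iterate_sturmian:
  assumes "y \<in> sturmian \<alpha>"
  shows "int_iterate (sturmian_space \<alpha>) (sturmian_map \<alpha> ^^ n) k y = shift_by (int n * k) y"
  using int_iterate_unique[OF homeomorphic_map_bij_betw[OF homeomorphic_map_sturmian_map_pow],
      of "\<lambda>k. shift_by (int n * k) y"] assms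
  by (simp add: shift_by_sturmian sturmian_map_pow algebra_simps)

text \<open>The digit is 1 exactly when adding \<open>frac \<alpha>\<close> to
  \<open>i * frac \<alpha>\<close> passes an integer. This turns the coding into the increments of a
  floor function.\<close>

lemma int_sturmian_point:
  "int (sturmian_point \<alpha> i) = \<lfloor>of_int (i + 1) * frac \<alpha>\<rfloor> - \<lfloor>of_int i * frac \<alpha>\<rfloor>"
proof -
  define v where "v = of_int i * frac \<alpha>"
  have "of_int i * \<alpha> = v + of_int (i * \<lfloor>\<alpha>\<rfloor>)" by (simp add: v_def frac_def algebra_simps)
  then have "frac (of_int i * \<alpha>) = frac v" by (simp only: frac_def floor_add_int) simp
  moreover have "\<lfloor>of_int (i + 1) * frac \<alpha>\<rfloor> = \<lfloor>v + frac \<alpha>\<rfloor>" by (simp add: v_def algebra_simps)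
  moreover have "\<lfloor>v + f\<rfloor> = \<lfloor>v\<rfloor> + (if frac v < 1 - f then 0 else 1)" if "0 \<le> f" "f < 1" for f
  proof (cases "v - of_int \<lfloor>v\<rfloor> < 1 - f")
    case True
    then have "\<lfloor>v + f\<rfloor> = \<lfloor>v\<rfloor>" using that by (intro floor_unique) linarith+
    with True show ?thesis by (simp add: frac_def)
  next
    case False
    then have "\<lfloor>v + f\<rfloor> = \<lfloor>v\<rfloor> + 1" using that by (intro floor_unique) linarith+
    with False show ?thesis by (simp add: frac_def)
  qed
  from this[OF frac_ge_0 frac_lt_1]
  have "\<lfloor>v + frac \<alpha>\<rfloor> = \<lfloor>v\<rfloor> + (if frac v < 1 - frac \<alpha> then 0 else 1)" .
  ultimately show ?thesis by (auto simp: sturmian_point_def v_def[symmetric])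
qed

definition word_count :: "(int \<Rightarrow> nat) \<Rightarrow> int \<Rightarrow> int" where
  "word_count y = ssum (\<lambda>i. int (y i))"

lemma word_count_succ: "word_count y (i + 1) = word_count y i + int (y i)"
  by (simp add: word_count_def ssum_succ)

lemma word_count_shift_by: "word_count (shift_by j y) i = word_count y (i + j) - word_count y j"
  unfolding word_count_def shift_by_def by (subst add.commute, subst ssum_add_shift) simp

lemma word_count_agree: "agree m y z \<Longrightarrow> \<bar>i\<bar> \<le> m \<Longrightarrow> word_count y i = word_count z i"
  unfolding word_count_def by (intro ssum_cong) (auto simp: agree_def)

lemma word_count_sturmian_point: "word_count (sturmian_point \<alpha>) i = \<lfloor>of_int i * frac \<alpha>\<rfloor>"
  unfolding word_count_def
  by (rule ssum_unique) (simp_all add: int_sturmian_point)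

lemma word_count_sturmian:
  assumes "y \<in> sturmian \<alpha>"
  shows "\<exists>k. \<forall>i. \<bar>i\<bar> \<le> m \<longrightarrow> word_count y i = \<lfloor>of_int (i + k) * frac \<alpha>\<rfloor> - \<lfloor>of_int k * frac \<alpha>\<rfloor>"
proof -
  obtain k where "agree m y (shift_by k (sturmian_point \<alpha>))" using assms sturmian_iff by blast
  then show ?thesis
    by (intro exI[of _ k]) (simp add: word_count_agree word_count_shift_by word_count_sturmian_point)
qed

section \<open>Integer-valued continuous functions and their means\<close>

text \<open>The group of functions on \<open>A\<close> generated by constants and coordinates. Being
  inductive, it lets means and defects be computed on generators; \<open>cong\<close> makes values
  off \<open>A\<close> irrelevant.\<close>

inductive coordinate_span :: "(int \<Rightarrow> nat) set \<Rightarrow> ((int \<Rightarrow> nat) \<Rightarrow> int) \<Rightarrow> bool" for A where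
  const: "coordinate_span A (\<lambda>y. c)"
| coordinate: "coordinate_span A (\<lambda>y. int (y j))"
| add: "coordinate_span A f \<Longrightarrow> coordinate_span A g \<Longrightarrow> coordinate_span A (\<lambda>y. f y + g y)"
| minus: "coordinate_span A f \<Longrightarrow> coordinate_span A (\<lambda>y. - f y)"
| cong: "coordinate_span A f \<Longrightarrow> (\<And>y. y \<in> A \<Longrightarrow> g y = f y) \<Longrightarrow> coordinate_span A g"

lemma coordinate_span_diff:
  "coordinate_span A f \<Longrightarrow> coordinate_span A g \<Longrightarrow> coordinate_span A (\<lambda>y. f y - g y)"
  using coordinate_span.add[OF _ coordinate_span.minus] by fastforce

lemma coordinate_span_scale:
  assumes f: "coordinate_span A f"
  shows "coordinate_span A (\<lambda>y. c * f y)"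
proof (induction c rule: int_induct[where k = 0])
  case base
  show ?case using coordinate_span.const[of A 0] by simp
next
  case (step1 c)
  show ?case using coordinate_span.add[OF step1(2) f] by (simp add: algebra_simps)
next
  case (step2 c)
  show ?case using coordinate_span_diff[OF step2(2) f] by (simp add: algebra_simps)
qed

text \<open>On the point of the circle with parameter \<open>t\<close>, \<open>arc \<alpha> i\<close> is the indicator
  function of \<open>t \<ge> 1 - frac (i \<alpha>)\<close>; these arcs are nested, so products of them are again arcs.\<close>

definition arc :: "real \<Rightarrow> int \<Rightarrow> (int \<Rightarrow> nat) \<Rightarrow> int" where
  "arc \<alpha> i y = word_count y i - \<lfloor>of_int i * frac \<alpha>\<rfloor>"

lemma floor_add_minus_floor:
  "\<lfloor>u + v\<rfloor> - \<lfloor>u\<rfloor> - \<lfloor>v\<rfloor> = (if 1 \<le> frac u + frac v then 1 else 0)"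
  using floor_add[of u v] by auto

lemma arc_mult:
  assumes y: "y \<in> sturmian \<alpha>"
    and le: "frac (of_int i * frac \<alpha>) \<le> frac (of_int j * frac \<alpha>)"
  shows "arc \<alpha> i y * arc \<alpha> j y = arc \<alpha> i y"
proof -
  obtain k where k: "\<And>l. \<bar>l\<bar> \<le> max \<bar>i\<bar> \<bar>j\<bar> \<Longrightarrow>
      word_count y l = \<lfloor>of_int (l + k) * frac \<alpha>\<rfloor> - \<lfloor>of_int k * frac \<alpha>\<rfloor>"
    using word_count_sturmian[OF y] by blast
  \<comment> \<open>On a finite window \<open>y\<close> is the shift by \<open>k\<close> of the
    Sturmian point, and the arc is the carry in adding the fractional parts of the
    \<open>k\<close>-th and \<open>l\<close>-th multiples.\<close>
  have arc: "arc \<alpha> l y = (if 1 \<le> frac (of_int k * frac \<alpha>) + frac (of_int l * frac \<alpha>) then 1 else 0)"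
    if "\<bar>l\<bar> \<le> max \<bar>i\<bar> \<bar>j\<bar>" for l
    using k[OF that] floor_add_minus_floor[of "of_int k * frac \<alpha>" "of_int l * frac \<alpha>"]
    unfolding arc_def by (simp only: of_int_add distrib_right add.commute[of "real_of_int l * _"])
  have "\<bar>i\<bar> \<le> max \<bar>i\<bar> \<bar>j\<bar>" "\<bar>j\<bar> \<le> max \<bar>i\<bar> \<bar>j\<bar>" by simp_all
  then show ?thesis using le by (simp add: arc)
qed

lemma coordinate_span_arc: "coordinate_span A (arc \<alpha> i)"
proof -
  have "coordinate_span A (\<lambda>y. word_count y i)"
  proof (induction i rule: int_induct[where k = 0])
    case base
    show ?case using coordinate_span.const[of A 0] by (simp add: word_count_def)
  next
    case (step1 i)
    show ?case using coordinate_span.add[OF step1(2) coordinate_span.coordinate[of A i]]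
      by (simp add: word_count_succ)
  next
    case (step2 i)
    show ?case using coordinate_span_diff[OF step2(2) coordinate_span.coordinate[of A "i - 1"]]
        word_count_succ[of _ "i - 1"] by simp
  qed
  from coordinate_span_diff[OF this coordinate_span.const] show ?thesis
    unfolding arc_def[abs_def] .
qed

lemma coordinate_eq_arc_diff:
  "int (y j) = arc \<alpha> (j + 1) y - arc \<alpha> j y + (\<lfloor>of_int (j + 1) * frac \<alpha>\<rfloor> - \<lfloor>of_int j * frac \<alpha>\<rfloor>)"
  by (simp add: arc_def word_count_succ)

text \<open>A coordinate is a difference of two arcs plus a constant, and products of arcs are arcs.
  Hence products of coordinates are again integral combinations of coordinates.\<close>

lemma coordinate_span_arc_mult:
  assumes "coordinate_span (sturmian \<alpha>) f"
  shows "coordinate_span (sturmian \<alpha>) (\<lambda>y. arc \<alpha> i y * f y)"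
  using assms
proof induction
  case (const c)
  show ?case using coordinate_span_scale[OF coordinate_span_arc, of _ c] by (simp add: mult.commute)
next
  case (coordinate j)
  have prod: "coordinate_span (sturmian \<alpha>) (\<lambda>y. arc \<alpha> i y * arc \<alpha> l y)" for l
  proof (cases "frac (of_int i * frac \<alpha>) \<le> frac (of_int l * frac \<alpha>)")
    case True
    show ?thesis by (rule coordinate_span.cong[OF coordinate_span_arc arc_mult[OF _ True]])
  next
    case False
    then have "arc \<alpha> i y * arc \<alpha> l y = arc \<alpha> l y" if "y \<in> sturmian \<alpha>" for y
      using arc_mult[OF that, of l i] by (simp add: mult.commute)
    then show ?thesis by (rule coordinate_span.cong[OF coordinate_span_arc])
  qed
  let ?c = "\<lfloor>of_int (j + 1) * frac \<alpha>\<rfloor> - \<lfloor>of_int j * frac \<alpha>\<rfloor>"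
  show ?case
    by (rule coordinate_span.cong[OF coordinate_span.add[OF coordinate_span_diff[OF prod[of "j + 1"] prod[of j]]
            coordinate_span_scale[OF coordinate_span_arc, of _ ?c \<alpha> i]]])
      (simp only: coordinate_eq_arc_diff[of _ j \<alpha>] algebra_simps)
next
  case (add f g)
  show ?case using coordinate_span.add[OF add.IH] by (simp add: distrib_left)
next
  case (minus f)
  show ?case using coordinate_span.minus[OF minus.IH] by simp
next
  case (cong f g)
  show ?case by (rule coordinate_span.cong[OF cong.IH]) (simp add: cong.hyps)
qed

lemma coordinate_span_coordinate_mult:
  assumes "coordinate_span (sturmian \<alpha>) f"
  shows "coordinate_span (sturmian \<alpha>) (\<lambda>y. int (y j) * f y)"
proof -
  let ?c = "\<lfloor>of_int (j + 1) * frac \<alpha>\<rfloor> - \<lfloor>of_int j * frac \<alpha>\<rfloor>"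
  show ?thesis
    by (rule coordinate_span.cong[OF coordinate_span.add[OF
            coordinate_span_diff[OF coordinate_span_arc_mult[OF assms, of "j + 1"] coordinate_span_arc_mult[OF assms, of j]]
            coordinate_span_scale[OF assms, of ?c]]])
      (simp only: coordinate_eq_arc_diff[of _ j \<alpha>] algebra_simps)
qed

lemma sturmian_01: "y \<in> sturmian \<alpha> \<Longrightarrow> y i = 0 \<or> y i = 1"
  using sturmian_subset by (auto simp: topspace_full_shift)

lemma coordinate_span_finite_window:
  assumes "finite I"
    and "\<And>y z. y \<in> sturmian \<alpha> \<Longrightarrow> z \<in> sturmian \<alpha> \<Longrightarrow> (\<forall>i\<in>I. y i = z i) \<Longrightarrow> f y = f z"
  shows "coordinate_span (sturmian \<alpha>) f"
  using assms
proof (induction I arbitrary: f)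
  case empty
  show ?case
    by (rule coordinate_span.cong[OF coordinate_span.const[of _ "f (sturmian_point \<alpha>)"]])
      (rule empty.prems; simp add: sturmian_point_mem)
next
  case (insert j I)
  define P where "P b y z \<longleftrightarrow> z \<in> sturmian \<alpha> \<and> (\<forall>i\<in>I. y i = z i) \<and> z j = b" for b :: nat and y z
  \<comment> \<open>\<open>g b y\<close> is the value of \<open>f\<close> when entry
    \<open>j\<close> is prescribed as \<open>b\<close>. Not every such word occurs in the system;
    the default 0 then has no effect, since \<open>y j\<close> selects the other value.\<close>
  define g where "g b y = (if Ex (P b y) then f (Eps (P b y)) else 0)" for b y
  have "coordinate_span (sturmian \<alpha>) (g b)" for b
  proof (rule insert.IH)
    fix y z :: "int \<Rightarrow> nat" assume "\<forall>i\<in>I. y i = z i"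
    then have "P b y = P b z" by (auto simp: P_def fun_eq_iff)
    then show "g b y = g b z" by (simp only: g_def)
  qed
  note span = this
  have f: "f y = g (y j) y" if y: "y \<in> sturmian \<alpha>" for y
  proof -
    have ex: "P (y j) y y" using y by (simp add: P_def)
    then have "P (y j) y (Eps (P (y j) y))" by (rule someI[of "P (y j) y"])
    then have "f y = f (Eps (P (y j) y))"
      by (intro insert.prems) (auto simp: P_def y)
    then show ?thesis using ex by (auto simp: g_def)
  qed
  have "f y = g 0 y + int (y j) * (g 1 y - g 0 y)" if "y \<in> sturmian \<alpha>" for y
    using f[OF that] sturmian_01[OF that, of j] by auto
  then show ?case
    by (rule coordinate_span.cong[OF coordinate_span.add[OF span
            coordinate_span_coordinate_mult[OF coordinate_span_diff[OF span span]]]])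
qed

lemma coordinate_span_window:
  assumes "\<And>y z. y \<in> sturmian \<alpha> \<Longrightarrow> z \<in> sturmian \<alpha> \<Longrightarrow> agree m y z \<Longrightarrow> f y = f z"
  shows "coordinate_span (sturmian \<alpha>) f"
proof (rule coordinate_span_finite_window[of "{-m..m}"])
  fix y z assume *: "y \<in> sturmian \<alpha>" "z \<in> sturmian \<alpha>" "\<forall>i\<in>{-m..m}. y i = z i"
  then have "agree m y z" by (auto simp: agree_def abs_le_iff)
  with * show "f y = f z" by (intro assms)
qed simp

section \<open>Birkhoff sums of powers of the shift and their uniform means\<close>

definition birkhoff :: "int \<Rightarrow> ((int \<Rightarrow> nat) \<Rightarrow> int) \<Rightarrow> (int \<Rightarrow> nat) \<Rightarrow> int \<Rightarrow> int" where
  "birkhoff n f y = ssum (\<lambda>i. f (shift_by (n * i) y))"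

text \<open>Uniform convergence of averages in both time directions, playing the role of an integral
  against an invariant measure. The additive error is convenient under sums and allows
  \<open>m\<close> to be replaced by a cocycle value.\<close>

definition has_mean :: "(int \<Rightarrow> nat) set \<Rightarrow> int \<Rightarrow> ((int \<Rightarrow> nat) \<Rightarrow> int) \<Rightarrow> real \<Rightarrow> bool" where
  "has_mean A n f \<mu> \<longleftrightarrow> (\<forall>\<epsilon>>0. \<exists>C. \<forall>y\<in>A. \<forall>m.
     \<bar>of_int (birkhoff n f y m) - \<mu> * of_int m\<bar> \<le> \<epsilon> * of_int \<bar>m\<bar> + C)"

lemma has_mean_const: "has_mean A n (\<lambda>y. c) (of_int c)"
  unfolding has_mean_def birkhoff_def ssum_const
  by (intro allI impI exI[of _ 0]) (simp add: mult.commute)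

lemma has_mean_add:
  assumes "has_mean A n f \<mu>" "has_mean A n g \<nu>"
  shows "has_mean A n (\<lambda>y. f y + g y) (\<mu> + \<nu>)"
  unfolding has_mean_def
proof (intro allI impI)
  fix \<epsilon> :: real assume "\<epsilon> > 0"
  then have "\<epsilon> / 2 > 0" by simp
  obtain C where C: "\<And>y m. y \<in> A \<Longrightarrow> \<bar>of_int (birkhoff n f y m) - \<mu> * of_int m\<bar> \<le> \<epsilon> / 2 * of_int \<bar>m\<bar> + C"
    using assms(1) \<open>\<epsilon> / 2 > 0\<close> unfolding has_mean_def by metis
  obtain D where D: "\<And>y m. y \<in> A \<Longrightarrow> \<bar>of_int (birkhoff n g y m) - \<nu> * of_int m\<bar> \<le> \<epsilon> / 2 * of_int \<bar>m\<bar> + D"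
    using assms(2) \<open>\<epsilon> / 2 > 0\<close> unfolding has_mean_def by metis
  have "\<bar>of_int (birkhoff n (\<lambda>y. f y + g y) y m) - (\<mu> + \<nu>) * of_int m\<bar> \<le> \<epsilon> * of_int \<bar>m\<bar> + (C + D)"
    if "y \<in> A" for y m
  proof -
    have "birkhoff n (\<lambda>y. f y + g y) y m = birkhoff n f y m + birkhoff n g y m"
      by (simp add: birkhoff_def ssum_add)
    then show ?thesis using C[OF that, of m] D[OF that, of m]
      unfolding distrib_right of_int_add by simp
  qed
  then show "\<exists>C. \<forall>y\<in>A. \<forall>m. \<bar>of_int (birkhoff n (\<lambda>y. f y + g y) y m) - (\<mu> + \<nu>) * of_int m\<bar> \<le> \<epsilon> * of_int \<bar>m\<bar> + C"
    by blast
qed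

lemma has_mean_minus:
  assumes "has_mean A n f \<mu>"
  shows "has_mean A n (\<lambda>y. - f y) (- \<mu>)"
proof -
  have "\<bar>of_int (birkhoff n (\<lambda>y. - f y) y m) - - \<mu> * of_int m\<bar> = \<bar>of_int (birkhoff n f y m) - \<mu> * of_int m\<bar>" for y m
    by (simp add: birkhoff_def ssum_minus abs_minus_commute)
  then show ?thesis using assms by (simp add: has_mean_def)
qed

lemma has_mean_cong:
  assumes "has_mean (sturmian \<alpha>) n f \<mu>" "\<And>y. y \<in> sturmian \<alpha> \<Longrightarrow> g y = f y"
  shows "has_mean (sturmian \<alpha>) n g \<mu>"
proof -
  have "birkhoff n g y = birkhoff n f y" if "y \<in> sturmian \<alpha>" for y
    using assms(2) shift_by_sturmian[OF that] by (simp add: birkhoff_def)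
  then show ?thesis using assms(1) by (simp add: has_mean_def)
qed

lemma has_mean_unique:
  assumes "has_mean A n f \<mu>" "has_mean A n f \<nu>" "A \<noteq> {}"
  shows "\<mu> = \<nu>"
proof (rule ccontr)
  assume "\<mu> \<noteq> \<nu>"
  define \<epsilon> where "\<epsilon> = \<bar>\<mu> - \<nu>\<bar> / 4"
  have \<epsilon>: "\<epsilon> > 0" using \<open>\<mu> \<noteq> \<nu>\<close> by (simp add: \<epsilon>_def)
  obtain y where y: "y \<in> A" using assms(3) by blast
  obtain C where C: "\<And>m. \<bar>of_int (birkhoff n f y m) - \<mu> * of_int m\<bar> \<le> \<epsilon> * of_int \<bar>m\<bar> + C"
    using assms(1) \<epsilon> y unfolding has_mean_def by metis
  obtain D where D: "\<And>m. \<bar>of_int (birkhoff n f y m) - \<nu> * of_int m\<bar> \<le> \<epsilon> * of_int \<bar>m\<bar> + D"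
    using assms(2) \<epsilon> y unfolding has_mean_def by metis
  have "2 * \<epsilon> * of_nat m \<le> C + D" for m
  proof -
    have "\<bar>\<mu> * of_nat m - \<nu> * of_nat m\<bar> \<le> 2 * \<epsilon> * of_nat m + C + D"
      using C[of "int m"] D[of "int m"] by simp
    moreover have "\<bar>\<mu> * of_nat m - \<nu> * of_nat m\<bar> = 4 * \<epsilon> * of_nat m"
      by (simp add: \<epsilon>_def left_diff_distrib[symmetric] abs_mult)
    ultimately show ?thesis by simp
  qed
  moreover obtain m :: nat where "of_nat m > (C + D) / (2 * \<epsilon>)" using reals_Archimedean2 by blast
  moreover from this have "C + D < 2 * \<epsilon> * of_nat m"
    using \<epsilon> pos_divide_less_eq[of "2 * \<epsilon>" "C + D" "of_nat m"] by (simp add: mult.commute)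
  ultimately show False by (metis leD)
qed

lemma irrational_frac: "\<alpha> \<notin> \<rat> \<Longrightarrow> frac \<alpha> \<notin> \<rat>"
proof
  assume "\<alpha> \<notin> \<rat>" "frac \<alpha> \<in> \<rat>"
  then have "frac \<alpha> + of_int \<lfloor>\<alpha>\<rfloor> \<in> \<rat>" by simp
  then show False using \<open>\<alpha> \<notin> \<rat>\<close> by (simp add: frac_def)
qed

text \<open>With step \<open>n\<close> the underlying rotation is by
  \<open>n * frac \<alpha>\<close>, still irrational, while the digit remains a floor difference
  with increment \<open>frac \<alpha>\<close>. The error is uniform in the starting point, hence in
  \<open>y\<close>.\<close>

lemma has_mean_coordinate:
  assumes \<alpha>: "\<alpha> \<notin> \<rat>" and n: "n \<noteq> 0"
  shows "has_mean (sturmian \<alpha>) n (\<lambda>y. int (y j)) (frac \<alpha>)"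
  unfolding has_mean_def
proof (intro allI impI)
  fix \<epsilon> :: real assume \<epsilon>: "\<epsilon> > 0"
  define \<theta> where "\<theta> = of_int n * frac \<alpha>"
  have \<theta>: "\<theta> \<notin> \<rat>"
  proof
    assume "\<theta> \<in> \<rat>"
    then have "\<theta> / of_int n \<in> \<rat>" by simp
    moreover have "\<theta> / of_int n = frac \<alpha>" using n by (simp add: \<theta>_def)
    ultimately show False using irrational_frac[OF \<alpha>] by (simp only:)
  qed
  obtain C where C: "\<forall>t m. \<bar>of_int (ssum (\<lambda>i. \<lfloor>t + of_int i * \<theta> + frac \<alpha>\<rfloor> - \<lfloor>t + of_int i * \<theta>\<rfloor>) m) - frac \<alpha> * of_int m\<bar>
    \<le> \<epsilon> * of_int \<bar>m\<bar> + C"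
    using ssum_floor_difference[OF \<theta> \<epsilon>] ..
  have "\<bar>of_int (birkhoff n (\<lambda>y. int (y j)) y m) - frac \<alpha> * of_int m\<bar> \<le> \<epsilon> * of_int \<bar>m\<bar> + C"
    if y: "y \<in> sturmian \<alpha>" for y m
  proof -
    obtain k where k: "agree (\<bar>j\<bar> + \<bar>n\<bar> * \<bar>m\<bar>) y (shift_by k (sturmian_point \<alpha>))"
      using y sturmian_iff by blast
    define t where "t = of_int (j + k) * frac \<alpha>"
    have "birkhoff n (\<lambda>y. int (y j)) y m = ssum (\<lambda>i. \<lfloor>t + of_int i * \<theta> + frac \<alpha>\<rfloor> - \<lfloor>t + of_int i * \<theta>\<rfloor>) m"
      unfolding birkhoff_def
    proof (rule ssum_cong)
      fix i :: int assume i: "\<bar>i\<bar> \<le> \<bar>m\<bar>"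
      have "\<bar>j + n * i\<bar> \<le> \<bar>j\<bar> + \<bar>n\<bar> * \<bar>i\<bar>" by (metis abs_mult abs_triangle_ineq)
      also have "\<dots> \<le> \<bar>j\<bar> + \<bar>n\<bar> * \<bar>m\<bar>" using i by (simp add: mult_left_mono)
      finally have "shift_by (n * i) y j = sturmian_point \<alpha> (j + n * i + k)"
        using k by (auto simp: agree_def shift_by_def)
      moreover have "of_int (j + n * i + k) * frac \<alpha> = t + of_int i * \<theta>"
        "of_int (j + n * i + k + 1) * frac \<alpha> = t + of_int i * \<theta> + frac \<alpha>"
        by (simp_all add: t_def \<theta>_def algebra_simps)
      ultimately show "int (shift_by (n * i) y j) = \<lfloor>t + of_int i * \<theta> + frac \<alpha>\<rfloor> - \<lfloor>t + of_int i * \<theta>\<rfloor>"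
        by (simp only: int_sturmian_point)
    qed
    from C[rule_format, of t m, folded this] show ?thesis .
  qed
  then show "\<exists>C. \<forall>y\<in>sturmian \<alpha>. \<forall>m. \<bar>of_int (birkhoff n (\<lambda>y. int (y j)) y m) - frac \<alpha> * of_int m\<bar> \<le> \<epsilon> * of_int \<bar>m\<bar> + C"
    by blast
qed

text \<open>The coding of the point \<open>0\<close> of the circle by left limits instead of right limits.\<close>

definition sturmian_twin :: "real \<Rightarrow> int \<Rightarrow> nat" where
  "sturmian_twin \<alpha> = (sturmian_point \<alpha>)(- 1 := 0, 0 := 1)"

lemma sturmian_twin_other: "i \<noteq> 0 \<Longrightarrow> i \<noteq> -1 \<Longrightarrow> sturmian_twin \<alpha> i = sturmian_point \<alpha> i"
  by (simp add: sturmian_twin_def)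

lemma frac_irrational_pos: "\<alpha> \<notin> \<rat> \<Longrightarrow> 0 < frac \<alpha>"
  using irrational_frac[of \<alpha>] frac_ge_0[of \<alpha>] by (cases "frac \<alpha> = 0") auto

lemma int_sturmian_twin:
  assumes "\<alpha> \<notin> \<rat>"
  shows "int (sturmian_twin \<alpha> i) = int (sturmian_point \<alpha> i) + (if i = 0 then 1 else 0) - (if i = -1 then 1 else 0)"
proof -
  have a: "0 < frac \<alpha>" "frac \<alpha> < 1" using frac_irrational_pos[OF assms] frac_lt_1 by auto
  have "\<lfloor>frac \<alpha>\<rfloor> = 0" "\<lfloor>- frac \<alpha>\<rfloor> = -1" using a by (auto simp: floor_eq_iff)
  then have "int (sturmian_point \<alpha> 0) = 0" "int (sturmian_point \<alpha> (-1)) = 1"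
    unfolding int_sturmian_point by simp_all
  then show ?thesis by (auto simp: sturmian_twin_def)
qed

lemma sturmian_twin_mem:
  assumes \<alpha>: "\<alpha> \<notin> \<rat>"
  shows "sturmian_twin \<alpha> \<in> sturmian \<alpha>"
  unfolding sturmian_iff
proof
  fix m :: int
  define a where "a = frac \<alpha>"
  have a: "a \<notin> \<rat>" using irrational_frac[OF \<alpha>] by (simp add: a_def)
  \<comment> \<open>The range reaches \<open>m + 1\<close> because digit \<open>i\<close> uses the
    floors at \<open>i\<close> and \<open>i + 1\<close>. A move to the left by less than all these
    fractional parts changes no floor except the one at 0.\<close>
  define D where "D = (\<lambda>i. frac (of_int i * a)) ` ({-m - 1..m + 1} - {0})"
  define \<epsilon> where "\<epsilon> = Min (insert 1 D)"
  have notint: "of_int i * a \<notin> \<int>" if "i \<noteq> 0" for i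
  proof
    assume "of_int i * a \<in> \<int>"
    then obtain p where "of_int i * a = of_int p" by (auto simp: Ints_def)
    then have "of_int (- p) + of_int i * a = 0" by simp
    from irrational_linear_eq_0(2)[OF a this] that show False by simp
  qed
  have "\<epsilon> > 0" unfolding \<epsilon>_def by (subst Min_gr_iff) (auto simp: D_def notint frac_gt_0_iff)
  have \<epsilon>: "\<epsilon> \<le> frac (of_int i * a)" if "i \<noteq> 0" "\<bar>i\<bar> \<le> m + 1" for i
    unfolding \<epsilon>_def by (intro Min_le) (use that in \<open>auto simp: D_def abs_le_iff\<close>)
  have "\<epsilon> \<le> 1" unfolding \<epsilon>_def by (intro Min_le) (auto simp: D_def)
  \<comment> \<open>Small multiples of \<open>- a\<close> give a \<open>k\<close> whose multiple of
    \<open>a\<close> lies just below an integer, so that 0 is approached from the left.\<close>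
  have "- a \<notin> \<rat>" using a by (metis Rats_minus_iff)
  from irrational_small_multiple[OF this \<open>\<epsilon> > 0\<close>] obtain q p \<delta>
    where \<delta>: "0 < \<delta>" "\<delta> < \<epsilon>" "of_nat q * (- a) = of_int p + \<delta>" by metis
  define k where "k = int q"
  have k: "of_int k * a = of_int (- p) - \<delta>" using \<delta>(3) by (simp add: k_def)
  have fl: "\<lfloor>of_int (i + k) * a\<rfloor> = \<lfloor>of_int i * a\<rfloor> - p - (if i = 0 then 1 else 0)" if "\<bar>i\<bar> \<le> m + 1" for i
  proof -
    have eq: "of_int (i + k) * a = (of_int i * a - \<delta>) + of_int (- p)" using k by (simp add: algebra_simps)
    have "\<lfloor>of_int i * a - \<delta>\<rfloor> = \<lfloor>of_int i * a\<rfloor> - (if i = 0 then 1 else 0)"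
    proof (cases "i = 0")
      case True
      then show ?thesis using \<delta> \<open>\<epsilon> \<le> 1\<close> by (simp add: floor_eq_iff)
    next
      case False
      then have "\<delta> < frac (of_int i * a)" using \<epsilon>[OF False that] \<delta> by linarith
      then have "\<lfloor>of_int i * a - \<delta>\<rfloor> = \<lfloor>of_int i * a\<rfloor>"
        using \<delta>(1) unfolding frac_def by (intro floor_unique) linarith+
      with False show ?thesis by simp
    qed
    then show ?thesis unfolding eq floor_add_int by simp
  qed
  have "sturmian_twin \<alpha> i = shift_by k (sturmian_point \<alpha>) i" if i: "\<bar>i\<bar> \<le> m" for i
  proof -
    have "int (shift_by k (sturmian_point \<alpha>) i) = \<lfloor>of_int ((i + 1) + k) * a\<rfloor> - \<lfloor>of_int (i + k) * a\<rfloor>"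
      unfolding shift_by_def int_sturmian_point a_def by (simp add: add_ac)
    also have "\<dots> = int (sturmian_twin \<alpha> i)"
      using i fl[of i] fl[of "i + 1"] unfolding int_sturmian_twin[OF \<alpha>] int_sturmian_point a_def[symmetric]
      by auto
    finally show ?thesis by simp
  qed
  then show "\<exists>k. agree m (sturmian_twin \<alpha>) (shift_by k (sturmian_point \<alpha>))"
    unfolding agree_def by blast
qed

text \<open>The integer-valued cocycles that come from continuous functions on the torus are those
  without defect along the asymptotic pair.\<close>

definition defect :: "real \<Rightarrow> int \<Rightarrow> ((int \<Rightarrow> nat) \<Rightarrow> int) \<Rightarrow> int \<Rightarrow> int \<Rightarrow> int" where
  "defect \<alpha> n f r K = (\<Sum>k\<in>{-K..<K}. f (shift_by (n * k + r) (sturmian_point \<alpha>)) -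
     f (shift_by (n * k + r) (sturmian_twin \<alpha>)))"

lemma sum_indicator_multiple:
  fixes n c K :: int
  assumes n: "n > 0" and K: "\<bar>c\<bar> < K"
  shows "(\<Sum>k\<in>{-K..<K}. if n * k + c = 0 then 1 else 0 :: int) = (if n dvd c then 1 else 0)"
proof (cases "n dvd c")
  case True
  then obtain d where d: "c = n * d" by blast
  have "\<bar>d\<bar> \<le> \<bar>c\<bar>" using n by (simp add: d abs_mult mult_le_cancel_right1)
  then have "- d \<in> {-K..<K}" using K by auto
  moreover have "n * k + c = 0 \<longleftrightarrow> k = - d" for k
    using n by (simp add: d distrib_left[symmetric] add_eq_0_iff2)
  ultimately show ?thesis using True by simp
next
  case False
  then have "n * k + c \<noteq> 0" for k by (metis add.commute add_eq_0_iff dvd_minus_iff dvd_triv_left)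
  with False show ?thesis by simp
qed

lemma coordinate_span_mean_defect:
  assumes \<alpha>: "\<alpha> \<notin> \<rat>" and n: "n > 0" and f: "coordinate_span (sturmian \<alpha>) f"
  shows "\<exists>p s. (\<forall>r. s (r + n) = s r) \<and>
     has_mean (sturmian \<alpha>) n f (of_int p + of_int (\<Sum>r\<in>{0..<n}. s r) * frac \<alpha>) \<and>
     (\<forall>r. \<forall>\<^sub>F K in at_top. defect \<alpha> n f r K = s (r + 1) - s r)"
  using f
proof induction
  case (const c)
  show ?case
    by (intro exI[of _ c] exI[of _ "\<lambda>_. 0"]) (simp add: has_mean_const defect_def)
next
  case (coordinate j)
  \<comment> \<open>The pair differs at -1 and 0 with opposite signs. Position
    \<open>n * k + r + j\<close> hits -1 for some \<open>k\<close> iff \<open>n\<close> divides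
    \<open>r + j + 1\<close>, and hits 0 iff \<open>n\<close> divides \<open>r + j\<close>, which
    gives the increment of \<open>s\<close>.\<close>
  define s where "s r = (if n dvd r + j then 1 else 0 :: int)" for r
  have per: "s (r + n) = s r" for r
    by (simp add: s_def add.assoc add.left_commute[of r n])
  have "(\<Sum>r\<in>{0..<n}. s r) = 1"
  proof -
    have "s r = (if r = (- j) mod n then 1 else 0)" if "r \<in> {0..<n}" for r
    proof -
      have "n dvd r + j \<longleftrightarrow> r mod n = (- j) mod n" by (simp add: mod_eq_dvd_iff)
      then show ?thesis using that by (simp add: s_def)
    qed
    then have "(\<Sum>r\<in>{0..<n}. s r) = (\<Sum>r\<in>{0..<n}. if r = (- j) mod n then 1 else 0)"
      by (intro sum.cong) auto
    then show ?thesis using n by simp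
  qed
  moreover have "\<forall>\<^sub>F K in at_top. defect \<alpha> n (\<lambda>y. int (y j)) r K = s (r + 1) - s r" for r
    using eventually_gt_at_top[of "\<bar>r + j\<bar> + 1"]
  proof eventually_elim
    case (elim K)
    have "defect \<alpha> n (\<lambda>y. int (y j)) r K =
        (\<Sum>k\<in>{-K..<K}. (if n * k + (r + j + 1) = 0 then 1 else 0) - (if n * k + (r + j) = 0 then 1 else 0))"
      unfolding defect_def shift_by_def int_sturmian_twin[OF \<alpha>]
      by (intro sum.cong refl) (auto simp: algebra_simps)
    also have "\<dots> = s (r + 1) - s r"
      using elim unfolding sum_subtractf
      by (subst (1 2) sum_indicator_multiple[OF n]) (auto simp: s_def algebra_simps)
    finally show ?case .
  qed
  ultimately show ?case
    using per has_mean_coordinate[OF \<alpha>, of n j] n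
    by (intro exI[of _ 0] exI[of _ s]) simp
next
  case (add f g)
  then obtain p s p' s' where
    f: "\<forall>r. s (r + n) = s r" "has_mean (sturmian \<alpha>) n f (of_int p + of_int (\<Sum>r\<in>{0..<n}. s r) * frac \<alpha>)"
      "\<And>r. \<forall>\<^sub>F K in at_top. defect \<alpha> n f r K = s (r + 1) - s r"
    and g: "\<forall>r. s' (r + n) = s' r" "has_mean (sturmian \<alpha>) n g (of_int p' + of_int (\<Sum>r\<in>{0..<n}. s' r) * frac \<alpha>)"
      "\<And>r. \<forall>\<^sub>F K in at_top. defect \<alpha> n g r K = s' (r + 1) - s' r"
    by blast
  have "\<forall>\<^sub>F K in at_top. defect \<alpha> n (\<lambda>y. f y + g y) r K = (s (r + 1) + s' (r + 1)) - (s r + s' r)" for r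
    using f(3)[of r] g(3)[of r]
  proof eventually_elim
    case (elim K)
    have "defect \<alpha> n (\<lambda>y. f y + g y) r K = defect \<alpha> n f r K + defect \<alpha> n g r K"
      unfolding defect_def sum.distrib[symmetric] by (simp add: algebra_simps)
    with elim show ?case by simp
  qed
  moreover have "has_mean (sturmian \<alpha>) n (\<lambda>y. f y + g y)
      (of_int (p + p') + of_int (\<Sum>r\<in>{0..<n}. s r + s' r) * frac \<alpha>)"
    using has_mean_add[OF f(2) g(2)] by (simp add: sum.distrib algebra_simps)
  ultimately show ?case
    using f(1) g(1) by (intro exI[of _ "p + p'"] exI[of _ "\<lambda>r. s r + s' r"]) simp
next
  case (minus f)
  then obtain p s where
    f: "\<forall>r. s (r + n) = s r" "has_mean (sturmian \<alpha>) n f (of_int p + of_int (\<Sum>r\<in>{0..<n}. s r) * frac \<alpha>)"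
      "\<And>r. \<forall>\<^sub>F K in at_top. defect \<alpha> n f r K = s (r + 1) - s r"
    by blast
  have "\<forall>\<^sub>F K in at_top. defect \<alpha> n (\<lambda>y. - f y) r K = - s (r + 1) - - s r" for r
    using f(3)[of r]
  proof eventually_elim
    case (elim K)
    have "defect \<alpha> n (\<lambda>y. - f y) r K = - defect \<alpha> n f r K"
      unfolding defect_def sum_negf[symmetric] by simp
    with elim show ?case by simp
  qed
  moreover have "has_mean (sturmian \<alpha>) n (\<lambda>y. - f y)
      (of_int (- p) + of_int (\<Sum>r\<in>{0..<n}. - s r) * frac \<alpha>)"
    using has_mean_minus[OF f(2)] by (simp add: sum_negf algebra_simps)
  ultimately show ?case
    using f(1) by (intro exI[of _ "- p"] exI[of _ "\<lambda>r. - s r"]) simp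
next
  case (cong f g)
  have "defect \<alpha> n g = defect \<alpha> n f"
    using cong.hyps(2) shift_by_sturmian sturmian_point_mem sturmian_twin_mem[OF \<alpha>]
    by (simp add: defect_def[abs_def])
  with cong has_mean_cong[of \<alpha> n f _ g] show ?case by metis
qed

lemma coordinate_span_mean:
  assumes "\<alpha> \<notin> \<rat>" "n > 0" "coordinate_span (sturmian \<alpha>) f"
  shows "\<exists>p q::int. has_mean (sturmian \<alpha>) n f (of_int p + of_int q * frac \<alpha>)"
  using coordinate_span_mean_defect[OF assms] by blast

text \<open>Without defect \<open>s\<close> is constant, so its sum over the \<open>n\<close>
  residues is \<open>n\<close> times one integer.\<close>

lemma coordinate_span_mean_no_defect:
  assumes "\<alpha> \<notin> \<rat>" and n: "n > 0" and "coordinate_span (sturmian \<alpha>) f"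
    and zero: "\<And>r. \<forall>\<^sub>F K in at_top. defect \<alpha> n f r K = 0"
  shows "\<exists>p q::int. has_mean (sturmian \<alpha>) n f (of_int p + of_int (n * q) * frac \<alpha>)"
proof -
  obtain p s where s: "has_mean (sturmian \<alpha>) n f (of_int p + of_int (\<Sum>r\<in>{0..<n}. s r) * frac \<alpha>)"
    "\<And>r. \<forall>\<^sub>F K in at_top. defect \<alpha> n f r K = s (r + 1) - s r"
    using coordinate_span_mean_defect[OF assms(1-3)] by blast
  have step: "s (r + 1) = s r" for r
  proof -
    have "\<forall>\<^sub>F K in (at_top :: int filter). s (r + 1) - s r = 0"
      using s(2)[of r] zero[of r] by eventually_elim simp
    then show ?thesis by simp
  qed
  have "s r = s 0" for r
  proof (induction r rule: int_induct[where k = 0])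
    case (step2 i)
    then show ?case using step[of "i - 1"] by simp
  qed (simp_all add: step)
  then have "(\<Sum>r\<in>{0..<n}. s r) = (\<Sum>r\<in>{0..<n}. s 0)" by (intro sum.cong) auto
  also have "\<dots> = n * s 0" using n by simp
  finally show ?thesis using s(1) by metis
qed

section \<open>Orbit cocycles between Sturmian systems\<close>

text \<open>The point of the circle coded by \<open>y\<close>, lifted to the unit interval. Both
  inequalities are weak, so codings by left and by right limits are covered.\<close>

definition phase :: "real \<Rightarrow> (int \<Rightarrow> nat) \<Rightarrow> real \<Rightarrow> bool" where
  "phase \<alpha> y t \<longleftrightarrow> (\<forall>i. of_int (word_count y i) \<le> t + of_int i * frac \<alpha> \<and>
     t + of_int i * frac \<alpha> \<le> of_int (word_count y i) + 1)"

text \<open>The differences between counts and multiples of \<open>frac \<alpha>\<close> vary by at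
  most 1, on all finite windows and hence globally; their supremum is a phase.\<close>

lemma phase_exists:
  assumes y: "y \<in> sturmian \<alpha>"
  shows "\<exists>t. phase \<alpha> y t"
proof -
  define v where "v i = of_int (word_count y i) - of_int i * frac \<alpha>" for i
  have le: "v i \<le> v j + 1" for i j
  proof -
    obtain k where k: "\<And>l. \<bar>l\<bar> \<le> max \<bar>i\<bar> \<bar>j\<bar> \<Longrightarrow>
      word_count y l = \<lfloor>of_int (l + k) * frac \<alpha>\<rfloor> - \<lfloor>of_int k * frac \<alpha>\<rfloor>"
      using word_count_sturmian[OF y] by blast
    have "word_count y i - word_count y j = \<lfloor>of_int (i + k) * frac \<alpha>\<rfloor> - \<lfloor>of_int (j + k) * frac \<alpha>\<rfloor>"
      using k[of i] k[of j] by simp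
    moreover have "of_int (\<lfloor>of_int (i + k) * frac \<alpha>\<rfloor> - \<lfloor>of_int (j + k) * frac \<alpha>\<rfloor>)
        \<le> of_int (i + k) * frac \<alpha> - of_int (j + k) * frac \<alpha> + 1"
      by linarith
    moreover have "of_int (i + k) * frac \<alpha> - of_int (j + k) * frac \<alpha> = of_int i * frac \<alpha> - of_int j * frac \<alpha>"
      by (simp add: algebra_simps)
    ultimately show ?thesis unfolding v_def by (smt (verit) of_int_diff)
  qed
  have bdd: "bdd_above (range v)" using le[of _ 0] by (intro bdd_aboveI[of _ "v 0 + 1"]) auto
  have "v i \<le> (SUP i. v i)" "(SUP i. v i) \<le> v i + 1" for i
    using le by (auto intro: cSUP_upper[OF _ bdd] cSUP_least)
  then have "phase \<alpha> y (SUP i. v i)"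
    unfolding phase_def v_def by (auto simp: algebra_simps)
  then show ?thesis ..
qed

lemma phase_shift_by:
  assumes "phase \<alpha> y t"
  shows "phase \<alpha> (shift_by j y) (t + of_int j * frac \<alpha> - of_int (word_count y j))"
  unfolding phase_def
proof
  fix i
  show "of_int (word_count (shift_by j y) i) \<le> t + of_int j * frac \<alpha> - of_int (word_count y j) + of_int i * frac \<alpha> \<and>
     t + of_int j * frac \<alpha> - of_int (word_count y j) + of_int i * frac \<alpha> \<le> of_int (word_count (shift_by j y) i) + 1"
    using assms[unfolded phase_def, rule_format, of "i + j"] unfolding word_count_shift_by
    by (simp add: algebra_simps)
qed

text \<open>If two phases differ by more than \<epsilon>, some rotation moves an integer between
  them, and the counts up to that time differ. The time needed is bounded independently of the
  points.\<close>

lemma phase_continuous: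
  assumes \<alpha>: "\<alpha> \<notin> \<rat>" and \<epsilon>: "\<epsilon> > 0"
  shows "\<exists>m. \<forall>y z t u. phase \<alpha> y t \<longrightarrow> phase \<alpha> z u \<longrightarrow> agree m y z \<longrightarrow> \<bar>t - u\<bar> \<le> \<epsilon>"
proof -
  obtain q p \<delta> where \<delta>: "0 < \<delta>" "\<delta> < \<epsilon>" "of_nat q * frac \<alpha> = of_int p + \<delta>"
    using irrational_small_multiple[OF irrational_frac[OF \<alpha>] \<epsilon>] by metis
  define m where "m = (\<lfloor>1 / \<delta>\<rfloor> + 1) * int q"
  have "u \<le> t + \<epsilon>" if t: "phase \<alpha> y t" and u: "phase \<alpha> z u" and yz: "agree m y z" for y z t u
  proof (rule ccontr)
    assume "\<not> u \<le> t + \<epsilon>"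
    have t01: "0 \<le> t" "t \<le> 1"
      using t[unfolded phase_def, rule_format, of 0] by (simp_all add: word_count_def)
    \<comment> \<open>The first multiple of \<delta> beyond \<open>t\<close>. It is still below
      \<open>u\<close>, so after \<open>- l * q\<close> steps the phase \<open>t\<close> has dropped
      below the integer \<open>- l * p\<close> and \<open>u\<close> has not. Since
      \<open>t \<le> 1\<close>, the window \<open>m\<close> contains that time.\<close>
    define l where "l = \<lfloor>t / \<delta>\<rfloor> + 1"
    have "t / \<delta> < of_int l" "of_int l \<le> t / \<delta> + 1" unfolding l_def by linarith+
    then have l: "t < of_int l * \<delta>" "of_int l * \<delta> \<le> t + \<delta>"
      using \<delta>(1) by (simp_all add: field_simps)
    have "t / \<delta> \<le> 1 / \<delta>" using t01 \<delta>(1) by (simp add: divide_right_mono)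
    then have l_le: "0 \<le> l" "l \<le> \<lfloor>1 / \<delta>\<rfloor> + 1"
      unfolding l_def using t01 \<delta>(1) by (auto simp: floor_mono)
    define i where "i = - l * int q"
    have "\<bar>i\<bar> \<le> m" unfolding i_def m_def using l_le by (simp add: abs_mult mult_right_mono)
    then have wc: "word_count y i = word_count z i" using word_count_agree[OF yz] by simp
    have "of_int i * frac \<alpha> = - of_int l * (of_nat q * frac \<alpha>)" by (simp add: i_def)
    also have "\<dots> = of_int (- l * p) - of_int l * \<delta>" unfolding \<delta>(3) by (simp add: algebra_simps)
    finally have i: "of_int i * frac \<alpha> = of_int (- l * p) - of_int l * \<delta>" .
    have "of_int (word_count y i) \<le> t + of_int i * frac \<alpha>" using t by (simp add: phase_def)
    also have "\<dots> < of_int (- l * p)" using l(1) i by simp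
    finally have "word_count y i + 1 \<le> - l * p" by linarith
    then have "real_of_int (word_count y i) + 1 \<le> of_int (- l * p)" by linarith
    moreover have "of_int (- l * p) < u + of_int i * frac \<alpha>"
      using \<open>\<not> u \<le> t + \<epsilon>\<close> l(2) \<delta>(2) i by linarith
    moreover have "u + of_int i * frac \<alpha> \<le> of_int (word_count z i) + 1" using u by (simp add: phase_def)
    ultimately show False using wc by simp
  qed
  then have "\<bar>t - u\<bar> \<le> \<epsilon>" if "phase \<alpha> y t" "phase \<alpha> z u" "agree m y z" for y z t u
    using that agree_sym[OF that(3)] by (smt (verit))
  then show ?thesis by blast
qed

lemma Ints_if_arbitrarily_close:
  fixes e :: real
  assumes "\<And>\<epsilon>. \<epsilon> > 0 \<Longrightarrow> \<exists>c::int. \<bar>e - of_int c\<bar> \<le> \<epsilon>"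
  shows "e \<in> \<int>"
proof (rule ccontr)
  assume "e \<notin> \<int>"
  then have pos: "0 < frac e" "frac e < 1" by (simp_all add: frac_gt_0_iff frac_lt_1)
  define \<epsilon> where "\<epsilon> = min (frac e) (1 - frac e) / 2"
  have \<epsilon>: "\<epsilon> > 0" "\<epsilon> < frac e" "\<epsilon> < 1 - frac e" using pos by (auto simp: \<epsilon>_def min_def)
  obtain c :: int where c: "\<bar>e - of_int c\<bar> \<le> \<epsilon>" using assms[OF \<epsilon>(1)] by blast
  show False
  proof (cases "c \<le> \<lfloor>e\<rfloor>")
    case True
    then have "real_of_int c \<le> of_int \<lfloor>e\<rfloor>" by simp
    then show False using c \<epsilon> unfolding frac_def by linarith
  next
    case False
    then have "real_of_int c \<ge> of_int \<lfloor>e\<rfloor> + 1" by linarith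
    then show False using c \<epsilon> unfolding frac_def by linarith
  qed
qed

lemma irrational_multiple_Ints:
  fixes x :: real
  assumes "x \<notin> \<rat>" "of_int k * x \<in> \<int>"
  shows "k = 0"
proof -
  obtain p where "of_int k * x = of_int p" using assms(2) by (auto simp: Ints_def)
  then have "of_int (- p) + of_int k * x = 0" by simp
  from irrational_linear_eq_0(2)[OF assms(1) this] show ?thesis .
qed

text \<open>A period \<open>d\<close> gives the same point two phases that differ by
  \<open>d * frac \<alpha>\<close> up to an integer; continuity of the phase makes this difference
  vanish.\<close>

lemma sturmian_aperiodic:
  assumes \<alpha>: "\<alpha> \<notin> \<rat>" and y: "y \<in> sturmian \<alpha>" and eq: "shift_by i y = shift_by j y"
  shows "i = j"
proof -
  define d where "d = i - j"
  have "shift_by (- j) (shift_by i y) = shift_by (- j) (shift_by j y)" by (simp only: eq)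
  then have d: "shift_by d y = y" by (simp add: d_def)
  obtain t where t: "phase \<alpha> y t" using phase_exists[OF y] by blast
  have t': "phase \<alpha> y (t + of_int d * frac \<alpha> - of_int (word_count y d))"
    using phase_shift_by[OF t, of d] unfolding d .
  have "of_int d * frac \<alpha> \<in> \<int>"
  proof (rule Ints_if_arbitrarily_close)
    fix \<epsilon> :: real assume "\<epsilon> > 0"
    then obtain m where "\<forall>y z t u. phase \<alpha> y t \<longrightarrow> phase \<alpha> z u \<longrightarrow> agree m y z \<longrightarrow> \<bar>t - u\<bar> \<le> \<epsilon>"
      using phase_continuous[OF \<alpha>] by blast
    from this[rule_format, OF t' t agree_refl]
    show "\<exists>c::int. \<bar>of_int d * frac \<alpha> - of_int c\<bar> \<le> \<epsilon>" by (intro exI[of _ "word_count y d"]) simp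
  qed
  from irrational_multiple_Ints[OF irrational_frac[OF \<alpha>] this] show ?thesis by (simp add: d_def)
qed

definition sturmian_cocycle ::
    "real \<Rightarrow> real \<Rightarrow> int \<Rightarrow> ((int \<Rightarrow> nat) \<Rightarrow> int \<Rightarrow> nat) \<Rightarrow> ((int \<Rightarrow> nat) \<Rightarrow> int) \<Rightarrow> bool" where
  "sturmian_cocycle \<alpha> \<beta> n \<phi> N \<longleftrightarrow>
     (\<forall>x\<in>sturmian \<alpha>. \<phi> x \<in> sturmian \<beta> \<and> \<phi> (shift_by n x) = shift_by (n * N x) (\<phi> x)) \<and>
     (\<forall>k. \<exists>m. \<forall>x\<in>sturmian \<alpha>. \<forall>y\<in>sturmian \<alpha>. agree m x y \<longrightarrow> agree k (\<phi> x) (\<phi> y)) \<and>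
     (\<exists>m. \<forall>x\<in>sturmian \<alpha>. \<forall>y\<in>sturmian \<alpha>. agree m x y \<longrightarrow> N x = N y)"

lemma sturmian_cocycle_mem:
  "sturmian_cocycle \<alpha> \<beta> n \<phi> N \<Longrightarrow> x \<in> sturmian \<alpha> \<Longrightarrow> \<phi> x \<in> sturmian \<beta>"
  by (simp add: sturmian_cocycle_def)

lemma sturmian_cocycle_shift:
  "sturmian_cocycle \<alpha> \<beta> n \<phi> N \<Longrightarrow> x \<in> sturmian \<alpha> \<Longrightarrow> \<phi> (shift_by n x) = shift_by (n * N x) (\<phi> x)"
  by (simp add: sturmian_cocycle_def)

lemma sturmian_cocycle_window:
  "sturmian_cocycle \<alpha> \<beta> n \<phi> N \<Longrightarrow>
    \<exists>m. \<forall>x\<in>sturmian \<alpha>. \<forall>y\<in>sturmian \<alpha>. agree m x y \<longrightarrow> agree k (\<phi> x) (\<phi> y)"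
  by (simp add: sturmian_cocycle_def)

lemma sturmian_cocycle_time_window:
  "sturmian_cocycle \<alpha> \<beta> n \<phi> N \<Longrightarrow>
    \<exists>m. \<forall>x\<in>sturmian \<alpha>. \<forall>y\<in>sturmian \<alpha>. agree m x y \<longrightarrow> N x = N y"
  by (simp add: sturmian_cocycle_def)

lemma sturmian_continuous_window:
  assumes "continuous_map (sturmian_space \<alpha>) (discrete_topology UNIV) f"
  shows "\<exists>m. \<forall>x\<in>sturmian \<alpha>. \<forall>y\<in>sturmian \<alpha>. agree m x y \<longrightarrow> f x = f y"
  using continuous_map_discrete_window[OF sturmian_subset, of \<alpha> f] compact_space_sturmian[of \<alpha>] assms
  by (simp only: sturmian_space_eq[symmetric])

text \<open>Lets the window depend on the point, as it does for a sum whose length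
  \<open>N x\<close> varies.\<close>

lemma sturmian_local_window:
  assumes "\<And>x. x \<in> sturmian \<alpha> \<Longrightarrow> \<exists>m. \<forall>y\<in>sturmian \<alpha>. agree m x y \<longrightarrow> f x = f y"
  shows "\<exists>m. \<forall>x\<in>sturmian \<alpha>. \<forall>y\<in>sturmian \<alpha>. agree m x y \<longrightarrow> f x = f y"
proof (rule sturmian_continuous_window, rule continuous_map_discrete_UNIV)
  fix x assume x: "x \<in> sturmian \<alpha>"
  obtain m where m: "\<forall>y\<in>sturmian \<alpha>. agree m x y \<longrightarrow> f x = f y" using assms[OF x] ..
  define U where "U = {z \<in> topspace full_shift. agree m x z} \<inter> sturmian \<alpha>"
  have "openin (sturmian_space \<alpha>) U"
    by (subst sturmian_space_eq) (auto simp only: U_def openin_subtopology intro: openin_agree)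
  moreover have "x \<in> U" using x sturmian_subset by (auto simp: U_def)
  moreover have "\<forall>y\<in>U. f y = f x" using m unfolding U_def by fastforce
  ultimately show "\<exists>U. openin (sturmian_space \<alpha>) U \<and> x \<in> U \<and> (\<forall>y\<in>U. f y = f x)" by blast
qed

lemma orbit_cocycle_imp_sturmian_cocycle:
  assumes "orbit_cocycle (sturmian_space \<alpha>) (sturmian_map \<alpha> ^^ n) (sturmian_space \<beta>) (sturmian_map \<beta> ^^ n) \<phi> N"
  shows "sturmian_cocycle \<alpha> \<beta> (int n) \<phi> N"
proof -
  have c: "continuous_map (sturmian_space \<alpha>) (sturmian_space \<beta>) \<phi>"
    "continuous_map (sturmian_space \<alpha>) (discrete_topology UNIV) N"
    and eq: "\<And>x. x \<in> sturmian \<alpha> \<Longrightarrow> \<phi> ((sturmian_map \<alpha> ^^ n) x) =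
      int_iterate (sturmian_space \<beta>) (sturmian_map \<beta> ^^ n) (N x) (\<phi> x)"
    using assms by (auto simp: orbit_cocycle_def)
  have \<phi>: "\<phi> x \<in> sturmian \<beta>" if "x \<in> sturmian \<alpha>" for x
    using c(1) that by (auto simp: continuous_map_def)
  have "\<phi> (shift_by (int n) x) = shift_by (int n * N x) (\<phi> x)" if x: "x \<in> sturmian \<alpha>" for x
    using eq[OF x] unfolding sturmian_map_pow[OF x] int_iterate_sturmian[OF \<phi>[OF x]] .
  moreover have "\<exists>m. \<forall>x\<in>sturmian \<alpha>. \<forall>y\<in>sturmian \<alpha>. agree m x y \<longrightarrow> agree k (\<phi> x) (\<phi> y)" for k
    using continuous_map_full_shift_window[OF sturmian_subset, of \<alpha> "sturmian \<beta>" \<phi> k]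
      compact_space_sturmian[of \<alpha>] c(1)
    by (simp only: sturmian_space_eq[symmetric])
  ultimately show ?thesis
    unfolding sturmian_cocycle_def using \<phi> sturmian_continuous_window[OF c(2)] by blast
qed

section \<open>Pulling back functions and means along a cocycle\<close>

lemma birkhoff_0 [simp]: "birkhoff n f y 0 = 0"
  by (simp add: birkhoff_def)

lemma birkhoff_succ: "birkhoff n f y (k + 1) = birkhoff n f y k + f (shift_by (n * k) y)"
  by (simp add: birkhoff_def ssum_succ)

lemma birkhoff_add: "birkhoff n f y (m + k) = birkhoff n f y m + birkhoff n f (shift_by (n * m) y) k"
  unfolding birkhoff_def ssum_add_shift[of _ m k] by (simp add: distrib_left)

lemma sturmian_cocycle_iterate:
  assumes c: "sturmian_cocycle \<alpha> \<beta> n \<phi> N" and x: "x \<in> sturmian \<alpha>"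
  shows "\<phi> (shift_by (n * k) x) = shift_by (n * birkhoff n N x k) (\<phi> x)"
proof (induction k rule: int_induct[where k = 0])
  case base
  show ?case by simp
next
  case (step1 k)
  have "\<phi> (shift_by n (shift_by (n * k) x)) = shift_by (n * N (shift_by (n * k) x)) (\<phi> (shift_by (n * k) x))"
    by (rule sturmian_cocycle_shift[OF c shift_by_sturmian[OF x]])
  also have "\<dots> = shift_by (n * birkhoff n N x (k + 1)) (\<phi> x)"
    unfolding step1(2) birkhoff_succ by (simp add: distrib_left add.commute)
  finally show ?case by (simp add: distrib_left add.commute)
next
  case (step2 k)
  define z where "z = shift_by (n * (k - 1)) x"
  have z: "shift_by n z = shift_by (n * k) x" by (simp add: z_def right_diff_distrib)
  have b: "birkhoff n N x k = birkhoff n N x (k - 1) + N z"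
    using birkhoff_succ[of n N x "k - 1"] by (simp add: z_def)
  have "shift_by (n * N z) (\<phi> z) = \<phi> (shift_by n z)"
    unfolding z_def by (rule sturmian_cocycle_shift[OF c shift_by_sturmian[OF x], symmetric])
  also have "\<dots> = shift_by (n * birkhoff n N x k) (\<phi> x)" unfolding z by (rule step2)
  finally have "shift_by (- (n * N z)) (shift_by (n * N z) (\<phi> z)) =
      shift_by (- (n * N z)) (shift_by (n * birkhoff n N x k) (\<phi> x))" by simp
  then show ?case unfolding z_def[symmetric] by (simp add: b distrib_left)
qed

text \<open>The sum of \<open>f\<close> over the orbit segment from \<open>\<phi> x\<close> to the
  image of the next point, so that sums of the pull back concatenate to sums of
  \<open>f\<close>.\<close>

definition pull_back ::
    "int \<Rightarrow> ((int \<Rightarrow> nat) \<Rightarrow> int \<Rightarrow> nat) \<Rightarrow> ((int \<Rightarrow> nat) \<Rightarrow> int) \<Rightarrow> ((int \<Rightarrow> nat) \<Rightarrow> int) \<Rightarrow> (int \<Rightarrow> nat) \<Rightarrow> int" where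
  "pull_back n \<phi> N f x = birkhoff n f (\<phi> x) (N x)"

lemma birkhoff_pull_back:
  assumes c: "sturmian_cocycle \<alpha> \<beta> n \<phi> N" and x: "x \<in> sturmian \<alpha>"
  shows "birkhoff n (pull_back n \<phi> N f) x k = birkhoff n f (\<phi> x) (birkhoff n N x k)"
  unfolding birkhoff_def[of n "pull_back n \<phi> N f"]
proof (rule ssum_unique)
  fix m
  show "birkhoff n f (\<phi> x) (birkhoff n N x (m + 1)) =
      birkhoff n f (\<phi> x) (birkhoff n N x m) + pull_back n \<phi> N f (shift_by (n * m) x)"
    by (subst birkhoff_succ) (simp only: birkhoff_add[of n f] pull_back_def sturmian_cocycle_iterate[OF c x])
qed simp

lemma coordinate_span_sturmian_cocycle:
  assumes "sturmian_cocycle \<alpha> \<beta> n \<phi> N"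
  shows "coordinate_span (sturmian \<alpha>) N"
proof -
  obtain m where m: "\<forall>x\<in>sturmian \<alpha>. \<forall>y\<in>sturmian \<alpha>. agree m x y \<longrightarrow> N x = N y"
    using sturmian_cocycle_time_window[OF assms] ..
  show ?thesis by (rule coordinate_span_window[OF m[rule_format]])
qed

lemma coordinate_span_pull_back:
  assumes c: "sturmian_cocycle \<alpha> \<beta> n \<phi> N"
  shows "coordinate_span (sturmian \<alpha>) (pull_back n \<phi> N (\<lambda>y. int (y 0)))"
proof -
  obtain m where "\<forall>x\<in>sturmian \<alpha>. \<forall>y\<in>sturmian \<alpha>. agree m x y \<longrightarrow> N x = N y"
    using sturmian_cocycle_time_window[OF c] ..
  note m = this[rule_format]
  have "\<exists>m. \<forall>x\<in>sturmian \<alpha>. \<forall>y\<in>sturmian \<alpha>. agree m x y \<longrightarrow>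
      pull_back n \<phi> N (\<lambda>y. int (y 0)) x = pull_back n \<phi> N (\<lambda>y. int (y 0)) y"
  proof (rule sturmian_local_window)
    fix x assume x: "x \<in> sturmian \<alpha>"
    obtain m' where "\<forall>x'\<in>sturmian \<alpha>. \<forall>y\<in>sturmian \<alpha>. agree m' x' y \<longrightarrow> agree (\<bar>n\<bar> * \<bar>N x\<bar>) (\<phi> x') (\<phi> y)"
      using sturmian_cocycle_window[OF c] ..
    note m' = this[rule_format]
    have "pull_back n \<phi> N (\<lambda>y. int (y 0)) x = pull_back n \<phi> N (\<lambda>y. int (y 0)) y"
      if y: "y \<in> sturmian \<alpha>" and "agree (max m m') x y" for y
    proof -
      have N: "N y = N x" using m[OF x y] agree_mono[OF that(2), of m] by simp
      have ag: "agree (\<bar>n\<bar> * \<bar>N x\<bar>) (\<phi> x) (\<phi> y)" using m'[OF x y] agree_mono[OF that(2), of m'] by simp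
      show ?thesis
        unfolding pull_back_def N birkhoff_def
      proof (rule ssum_cong)
        fix i assume "\<bar>i\<bar> \<le> \<bar>N x\<bar>"
        then have "\<bar>n * i\<bar> \<le> \<bar>n\<bar> * \<bar>N x\<bar>" by (simp add: abs_mult mult_left_mono)
        then show "int (shift_by (n * i) (\<phi> x) 0) = int (shift_by (n * i) (\<phi> y) 0)"
          using ag by (simp add: agree_def shift_by_def)
      qed
    qed
    then show "\<exists>m. \<forall>y\<in>sturmian \<alpha>. agree m x y \<longrightarrow>
        pull_back n \<phi> N (\<lambda>y. int (y 0)) x = pull_back n \<phi> N (\<lambda>y. int (y 0)) y" by blast
  qed
  then obtain k where "\<forall>x\<in>sturmian \<alpha>. \<forall>y\<in>sturmian \<alpha>. agree k x y \<longrightarrow>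
      pull_back n \<phi> N (\<lambda>y. int (y 0)) x = pull_back n \<phi> N (\<lambda>y. int (y 0)) y" ..
  from coordinate_span_window[OF this[rule_format]] show ?thesis .
qed

text \<open>After \<open>m\<close> steps the image has run for a time close to
  \<open>\<nu> * m\<close>, over which \<open>f\<close> sums to about \<mu> times that time.\<close>

lemma has_mean_pull_back:
  assumes c: "sturmian_cocycle \<alpha> \<beta> n \<phi> N"
    and N: "has_mean (sturmian \<alpha>) n N \<nu>" and f: "has_mean (sturmian \<beta>) n f \<mu>"
  shows "has_mean (sturmian \<alpha>) n (pull_back n \<phi> N f) (\<mu> * \<nu>)"
  unfolding has_mean_def
proof (intro allI impI)
  fix \<epsilon> :: real assume \<epsilon>: "\<epsilon> > 0"
  \<comment> \<open>Each error is to be at most half of \<epsilon>: \<open>\<epsilon>1\<close> is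
    multiplied by the running time, \<open>\<epsilon>2\<close> by \<open>\<bar>\<mu>\<bar>\<close>.
    The cap \<open>\<epsilon>2 \<le> 1\<close> bounds the running time by
    \<open>(\<bar>\<nu>\<bar> + 1) * \<bar>m\<bar> + D\<close>, and the added 1 avoids division by
    0.\<close>
  define \<epsilon>1 \<epsilon>2 where "\<epsilon>1 = \<epsilon> / (2 * (\<bar>\<nu>\<bar> + 1))" and "\<epsilon>2 = min 1 (\<epsilon> / (2 * (\<bar>\<mu>\<bar> + 1)))"
  have pos: "\<epsilon>1 > 0" "\<epsilon>2 > 0" "\<epsilon>2 \<le> 1" using \<epsilon> by (auto simp: \<epsilon>1_def \<epsilon>2_def intro!: divide_pos_pos add_nonneg_pos)
  obtain C where C: "\<And>y m. y \<in> sturmian \<beta> \<Longrightarrow> \<bar>of_int (birkhoff n f y m) - \<mu> * of_int m\<bar> \<le> \<epsilon>1 * of_int \<bar>m\<bar> + C"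
    using f pos(1) unfolding has_mean_def by metis
  obtain D where D: "\<And>x m. x \<in> sturmian \<alpha> \<Longrightarrow> \<bar>of_int (birkhoff n N x m) - \<nu> * of_int m\<bar> \<le> \<epsilon>2 * of_int \<bar>m\<bar> + D"
    using N pos(2) unfolding has_mean_def by metis
  have "\<bar>of_int (birkhoff n (pull_back n \<phi> N f) x m) - \<mu> * \<nu> * of_int m\<bar>
      \<le> \<epsilon> * of_int \<bar>m\<bar> + (\<epsilon>1 * D + C + \<bar>\<mu>\<bar> * D)" if x: "x \<in> sturmian \<alpha>" for x m
  proof -
    define b where "b = birkhoff n N x m"
    have "\<phi> x \<in> sturmian \<beta>" by (rule sturmian_cocycle_mem[OF c x])
    from C[OF this, of b] have 1: "\<bar>of_int (birkhoff n (pull_back n \<phi> N f) x m) - \<mu> * of_int b\<bar> \<le> \<epsilon>1 * of_int \<bar>b\<bar> + C"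
      by (simp only: birkhoff_pull_back[OF c x] b_def)
    have 2: "\<bar>of_int b - \<nu> * of_int m\<bar> \<le> \<epsilon>2 * of_int \<bar>m\<bar> + D" using D[OF x] by (simp only: b_def)
    have "\<epsilon>2 * of_int \<bar>m\<bar> \<le> 1 * of_int \<bar>m\<bar>" by (rule mult_right_mono) (use pos in auto)
    moreover have "\<bar>\<nu> * of_int m\<bar> = \<bar>\<nu>\<bar> * of_int \<bar>m\<bar>" by (simp add: abs_mult)
    ultimately have "of_int \<bar>b\<bar> \<le> (\<bar>\<nu>\<bar> + 1) * of_int \<bar>m\<bar> + D" using 2 unfolding distrib_right of_int_abs by linarith
    then have "\<epsilon>1 * of_int \<bar>b\<bar> \<le> \<epsilon>1 * ((\<bar>\<nu>\<bar> + 1) * of_int \<bar>m\<bar> + D)" using pos by (intro mult_left_mono) auto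
    also have "\<dots> = (\<epsilon>1 * (\<bar>\<nu>\<bar> + 1)) * of_int \<bar>m\<bar> + \<epsilon>1 * D" by (simp add: algebra_simps)
    also have "\<epsilon>1 * (\<bar>\<nu>\<bar> + 1) = \<epsilon> / 2" unfolding \<epsilon>1_def by (simp add: field_simps)
    finally have 3: "\<epsilon>1 * of_int \<bar>b\<bar> \<le> \<epsilon> / 2 * of_int \<bar>m\<bar> + \<epsilon>1 * D" .
    have "\<bar>\<mu> * of_int b - \<mu> * \<nu> * of_int m\<bar> = \<bar>\<mu>\<bar> * \<bar>of_int b - \<nu> * of_int m\<bar>"
      unfolding abs_mult[symmetric] by (simp add: algebra_simps)
    also have "\<dots> \<le> \<bar>\<mu>\<bar> * (\<epsilon>2 * of_int \<bar>m\<bar> + D)" using 2 by (intro mult_left_mono) auto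
    also have "\<dots> = (\<bar>\<mu>\<bar> * \<epsilon>2) * of_int \<bar>m\<bar> + \<bar>\<mu>\<bar> * D" by (simp add: algebra_simps)
    also have "\<bar>\<mu>\<bar> * \<epsilon>2 \<le> \<epsilon> / 2"
    proof -
      have "\<bar>\<mu>\<bar> * \<epsilon>2 \<le> (\<bar>\<mu>\<bar> + 1) * (\<epsilon> / (2 * (\<bar>\<mu>\<bar> + 1)))"
        using pos by (intro mult_mono) (auto simp: \<epsilon>2_def)
      also have "\<dots> = \<epsilon> / 2" by (simp add: field_simps)
      finally show ?thesis .
    qed
    then have "(\<bar>\<mu>\<bar> * \<epsilon>2) * of_int \<bar>m\<bar> + \<bar>\<mu>\<bar> * D \<le> \<epsilon> / 2 * of_int \<bar>m\<bar> + \<bar>\<mu>\<bar> * D"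
      by (intro add_right_mono mult_right_mono) auto
    finally have 4: "\<bar>\<mu> * of_int b - \<mu> * \<nu> * of_int m\<bar> \<le> \<epsilon> / 2 * of_int \<bar>m\<bar> + \<bar>\<mu>\<bar> * D" .
    show ?thesis using 1 3 4 by linarith
  qed
  then show "\<exists>C. \<forall>x\<in>sturmian \<alpha>. \<forall>m. \<bar>of_int (birkhoff n (pull_back n \<phi> N f) x m) - \<mu> * \<nu> * of_int m\<bar>
      \<le> \<epsilon> * of_int \<bar>m\<bar> + C" by blast
qed

text \<open>Going over by \<phi> and back by \<psi> reproduces \<open>k\<close> steps up to
  \<open>j x - j z\<close>, by aperiodicity. This is bounded, so the pulled back function has mean
  1, while its mean is also the product of the two means.\<close>

lemma sturmian_cocycle_means_inverse:
  assumes \<alpha>: "\<alpha> \<notin> \<rat>" and n: "n > 0"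
    and \<phi>: "sturmian_cocycle \<alpha> \<beta> n \<phi> N" and \<psi>: "sturmian_cocycle \<beta> \<alpha> n \<psi> M"
    and j: "\<And>x. x \<in> sturmian \<alpha> \<Longrightarrow> x = shift_by (n * j x) (\<psi> (\<phi> x))" "\<And>x. x \<in> sturmian \<alpha> \<Longrightarrow> \<bar>j x\<bar> \<le> B"
    and N: "has_mean (sturmian \<alpha>) n N \<nu>" and M: "has_mean (sturmian \<beta>) n M \<mu>"
  shows "\<mu> * \<nu> = 1"
proof -
  have "has_mean (sturmian \<alpha>) n (pull_back n \<phi> N M) 1"
    unfolding has_mean_def
  proof (intro allI impI)
    fix \<epsilon> :: real assume \<epsilon>: "\<epsilon> > 0"
    have "\<bar>of_int (birkhoff n (pull_back n \<phi> N M) x k) - 1 * of_int k\<bar> \<le> \<epsilon> * of_int \<bar>k\<bar> + of_int (2 * B)"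
      if x: "x \<in> sturmian \<alpha>" for x k
    proof -
      define b where "b = birkhoff n M (\<phi> x) (birkhoff n N x k)"
      define z where "z = shift_by (n * k) x"
      have z: "z \<in> sturmian \<alpha>" using x by (simp add: z_def shift_by_sturmian)
      have \<phi>x: "\<phi> x \<in> sturmian \<beta>" by (rule sturmian_cocycle_mem[OF \<phi> x])
      have \<psi>x: "\<psi> (\<phi> x) \<in> sturmian \<alpha>" by (rule sturmian_cocycle_mem[OF \<psi> \<phi>x])
      have "\<psi> (\<phi> z) = shift_by (n * b) (\<psi> (\<phi> x))"
        unfolding z_def b_def sturmian_cocycle_iterate[OF \<phi> x] sturmian_cocycle_iterate[OF \<psi> \<phi>x] ..
      then have "z = shift_by (n * j z) (shift_by (n * b) (\<psi> (\<phi> x)))" using j(1)[OF z] by simp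
      moreover have "z = shift_by (n * k) (shift_by (n * j x) (\<psi> (\<phi> x)))"
        using j(1)[OF x] by (simp add: z_def)
      ultimately have "shift_by (n * j z + n * b) (\<psi> (\<phi> x)) = shift_by (n * k + n * j x) (\<psi> (\<phi> x))"
        by simp
      from sturmian_aperiodic[OF \<alpha> \<psi>x this] have "n * (j z + b) = n * (k + j x)" by (simp add: distrib_left)
      then have "b - k = j x - j z" using n by simp
      then have "\<bar>b - k\<bar> \<le> 2 * B" using j(2)[OF x] j(2)[OF z] by linarith
      then have "\<bar>real_of_int b - of_int k\<bar> \<le> of_int (2 * B)" by linarith
      moreover have "0 \<le> \<epsilon> * of_int \<bar>k\<bar>" using \<epsilon> by simp
      ultimately show ?thesis unfolding birkhoff_pull_back[OF \<phi> x] b_def[symmetric] by linarith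
    qed
    then show "\<exists>C. \<forall>x\<in>sturmian \<alpha>. \<forall>m. \<bar>of_int (birkhoff n (pull_back n \<phi> N M) x m) - 1 * of_int m\<bar> \<le> \<epsilon> * of_int \<bar>m\<bar> + C"
      by blast
  qed
  from has_mean_unique[OF has_mean_pull_back[OF \<phi> N M] this] show ?thesis
    using sturmian_point_mem by blast
qed

text \<open>Since the rotation factor does not see the difference between the two points of an
  asymptotic pair, a cocycle of a continuous orbit map cannot accumulate a defect along it.\<close>

lemma sturmian_cocycle_no_defect:
  assumes \<alpha>: "\<alpha> \<notin> \<rat>" and \<beta>: "\<beta> \<notin> \<rat>" and n: "n > 0"
    and \<psi>: "sturmian_cocycle \<beta> \<alpha> n \<psi> M"
  shows "\<forall>\<^sub>F K in at_top. defect \<beta> n M r K = 0"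
proof -
  define y z where "y = shift_by r (sturmian_point \<beta>)" and "z = shift_by r (sturmian_twin \<beta>)"
  have y: "y \<in> sturmian \<beta>" and z: "z \<in> sturmian \<beta>"
    unfolding y_def z_def by (simp_all add: shift_by_sturmian sturmian_point_mem sturmian_twin_mem[OF \<beta>])
  have asym: "agree m (shift_by (n * k) y) (shift_by (n * k) z)" if "\<bar>k\<bar> > m + \<bar>r\<bar> + 1" for m k
    unfolding agree_def
  proof (intro allI impI)
    fix i assume i: "\<bar>i\<bar> \<le> m"
    have "1 * \<bar>k\<bar> \<le> n * \<bar>k\<bar>" using n by (intro mult_right_mono) auto
    then have "\<bar>n * k\<bar> > m + \<bar>r\<bar> + 1" using that n by (simp add: abs_mult)
    then have "i + n * k + r \<noteq> 0" "i + n * k + r \<noteq> -1" using i by linarith+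
    then show "shift_by (n * k) y i = shift_by (n * k) z i"
      using sturmian_twin_other by (simp add: y_def z_def shift_by_def)
  qed
  define D where "D k = birkhoff n M y k - birkhoff n M z k" for k
  have D_succ: "D (k + 1) = D k + (M (shift_by (n * k) y) - M (shift_by (n * k) z))" for k
    by (simp add: D_def birkhoff_succ)
  obtain m where "\<forall>x\<in>sturmian \<beta>. \<forall>x'\<in>sturmian \<beta>. agree m x x' \<longrightarrow> M x = M x'"
    using sturmian_cocycle_time_window[OF \<psi>] ..
  note m = this[rule_format]
  have stable: "D (k + 1) = D k" if "\<bar>k\<bar> > m + \<bar>r\<bar> + 1" for k
    using D_succ[of k] m[OF shift_by_sturmian[OF y] shift_by_sturmian[OF z] asym[OF that]] by simp
  \<comment> \<open>Beyond this range the two orbits agree on the window of \<open>M\<close>, so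
    \<open>D\<close> is constant at each end and the defect is
    \<open>D K0 - D (- K0)\<close>.\<close>
  define K0 where "K0 = \<bar>m\<bar> + \<bar>r\<bar> + 2"
  have up: "D k = D K0" if "k \<ge> K0" for k
    using that
  proof (induction k rule: int_ge_induct)
    case (step i)
    then have "D (i + 1) = D i" by (intro stable) (simp add: K0_def)
    with step show ?case by simp
  qed simp
  have down: "D k = D (- K0)" if "k \<le> - K0" for k
    using that
  proof (induction k rule: int_le_induct)
    case (step i)
    then have "D (i - 1 + 1) = D (i - 1)" by (intro stable) (simp add: K0_def)
    with step show ?case by simp
  qed simp
  obtain t where t: "phase \<alpha> (\<psi> y) t"
    using phase_exists[OF sturmian_cocycle_mem[OF \<psi> y]] ..
  obtain u where u: "phase \<alpha> (\<psi> z) u"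
    using phase_exists[OF sturmian_cocycle_mem[OF \<psi> z]] ..
  \<comment> \<open>Far out the image points agree on long windows, so their phases are close.
    Modulo 1 each phase has moved by its own number of steps times \<open>frac \<alpha>\<close>, and
    the numbers of steps differ by \<open>n * D k\<close>.\<close>
  have close: "\<exists>K1. \<forall>k. \<bar>k\<bar> \<ge> K1 \<longrightarrow> (\<exists>c::int. \<bar>t - u + of_int (n * D k) * frac \<alpha> - of_int c\<bar> \<le> \<epsilon>)"
    if \<epsilon>: "\<epsilon> > 0" for \<epsilon>
  proof -
    obtain l where l: "\<forall>y z t u. phase \<alpha> y t \<longrightarrow> phase \<alpha> z u \<longrightarrow> agree l y z \<longrightarrow> \<bar>t - u\<bar> \<le> \<epsilon>"
      using phase_continuous[OF \<alpha> \<epsilon>] ..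
    obtain l' where "\<forall>x\<in>sturmian \<beta>. \<forall>x'\<in>sturmian \<beta>. agree l' x x' \<longrightarrow> agree l (\<psi> x) (\<psi> x')"
      using sturmian_cocycle_window[OF \<psi>] ..
    note l' = this[rule_format]
    have "\<exists>c::int. \<bar>t - u + of_int (n * D k) * frac \<alpha> - of_int c\<bar> \<le> \<epsilon>" if k: "\<bar>k\<bar> \<ge> \<bar>l'\<bar> + \<bar>r\<bar> + 2" for k
    proof -
      have "agree l' (shift_by (n * k) y) (shift_by (n * k) z)" using k by (intro asym) linarith
      then have "agree l (\<psi> (shift_by (n * k) y)) (\<psi> (shift_by (n * k) z))"
        using y z by (intro l') (simp_all add: shift_by_sturmian)
      then have "agree l (shift_by (n * birkhoff n M y k) (\<psi> y)) (shift_by (n * birkhoff n M z k) (\<psi> z))"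
        by (simp only: sturmian_cocycle_iterate[OF \<psi> y] sturmian_cocycle_iterate[OF \<psi> z])
      from l[rule_format, OF phase_shift_by[OF t] phase_shift_by[OF u] this]
      show ?thesis
        by (intro exI[of _ "word_count (\<psi> y) (n * birkhoff n M y k) - word_count (\<psi> z) (n * birkhoff n M z k)"])
          (simp add: D_def algebra_simps)
    qed
    then show ?thesis by blast
  qed
  \<comment> \<open>The unknown offset \<open>t - u\<close> is the same at both ends and drops out
    of the difference.\<close>
  have "of_int (n * (D K0 - D (- K0))) * frac \<alpha> \<in> \<int>"
  proof (rule Ints_if_arbitrarily_close)
    fix \<epsilon> :: real assume "\<epsilon> > 0"
    then obtain K1 where K1: "\<And>k. \<bar>k\<bar> \<ge> K1 \<Longrightarrow> \<exists>c::int. \<bar>t - u + of_int (n * D k) * frac \<alpha> - of_int c\<bar> \<le> \<epsilon> / 2"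
      using close[of "\<epsilon> / 2"] by auto
    define K where "K = max K0 \<bar>K1\<bar>"
    have "K0 \<ge> 0" by (simp add: K0_def)
    then have K: "K \<ge> K0" "- K \<le> - K0" "\<bar>K\<bar> \<ge> K1" "\<bar>- K\<bar> \<ge> K1" by (auto simp: K_def)
    obtain c c' :: int where
      "\<bar>t - u + of_int (n * D K) * frac \<alpha> - of_int c\<bar> \<le> \<epsilon> / 2"
      "\<bar>t - u + of_int (n * D (- K)) * frac \<alpha> - of_int c'\<bar> \<le> \<epsilon> / 2"
      using K1[OF K(3)] K1[OF K(4)] by blast
    then have cc: "\<bar>t - u + of_int (n * D K0) * frac \<alpha> - of_int c\<bar> \<le> \<epsilon> / 2"
      "\<bar>t - u + of_int (n * D (- K0)) * frac \<alpha> - of_int c'\<bar> \<le> \<epsilon> / 2"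
      unfolding up[OF K(1)] down[OF K(2)] .
    have "of_int (n * (D K0 - D (- K0))) * frac \<alpha> = of_int (n * D K0) * frac \<alpha> - of_int (n * D (- K0)) * frac \<alpha>"
      by (simp add: algebra_simps)
    then have "\<bar>of_int (n * (D K0 - D (- K0))) * frac \<alpha> - of_int (c - c')\<bar> \<le> \<epsilon>"
      using cc by (simp only: of_int_diff)
    then show "\<exists>c::int. \<bar>of_int (n * (D K0 - D (- K0))) * frac \<alpha> - of_int c\<bar> \<le> \<epsilon>" by blast
  qed
  from irrational_multiple_Ints[OF irrational_frac[OF \<alpha>] this] n have D: "D K0 = D (- K0)" by simp
  have "defect \<beta> n M r K = 0" if "K \<ge> K0" for K
  proof -
    have "K \<ge> 0" using that by (simp add: K0_def)
    have "defect \<beta> n M r K = (\<Sum>k\<in>{-K..<K}. M (shift_by (n * k) y) - M (shift_by (n * k) z))"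
      by (simp add: defect_def y_def z_def)
    also have "\<dots> = (\<Sum>k\<in>{-K..<K}. D (k + 1) - D k)" by (simp add: D_succ)
    also have "\<dots> = D K - D (- K)"
      using \<open>K \<ge> 0\<close> by (simp add: sum_symmetric_interval_ssum ssum_telescope)
    also have "\<dots> = 0" using up[OF that] down[of "- K"] that D by simp
    finally show ?thesis .
  qed
  then show ?thesis unfolding eventually_at_top_linorder by blast
qed

text \<open>Pulling back 1 and the coordinate expresses \<mu> and \<open>a * \<mu>\<close> through 1
  and \<open>b\<close>, and \<nu> and \<open>b * \<nu>\<close> through 1 and \<open>a\<close>. As
  \<open>\<mu> * \<nu> = 1\<close>, the two integral matrices are inverse to each other, and the row
  of \<mu> carries the factor \<open>n\<close>.\<close>

lemma flow_equivalent_imp_modular_relation: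
  assumes \<alpha>: "\<alpha> \<notin> \<rat>" and \<beta>: "\<beta> \<notin> \<rat>" and n: "n \<ge> 1"
    and eq: "flow_equivalent (sturmian_space \<alpha>) (sturmian_map \<alpha> ^^ n) (sturmian_space \<beta>) (sturmian_map \<beta> ^^ n)"
  shows "\<exists>a b c d. modular_relation n (frac \<alpha>) (frac \<beta>) a b c d"
proof -
  have zd: "zero_dimensional (sturmian_space \<gamma>)" for \<gamma>
    by (subst sturmian_space_eq) (rule zero_dimensional_subshift)
  obtain \<phi> N \<psi> M B j where
    oc: "orbit_cocycle (sturmian_space \<alpha>) (sturmian_map \<alpha> ^^ n) (sturmian_space \<beta>) (sturmian_map \<beta> ^^ n) \<phi> N"
      "orbit_cocycle (sturmian_space \<beta>) (sturmian_map \<beta> ^^ n) (sturmian_space \<alpha>) (sturmian_map \<alpha> ^^ n) \<psi> M"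
    and j: "\<And>x. x \<in> sturmian \<alpha> \<Longrightarrow> x = int_iterate (sturmian_space \<alpha>) (sturmian_map \<alpha> ^^ n) (j x) (\<psi> (\<phi> x))"
      "\<And>x. x \<in> sturmian \<alpha> \<Longrightarrow> \<bar>j x\<bar> \<le> (B::int)"
    using flow_equivalent_imp_orbit_cocycles[OF compact_space_sturmian zd homeomorphic_map_sturmian_map_pow
        compact_space_sturmian zd homeomorphic_map_sturmian_map_pow eq] by blast
  define m where "m = int n"
  have m: "m > 0" using n by (simp add: m_def)
  have \<phi>: "sturmian_cocycle \<alpha> \<beta> m \<phi> N" and \<psi>: "sturmian_cocycle \<beta> \<alpha> m \<psi> M"
    unfolding m_def using oc[THEN orbit_cocycle_imp_sturmian_cocycle] by simp_all
  have j': "x = shift_by (m * j x) (\<psi> (\<phi> x))" if x: "x \<in> sturmian \<alpha>" for x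
  proof -
    have "\<psi> (\<phi> x) \<in> sturmian \<alpha>" by (intro sturmian_cocycle_mem[OF \<psi>] sturmian_cocycle_mem[OF \<phi>] x)
    from int_iterate_sturmian[OF this, of n "j x"] show ?thesis using j(1)[OF x] by (simp add: m_def)
  qed
  define a b where "a = frac \<alpha>" and "b = frac \<beta>"
  have b: "b \<notin> \<rat>" using irrational_frac[OF \<beta>] by (simp add: b_def)
  have ne: "sturmian \<gamma> \<noteq> {}" for \<gamma> using sturmian_point_mem by blast
  obtain p q where M: "has_mean (sturmian \<beta>) m M (of_int p + of_int (m * q) * b)"
    using coordinate_span_mean_no_defect[OF \<beta> m coordinate_span_sturmian_cocycle[OF \<psi>]
        sturmian_cocycle_no_defect[OF \<alpha> \<beta> m \<psi>]] unfolding b_def by blast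
  obtain p' q' where N: "has_mean (sturmian \<alpha>) m N (of_int p' + of_int q' * a)"
    using coordinate_span_mean[OF \<alpha> m coordinate_span_sturmian_cocycle[OF \<phi>]] unfolding a_def by blast
  define \<mu> \<nu> where "\<mu> = of_int p + of_int (m * q) * b" and "\<nu> = of_int p' + of_int q' * a"
  note M = M[folded \<mu>_def] and N = N[folded \<nu>_def]
  have \<mu>\<nu>: "\<mu> * \<nu> = 1"
    by (rule sturmian_cocycle_means_inverse[OF \<alpha> m \<phi> \<psi> j' j(2) N M])
  have coord: "has_mean (sturmian \<alpha>) m (\<lambda>y. int (y 0)) a" "has_mean (sturmian \<beta>) m (\<lambda>y. int (y 0)) b"
    unfolding a_def b_def using has_mean_coordinate \<alpha> \<beta> m by auto
  obtain p2 q2 where "has_mean (sturmian \<alpha>) m (pull_back m \<phi> N (\<lambda>y. int (y 0))) (of_int p2 + of_int q2 * a)"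
    using coordinate_span_mean[OF \<alpha> m coordinate_span_pull_back[OF \<phi>]] unfolding a_def by blast
  from has_mean_unique[OF has_mean_pull_back[OF \<phi> N coord(2)] this ne]
  have b\<nu>: "b * \<nu> = of_int p2 + of_int q2 * a" .
  obtain p3 q3 where "has_mean (sturmian \<beta>) m (pull_back m \<psi> M (\<lambda>y. int (y 0))) (of_int p3 + of_int q3 * b)"
    using coordinate_span_mean[OF \<beta> m coordinate_span_pull_back[OF \<psi>]] unfolding b_def by blast
  from has_mean_unique[OF has_mean_pull_back[OF \<psi> M coord(1)] this ne]
  have a\<mu>: "a * \<mu> = of_int p3 + of_int q3 * b" .
  have "1 = of_int p' * \<mu> + of_int q' * (a * \<mu>)"
    using \<mu>\<nu> unfolding \<nu>_def by (simp add: algebra_simps)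
  then have "of_int (p' * p + q' * p3) + of_int (p' * (m * q) + q' * q3) * b = of_int 1 + of_int 0 * b"
    unfolding a\<mu> unfolding \<mu>_def by (simp add: algebra_simps)
  from irrational_linear_eq_iff[OF b this]
  have 1: "p' * p + q' * p3 = 1" "p' * (m * q) + q' * q3 = 0" .
  have "b = (b * \<nu>) * \<mu>" using \<mu>\<nu> by (simp add: mult_ac)
  also have "\<dots> = of_int p2 * \<mu> + of_int q2 * (a * \<mu>)" unfolding b\<nu> by (simp add: algebra_simps)
  finally have "of_int (p2 * p + q2 * p3) + of_int (p2 * (m * q) + q2 * q3) * b = of_int 0 + of_int 1 * b"
    unfolding a\<mu> unfolding \<mu>_def by (simp add: algebra_simps)
  from irrational_linear_eq_iff[OF b this]
  have 2: "p2 * p + q2 * p3 = 0" "p2 * (m * q) + q2 * q3 = 1" .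
  \<comment> \<open>Multiplicativity of the determinant for the product of the two matrices, which
    has just been found to be the identity.\<close>
  have "(p' * q2 - q' * p2) * (p * q3 - (m * q) * p3) =
      (p' * p + q' * p3) * (p2 * (m * q) + q2 * q3) - (p' * (m * q) + q' * q3) * (p2 * p + q2 * p3)"
    by (simp add: algebra_simps)
  then have "(p' * q2 - q' * p2) * (p * q3 - (m * q) * p3) = 1" by (simp only: 1 2)
  then have "\<bar>p * q3 - (m * q) * p3\<bar> = 1" by (auto simp: zmult_eq_1_iff)
  then have "modular_relation n a b p (m * q) p3 q3"
    using a\<mu> by (simp add: modular_relation_def \<mu>_def m_def)
  then show ?thesis unfolding a_def b_def by blast
qed

section \<open>Conjugacy\<close>

definition suspension_map :: "('a \<Rightarrow> 'b) \<Rightarrow> ('a \<times> real) set \<Rightarrow> ('b \<times> real) set" where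
  "suspension_map h c = (\<lambda>(x, s). (h x, s)) ` c"

lemma suspension_map_class:
  assumes S: "homeomorphic_map X X S" and T: "homeomorphic_map Y Y T" and h: "h ` topspace X \<subseteq> topspace Y"
    and comm: "\<And>x. x \<in> topspace X \<Longrightarrow> h (S x) = T (h x)" and x: "x \<in> topspace X"
  shows "suspension_map h (suspension_class X S (x, s)) = suspension_class Y T (h x, s)"
proof -
  note bS = homeomorphic_map_bij_betw[OF S] and bT = homeomorphic_map_bij_betw[OF T]
  have "int_iterate Y T k (h x) = h (int_iterate X S k x)" for k
    using int_iterate_unique[OF bT, of "\<lambda>k. h (int_iterate X S k x)" k] h x
    by (simp add: int_iterate_mem[OF bS x] int_iterate_succ[OF bS x] comm image_subset_iff)
  then show ?thesis by (simp add: suspension_map_def suspension_class_def image_image)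
qed

lemma continuous_map_suspension_map:
  assumes S: "homeomorphic_map X X S" and T: "homeomorphic_map Y Y T" and h: "continuous_map X Y h"
    and comm: "\<And>x. x \<in> topspace X \<Longrightarrow> h (S x) = T (h x)"
  shows "continuous_map (suspension X S) (suspension Y T) (suspension_map h)"
proof (rule continuous_compose_quotient_map[OF quotient_map_suspension])
  have "continuous_map (prod_topology X euclideanreal) (prod_topology Y euclideanreal) (\<lambda>p. (h (fst p), snd p))"
    by (intro continuous_map_pairedI continuous_map_compose[OF continuous_map_fst h, unfolded o_def] continuous_map_snd)
  from continuous_map_compose[OF this quotient_imp_continuous_map[OF quotient_map_suspension[of Y T]]]
  show "continuous_map (prod_topology X euclideanreal) (suspension Y T) (suspension_map h \<circ> suspension_class X S)"
  proof (rule continuous_map_eq)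
    fix p assume "p \<in> topspace (prod_topology X euclideanreal)"
    then have "fst p \<in> topspace X" by auto
    from suspension_map_class[OF S T continuous_map_image_subset_topspace[OF h] comm this, of "snd p"]
    show "(suspension_class Y T \<circ> (\<lambda>p. (h (fst p), snd p))) p = (suspension_map h \<circ> suspension_class X S) p"
      by simp
  qed
qed

lemma topologically_conjugate_imp_flow_equivalent:
  assumes S: "homeomorphic_map X X S" and T: "homeomorphic_map Y Y T"
    and conj: "topologically_conjugate X S Y T"
  shows "flow_equivalent X S Y T"
proof -
  obtain h where hm: "homeomorphic_map X Y h" and comm: "\<And>x. x \<in> topspace X \<Longrightarrow> h (S x) = T (h x)"
    using conj by (auto simp: topologically_conjugate_def)
  obtain g where hg: "homeomorphic_maps X Y h g" using hm homeomorphic_map_maps by blast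
  then have ch: "continuous_map X Y h" and cg: "continuous_map Y X g"
    and gh: "\<And>x. x \<in> topspace X \<Longrightarrow> g (h x) = x" and hg: "\<And>y. y \<in> topspace Y \<Longrightarrow> h (g y) = y"
    by (auto simp: homeomorphic_maps_def)
  note ih = continuous_map_image_subset_topspace[OF ch] and ig = continuous_map_image_subset_topspace[OF cg]
  have comm': "g (T y) = S (g y)" if y: "y \<in> topspace Y" for y
  proof -
    have gy: "g y \<in> topspace X" using ig y by blast
    then have "S (g y) \<in> topspace X" using homeomorphic_map_bij_betw[OF S] by (auto dest: bij_betwE)
    from gh[OF this] show ?thesis by (simp add: comm[OF gy] hg[OF y])
  qed
  let ?H = "suspension_map h" and ?G = "suspension_map g"
  have H: "?H (suspension_class X S (x, s)) = suspension_class Y T (h x, s)" if "x \<in> topspace X" for x s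
    by (rule suspension_map_class[OF S T ih comm that])
  have G: "?G (suspension_class Y T (y, s)) = suspension_class X S (g y, s)" if "y \<in> topspace Y" for y s
    by (rule suspension_map_class[OF T S ig comm' that])
  have "?G (?H c) = c" if "c \<in> topspace (suspension X S)" for c
    using that ih gh by (auto simp: topspace_suspension H G image_subset_iff)
  moreover have "?H (?G c) = c" if "c \<in> topspace (suspension Y T)" for c
    using that ig hg by (auto simp: topspace_suspension H G image_subset_iff)
  ultimately have "homeomorphic_maps (suspension X S) (suspension Y T) ?H ?G"
    unfolding homeomorphic_maps_def
    using continuous_map_suspension_map[OF S T ch comm] continuous_map_suspension_map[OF T S cg comm'] by blast
  then have "homeomorphic_map (suspension X S) (suspension Y T) ?H" by (rule homeomorphic_maps_imp_map)
  moreover have "?H ` flow_orbit c = flow_orbit (?H c) \<and>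
      (\<exists>\<theta>::real \<Rightarrow> real. homeomorphic_map euclideanreal euclideanreal \<theta> \<and> strict_mono \<theta> \<and>
         (\<forall>t. ?H (suspension_flow t c) = suspension_flow (\<theta> t) (?H c)))"
    if c: "c \<in> topspace (suspension X S)" for c
  proof -
    obtain x s where x: "x \<in> topspace X" and c_eq: "c = suspension_class X S (x, s)"
      using c by (auto simp: topspace_suspension)
    have flow: "?H (suspension_flow t c) = suspension_flow t (?H c)" for t
      unfolding c_eq by (simp add: H x suspension_flow_class)
    then have "?H ` flow_orbit c = flow_orbit (?H c)" by (simp add: flow_orbit_def image_image)
    moreover have "homeomorphic_map euclideanreal euclideanreal (\<lambda>t::real. t)"
      using homeomorphic_map_id[of euclideanreal euclideanreal] by (simp add: id_def)
    moreover have "strict_mono (\<lambda>t::real. t)" by (simp add: strict_mono_def)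
    ultimately show ?thesis using flow by blast
  qed
  ultimately show ?thesis unfolding flow_equivalent_def by blast
qed

lemma topologically_conjugate_funpow:
  assumes S: "homeomorphic_map X X S" and conj: "topologically_conjugate X S Y T"
  shows "topologically_conjugate X (S ^^ n) Y (T ^^ n)"
proof -
  obtain h where hm: "homeomorphic_map X Y h" and comm: "\<And>x. x \<in> topspace X \<Longrightarrow> h (S x) = T (h x)"
    using conj by (auto simp: topologically_conjugate_def)
  have "(S ^^ n) x \<in> topspace X \<and> h ((S ^^ n) x) = (T ^^ n) (h x)" if "x \<in> topspace X" for x
    using that homeomorphic_map_bij_betw[OF S] comm by (induction n) (auto dest: bij_betwE)
  with hm show ?thesis unfolding topologically_conjugate_def by blast
qed

section \<open>The exchange of the two symbols\<close>

definition flip :: "(int \<Rightarrow> nat) \<Rightarrow> int \<Rightarrow> nat" where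
  "flip y = (\<lambda>i. 1 - y i)"

lemma flip_flip:
  assumes "y \<in> sturmian \<alpha>"
  shows "flip (flip y) = y"
proof
  fix i
  show "flip (flip y) i = y i" using sturmian_01[OF assms, of i] by (auto simp: flip_def)
qed

lemma agree_flip: "agree m y z \<Longrightarrow> agree m (flip y) (flip z)"
  by (simp add: agree_def flip_def)

lemma shift_by_flip: "shift_by k (flip y) = flip (shift_by k y)"
  by (simp add: shift_by_def flip_def)

text \<open>For nonzero \<open>i\<close> the floor of \<open>i * (1 - a)\<close> is
  \<open>i - \<lfloor>i * a\<rfloor> - 1\<close>, but the term -1 is missing at
  \<open>i = 0\<close>. Reversing the rotation thus exchanges the boundary conventions, which
  produces the twin.\<close>

lemma flip_sturmian_point:
  assumes \<alpha>: "\<alpha> \<notin> \<rat>" and eq: "frac \<beta> = 1 - frac \<alpha>"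
  shows "flip (sturmian_point \<beta>) = sturmian_twin \<alpha>"
proof
  fix i
  define a where "a = frac \<alpha>"
  have a: "a \<notin> \<rat>" using irrational_frac[OF \<alpha>] by (simp add: a_def)
  have fl: "\<lfloor>of_int i * (1 - a)\<rfloor> = i - \<lfloor>of_int i * a\<rfloor> - (if i = 0 then 0 else 1)" for i
  proof (cases "i = 0")
    case False
    then have "of_int i * a \<notin> \<int>" using irrational_multiple_Ints[OF a] by blast
    then have "of_int \<lfloor>of_int i * a\<rfloor> \<noteq> of_int i * a" by (metis Ints_of_int)
    then have "\<lfloor>of_int i * a\<rfloor> < of_int i * a" by (metis of_int_floor_le order_less_le)
    then have "\<lfloor>of_int i - of_int i * a\<rfloor> = i - \<lfloor>of_int i * a\<rfloor> - 1"
      by (intro floor_unique) (simp_all, linarith+)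
    with False show ?thesis by (simp add: algebra_simps)
  qed simp
  have b: "frac \<beta> = 1 - a" using eq by (simp add: a_def)
  have p: "sturmian_point \<beta> i \<le> 1" by (simp add: sturmian_point_def)
  have "int (flip (sturmian_point \<beta>) i) = 1 - int (sturmian_point \<beta> i)"
    using p by (simp add: flip_def of_nat_diff)
  also have "\<dots> = int (sturmian_twin \<alpha> i)"
    unfolding int_sturmian_twin[OF \<alpha>] int_sturmian_point b fl a_def[symmetric] by auto
  finally show "flip (sturmian_point \<beta>) i = sturmian_twin \<alpha> i" by simp
qed

text \<open>The exchange sends the coding point to the twin, so membership rests on the twin
  belonging to the system.\<close>

lemma flip_mem:
  assumes \<alpha>: "\<alpha> \<notin> \<rat>" and eq: "frac \<beta> = 1 - frac \<alpha>" and y: "y \<in> sturmian \<beta>"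
  shows "flip y \<in> sturmian \<alpha>"
  unfolding sturmian_iff
proof
  fix m
  obtain k where "agree m y (shift_by k (sturmian_point \<beta>))" using y sturmian_iff by blast
  from agree_flip[OF this] have 1: "agree m (flip y) (shift_by k (sturmian_twin \<alpha>))"
    by (simp add: shift_by_flip[symmetric] flip_sturmian_point[OF \<alpha> eq])
  obtain k' where "agree m (shift_by k (sturmian_twin \<alpha>)) (shift_by k' (sturmian_point \<alpha>))"
    using shift_by_sturmian[OF sturmian_twin_mem[OF \<alpha>]] sturmian_iff by blast
  from agree_trans[OF 1 this] show "\<exists>k. agree m (flip y) (shift_by k (sturmian_point \<alpha>))" ..
qed

lemma continuous_map_flip: "continuous_map full_shift full_shift flip"
proof -
  have "continuous_map full_shift (discrete_topology {0, 1}) (\<lambda>y. flip y i)" for i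
  proof -
    have "continuous_map (discrete_topology {0, 1}) (discrete_topology {0, 1}) (\<lambda>b::nat. 1 - b)" by auto
    from continuous_map_compose[OF continuous_map_coordinate this] show ?thesis
      by (simp add: o_def flip_def)
  qed
  then show ?thesis
    by (subst (2) full_shift_def) (simp only: continuous_map_componentwise_UNIV simp_thms)
qed

text \<open>Both fractional parts lie strictly between 0 and 1, so \<open>k\<close> is 0 in the
  first case and 1 in the second.\<close>

lemma sturmian_conjugate_if_frac:
  assumes \<alpha>: "\<alpha> \<notin> \<rat>" and \<beta>: "\<beta> \<notin> \<rat>" and k: "frac \<alpha> = frac \<beta> + of_int k \<or> frac \<alpha> = - frac \<beta> + of_int k"
  shows "topologically_conjugate (sturmian_space \<alpha>) (sturmian_map \<alpha>) (sturmian_space \<beta>) (sturmian_map \<beta>)"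
proof -
  have bounds: "0 < frac \<alpha>" "frac \<alpha> < 1" "0 < frac \<beta>" "frac \<beta> < 1"
    using frac_irrational_pos \<alpha> \<beta> frac_lt_1 by auto
  from k show ?thesis
  proof
    assume eq: "frac \<alpha> = frac \<beta> + of_int k"
    then have "\<bar>real_of_int k\<bar> < 1" using bounds by linarith
    then have "k = 0" by linarith
    then have "int (sturmian_point \<alpha> i) = int (sturmian_point \<beta> i)" for i
      using eq by (simp add: int_sturmian_point)
    then have point: "sturmian_point \<alpha> = sturmian_point \<beta>" by (intro ext) simp
    have space: "sturmian_space \<alpha> = sturmian_space \<beta>"
      by (simp only: sturmian_space_def sturmian_orbit_def point)
    then have map: "sturmian_map \<alpha> = sturmian_map \<beta>" by (simp only: sturmian_map_def)
    show ?thesis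
      unfolding topologically_conjugate_def space map by (intro exI[of _ id]) simp
  next
    assume eq: "frac \<alpha> = - frac \<beta> + of_int k"
    then have "0 < real_of_int k" "real_of_int k < 2" using bounds by linarith+
    then have "k = 1" by linarith
    with eq have ba: "frac \<beta> = 1 - frac \<alpha>" and ab: "frac \<alpha> = 1 - frac \<beta>" by simp_all
    have cont: "continuous_map (sturmian_space \<gamma>) (sturmian_space \<delta>) flip"
      if "\<And>y. y \<in> sturmian \<gamma> \<Longrightarrow> flip y \<in> sturmian \<delta>" for \<gamma> \<delta>
    proof -
      have "continuous_map (sturmian_space \<gamma>) full_shift flip"
        by (subst sturmian_space_eq) (rule continuous_map_from_subtopology[OF continuous_map_flip])
      then have "continuous_map (sturmian_space \<gamma>) (subtopology full_shift (sturmian \<delta>)) flip"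
        by (rule continuous_map_into_subtopology) (use that in blast)
      then show ?thesis by (simp only: sturmian_space_eq[symmetric])
    qed
    have "homeomorphic_maps (sturmian_space \<alpha>) (sturmian_space \<beta>) flip flip"
      unfolding homeomorphic_maps_def
      by (intro conjI ballI cont flip_mem[OF \<beta> ab] flip_mem[OF \<alpha> ba] flip_flip)
    then have "homeomorphic_map (sturmian_space \<alpha>) (sturmian_space \<beta>) flip"
      by (rule homeomorphic_maps_imp_map)
    moreover have "flip (sturmian_map \<alpha> x) = sturmian_map \<beta> (flip x)" if x: "x \<in> sturmian \<alpha>" for x
      using x flip_mem[OF \<beta> ab x] by (simp add: sturmian_map_def shift_def[abs_def] flip_def)
    ultimately show ?thesis unfolding topologically_conjugate_def by blast
  qed
qed

theorem theorem1p7: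
  fixes \<alpha> \<beta> :: real
  assumes "\<alpha> \<notin> \<rat>" and "\<beta> \<notin> \<rat>"
  shows "eventually_flow_equivalent (sturmian_space \<alpha>) (sturmian_map \<alpha>)
             (sturmian_space \<beta>) (sturmian_map \<beta>)
         \<longleftrightarrow> topologically_conjugate (sturmian_space \<alpha>) (sturmian_map \<alpha>)
             (sturmian_space \<beta>) (sturmian_map \<beta>)"
proof
  assume "eventually_flow_equivalent (sturmian_space \<alpha>) (sturmian_map \<alpha>)
             (sturmian_space \<beta>) (sturmian_map \<beta>)"
  then obtain n0 where n0: "\<And>n. n \<in> {n. n \<ge> 1 \<and> \<not> flow_equivalent (sturmian_space \<alpha>) (sturmian_map \<alpha> ^^ n)
      (sturmian_space \<beta>) (sturmian_map \<beta> ^^ n)} \<Longrightarrow> n < n0"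
    unfolding eventually_flow_equivalent_def finite_nat_set_iff_bounded by blast
  \<comment> \<open>Starting at \<open>n0 + 1\<close> avoids the finitely many exceptional exponents
    and ensures \<open>n \<ge> 1\<close>.\<close>
  have "\<exists>a b c d. modular_relation n (frac \<alpha>) (frac \<beta>) a b c d" if "n \<ge> n0 + 1" for n
    using n0[of n] that by (intro flow_equivalent_imp_modular_relation assms) auto
  from eventually_modular_relation_imp[OF irrational_frac[OF assms(1)] irrational_frac[OF assms(2)] this]
  obtain k :: int where "frac \<alpha> = frac \<beta> + of_int k \<or> frac \<alpha> = - frac \<beta> + of_int k" ..
  from sturmian_conjugate_if_frac[OF assms this]
  show "topologically_conjugate (sturmian_space \<alpha>) (sturmian_map \<alpha>)
             (sturmian_space \<beta>) (sturmian_map \<beta>)" .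
next
  assume conj: "topologically_conjugate (sturmian_space \<alpha>) (sturmian_map \<alpha>)
             (sturmian_space \<beta>) (sturmian_map \<beta>)"
  have "homeomorphic_map (sturmian_space \<alpha>) (sturmian_space \<alpha>) (sturmian_map \<alpha>)"
    using dynamical_system_sturmian by (simp add: dynamical_system_def)
  from topologically_conjugate_funpow[OF this conj]
  have "flow_equivalent (sturmian_space \<alpha>) (sturmian_map \<alpha> ^^ n) (sturmian_space \<beta>) (sturmian_map \<beta> ^^ n)" for n
    by (intro topologically_conjugate_imp_flow_equivalent homeomorphic_map_sturmian_map_pow)
  then show "eventually_flow_equivalent (sturmian_space \<alpha>) (sturmian_map \<alpha>)
             (sturmian_space \<beta>) (sturmian_map \<beta>)"
    by (simp add: eventually_flow_equivalent_def)
qed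

end
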